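(* Let $u\in C^2[0,\pi]$ with $u(x)>0$ for all $x\in[0,\pi]$, let $p,q\in\mathbb{N}^+$ with $\gcd(p,q)=1$ and $p$ even, $T=2\pi p/q$, $\Omega=(0,T)\times(0,\pi)$, and let $f\in C(\Omega\times\mathbb{R},\mathbb{R})$ be $T$-periodic in $t$. Put $\hat f(t,x,y)=f(t,x,y)/u(x)$ and assume that for every $R>0$ there is $h_R\in L^2(\Omega)$ with $|\hat f(t,x,y)|\le h_R(t,x)$ for $|y|\le R$. Let $\underline{\lambda}<\bar{\lambda}$ be two consecutive elements of $\Lambda(L_o)$, and let $\alpha,\beta\in\mathcal{M}_e\cap L^\infty(\Omega)$ satisfy $\underline{\lambda}\le\alpha(t,x)\le\beta(t,x)\le\bar{\lambda}$ for a.e. $(t,x)\in\Omega$, $\int_\Omega(\alpha-\underline{\lambda})v^2\,dt\,dx>0$ for all $v\in\ker(L_o-\underline{\lambda}I)\setminus\{0\}$, and $\int_\Omega(\bar{\lambda}-\beta)w^2\,dt\,dx>0$ for all $w\in\ker(L_o-\bar{\lambda}I)\setminus\{0\}$. Suppose $\hat f(t,x,y)=\hat f(t+T/2,x,y)$ and $\hat f(t,x,-y)=-\hat f(t,x,y)$, and $$\alpha(t,x)\le\frac{\hat f(t,x,y)-\hat f(t,x,z)}{y-z}\le\beta(t,x)$$ for all $y\ne z$ and a.e. $(t,x)\in\Omega$. Then the problem $u(x)y_{tt}-(u(x)y_x)_x=f(t,x,y)$ in $\Omega$, $y(0,x)=y(T,x)$, $y_t(0,x)=y_t(T,x)$, $y(t,0)=y(t,\pi)=0$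 has only one (the trivial) solution in $\mathcal{M}_o$.
   Context: Functions on $\Omega$ are identified with their $T$-periodic extensions in $t$. $L^2(\Omega)$ is the space of real measurable $y$ with $\int_\Omega u|y|^2dt\,dx<\infty$, inner product $\langle y,z\rangle=\int_\Omega u\,y\,z\,dt\,dx$. Solutions are weak solutions: $y\in L^2(\Omega)$ with $\int_\Omega y(u\psi_{tt}-(u\psi_x)_x)\,dt\,dx-\int_\Omega f(t,x,y)\psi\,dt\,dx=0$ for all $\psi\in C^\infty(\Omega)$ with $\psi(t,0)=\psi(t,\pi)=0$, $\psi(0,x)=\psi(T,x)$, $\psi_t(0,x)=\psi_t(T,x)$. Let $\lambda_1^2<\lambda_2^2<\cdots$ be the eigenvalues of $(u\varphi')'=-\lambda^2u\varphi$, $\varphi(0)=\varphi(\pi)=0$, with eigenfunctions $\varphi_n$, $\int_0^\pi u\varphi_n^2=1$. With $T_0=1/\sqrt T$, $T_m=\sqrt{2/T}$ ($m\ge1$), the functions $T_m\varphi_n\cos\frac{q}{p}mt$, $T_m\varphi_n\sin\frac{q}{p}mt$ ($m\in\mathbb{N}$, $n\in\mathbb{N}^+$) form a complete orthonormal system, $y=\sum_{n,m}T_m\varphi_n(a_{mn}\cos\frac{q}{p}mt+b_{mn}\sin\frac{q}{p}mt)$. Put $\mu_{mn}=\lambda_n^2-(\frac{q}{p}m)^2$, $\mathcal{D}(L)=\{y:\sum\mu_{mn}^2(a_{mn}^2+b_{mn}^2)<\infty\}$, $Ly=\sum\mu_{mn}T_m\varphi_n(a_{mn}\cos\frac{q}{p}mt+b_{mn}\sin\frac{q}{p}mt)$.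 $\mathcal{M}_o=\{y\in L^2(\Omega): y(t,x)=-y(t+T/2,x)\}$, $\mathcal{M}_e=\{y\in L^2(\Omega): y(t,x)=y(t+T/2,x)\}$. $L_o$ is the restriction of $L$ to $\mathcal{D}(L)\cap\mathcal{M}_o$; $\Lambda(L_o)=\{\mu_{mn}: m\text{ odd}, n\in\mathbb{N}^+\}$; consecutive means no element of $\Lambda(L_o)$ lies strictly between; $\ker(L_o-\lambda I)=\{y\in\mathcal{D}(L)\cap\mathcal{M}_o: Ly=\lambda y\}$. *)

theory Defs
  imports "HOL-Analysis.Analysis"
begin

definition Tper :: "nat \<Rightarrow> nat \<Rightarrow> real" where
  "Tper p q = 2 * pi * real p / real q"

definition Omega :: "real \<Rightarrow> (real \<times> real) set" where
  "Omega T = {0<..<T} \<times> {0<..<pi}"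

definition C2_on :: "real set \<Rightarrow> (real \<Rightarrow> real) \<Rightarrow> bool" where
  "C2_on S u \<longleftrightarrow> (\<exists>u1 u2.
     (\<forall>x\<in>S. (u has_real_derivative u1 x) (at x within S)
            \<and> (u1 has_real_derivative u2 x) (at x within S))
     \<and> continuous_on S u2)"

definition L2u :: "(real \<Rightarrow> real) \<Rightarrow> real \<Rightarrow> (real \<times> real \<Rightarrow> real) \<Rightarrow> bool" where
  "L2u u T y \<longleftrightarrow> set_borel_measurable lebesgue (Omega T) y
     \<and> set_integrable lebesgue (Omega T) (\<lambda>z. u (snd z) * (y z)\<^sup>2)"

definition pext :: "real \<Rightarrow> (real \<times> real \<Rightarrow> real) \<Rightarrow> real \<times> real \<Rightarrow> real" where
  "pext T y z = y (fst z - T * of_int \<lfloor>fst z / T\<rfloor>, snd z)"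

definition Mo :: "(real \<Rightarrow> real) \<Rightarrow> real \<Rightarrow> (real \<times> real \<Rightarrow> real) \<Rightarrow> bool" where
  "Mo u T y \<longleftrightarrow> L2u u T y \<and>
     (AE z in lebesgue. z \<in> Omega T \<longrightarrow> pext T y z = - pext T y (fst z + T / 2, snd z))"

definition Me :: "(real \<Rightarrow> real) \<Rightarrow> real \<Rightarrow> (real \<times> real \<Rightarrow> real) \<Rightarrow> bool" where
  "Me u T y \<longleftrightarrow> L2u u T y \<and>
     (AE z in lebesgue. z \<in> Omega T \<longrightarrow> pext T y z = pext T y (fst z + T / 2, snd z))"

definition Linf :: "real \<Rightarrow> (real \<times> real \<Rightarrow> real) \<Rightarrow> bool" where
  "Linf T y \<longleftrightarrow> set_borel_measurable lebesgue (Omega T) y \<and>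
     (\<exists>C. AE z in lebesgue. z \<in> Omega T \<longrightarrow> \<bar>y z\<bar> \<le> C)"

definition ae_zero :: "real \<Rightarrow> (real \<times> real \<Rightarrow> real) \<Rightarrow> bool" where
  "ae_zero T y \<longleftrightarrow> (AE z in lebesgue. z \<in> Omega T \<longrightarrow> y z = 0)"

text \<open>mu plays the role of lambda^2.\<close>
definition sl_eigfun :: "(real \<Rightarrow> real) \<Rightarrow> real \<Rightarrow> (real \<Rightarrow> real) \<Rightarrow> bool" where
  "sl_eigfun u mu phi \<longleftrightarrow>
     (\<exists>phi'. \<forall>x\<in>{0..pi}. (phi has_real_derivative phi' x) (at x within {0..pi})
        \<and> ((\<lambda>s. u s * phi' s) has_real_derivative (- mu * u x * phi x)) (at x within {0..pi}))
     \<and> phi 0 = 0 \<and> phi pi = 0 \<and> (\<exists>x\<in>{0..pi}. phi x \<noteq> 0)"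

definition sl_eigs :: "(real \<Rightarrow> real) \<Rightarrow> real set" where
  "sl_eigs u = {mu. \<exists>phi. sl_eigfun u mu phi}"

text \<open>lam2 u n = lambda_n^2, the n-th smallest eigenvalue (n \<ge> 1).\<close>
definition lam2 :: "(real \<Rightarrow> real) \<Rightarrow> nat \<Rightarrow> real" where
  "lam2 u n = (THE mu. mu \<in> sl_eigs u \<and> card {nu \<in> sl_eigs u. nu < mu} = n - 1)"

definition phi :: "(real \<Rightarrow> real) \<Rightarrow> nat \<Rightarrow> real \<Rightarrow> real" where
  "phi u n = (SOME f. sl_eigfun u (lam2 u n) f \<and> integral {0..pi} (\<lambda>x. u x * (f x)\<^sup>2) = 1)"

definition Tm :: "real \<Rightarrow> nat \<Rightarrow> real" where
  "Tm T m = (if m = 0 then 1 / sqrt T else sqrt (2 / T))"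

definition ecos :: "(real \<Rightarrow> real) \<Rightarrow> nat \<Rightarrow> nat \<Rightarrow> nat \<Rightarrow> nat \<Rightarrow> real \<times> real \<Rightarrow> real" where
  "ecos u p q m n z = Tm (Tper p q) m * phi u n (snd z) * cos (real q / real p * real m * fst z)"

definition esin :: "(real \<Rightarrow> real) \<Rightarrow> nat \<Rightarrow> nat \<Rightarrow> nat \<Rightarrow> nat \<Rightarrow> real \<times> real \<Rightarrow> real" where
  "esin u p q m n z = Tm (Tper p q) m * phi u n (snd z) * sin (real q / real p * real m * fst z)"

definition acoef :: "(real \<Rightarrow> real) \<Rightarrow> nat \<Rightarrow> nat \<Rightarrow> (real \<times> real \<Rightarrow> real) \<Rightarrow> nat \<Rightarrow> nat \<Rightarrow> real" where
  "acoef u p q y m n = (LINT z:Omega (Tper p q)|lebesgue. u (snd z) * y z * ecos u p q m n z)"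

definition bcoef :: "(real \<Rightarrow> real) \<Rightarrow> nat \<Rightarrow> nat \<Rightarrow> (real \<times> real \<Rightarrow> real) \<Rightarrow> nat \<Rightarrow> nat \<Rightarrow> real" where
  "bcoef u p q y m n = (LINT z:Omega (Tper p q)|lebesgue. u (snd z) * y z * esin u p q m n z)"

definition mu :: "(real \<Rightarrow> real) \<Rightarrow> nat \<Rightarrow> nat \<Rightarrow> nat \<Rightarrow> nat \<Rightarrow> real" where
  "mu u p q m n = lam2 u n - (real q / real p * real m)\<^sup>2"

definition idx :: "(nat \<times> nat) set" where
  "idx = UNIV \<times> {1..}"

definition inDL :: "(real \<Rightarrow> real) \<Rightarrow> nat \<Rightarrow> nat \<Rightarrow> (real \<times> real \<Rightarrow> real) \<Rightarrow> bool" where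
  "inDL u p q y \<longleftrightarrow> L2u u (Tper p q) y \<and>
     (\<lambda>(m, n). (mu u p q m n)\<^sup>2 * ((acoef u p q y m n)\<^sup>2 + (bcoef u p q y m n)\<^sup>2)) summable_on idx"

text \<open>L y = w in L^2(Omega): the series defining L y converges (unconditionally) to w in L^2.\<close>
definition L_eq :: "(real \<Rightarrow> real) \<Rightarrow> nat \<Rightarrow> nat \<Rightarrow> (real \<times> real \<Rightarrow> real) \<Rightarrow> (real \<times> real \<Rightarrow> real) \<Rightarrow> bool" where
  "L_eq u p q y w \<longleftrightarrow>
     ((\<lambda>F. LINT z:Omega (Tper p q)|lebesgue. u (snd z) *
         (w z - (\<Sum>(m, n)\<in>F. mu u p q m n *
            (acoef u p q y m n * ecos u p q m n z + bcoef u p q y m n * esin u p q m n z)))\<^sup>2)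
      \<longlongrightarrow> 0) (finite_subsets_at_top idx)"

definition ker_Lo :: "(real \<Rightarrow> real) \<Rightarrow> nat \<Rightarrow> nat \<Rightarrow> real \<Rightarrow> (real \<times> real \<Rightarrow> real) set" where
  "ker_Lo u p q lam = {y. inDL u p q y \<and> Mo u (Tper p q) y \<and> L_eq u p q y (\<lambda>z. lam * y z)}"

definition Lambda_Lo :: "(real \<Rightarrow> real) \<Rightarrow> nat \<Rightarrow> nat \<Rightarrow> real set" where
  "Lambda_Lo u p q = {mu u p q m n | m n. odd m \<and> n \<ge> 1}"

fun Ck :: "nat \<Rightarrow> (real \<times> real \<Rightarrow> real) \<Rightarrow> bool" where
  "Ck 0 g = continuous_on UNIV g"
| "Ck (Suc k) g = (\<exists>g'. (\<forall>z. (g has_derivative g' z) (at z)) \<and> (\<forall>v. Ck k (\<lambda>z. g' z v)))"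

definition smooth :: "(real \<times> real \<Rightarrow> real) \<Rightarrow> bool" where
  "smooth g \<longleftrightarrow> (\<forall>k. Ck k g)"

definition dt :: "(real \<times> real \<Rightarrow> real) \<Rightarrow> real \<times> real \<Rightarrow> real" where
  "dt g z = deriv (\<lambda>s. g (s, snd z)) (fst z)"

definition test_fn :: "real \<Rightarrow> (real \<times> real \<Rightarrow> real) \<Rightarrow> bool" where
  "test_fn T psi \<longleftrightarrow> smooth psi
     \<and> (\<forall>t\<in>{0..T}. psi (t, 0) = 0 \<and> psi (t, pi) = 0)
     \<and> (\<forall>x\<in>{0..pi}. psi (0, x) = psi (T, x) \<and> dt psi (0, x) = dt psi (T, x))"

definition Aop :: "(real \<Rightarrow> real) \<Rightarrow> (real \<times> real \<Rightarrow> real) \<Rightarrow> real \<times> real \<Rightarrow> real" where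
  "Aop u psi z = u (snd z) * deriv (\<lambda>s. deriv (\<lambda>r. psi (r, snd z)) s) (fst z)
     - deriv (\<lambda>xi. u xi * deriv (\<lambda>eta. psi (fst z, eta)) xi) (snd z)"

definition weak_sol :: "(real \<Rightarrow> real) \<Rightarrow> nat \<Rightarrow> nat \<Rightarrow> (real \<Rightarrow> real \<Rightarrow> real \<Rightarrow> real)
    \<Rightarrow> (real \<times> real \<Rightarrow> real) \<Rightarrow> bool" where
  "weak_sol u p q f y \<longleftrightarrow> L2u u (Tper p q) y \<and>
     (\<forall>psi. test_fn (Tper p q) psi \<longrightarrow>
        set_integrable lebesgue (Omega (Tper p q)) (\<lambda>z. y z * Aop u psi z)
      \<and> set_integrable lebesgue (Omega (Tper p q)) (\<lambda>z. f (fst z) (snd z) (y z) * psi z)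
      \<and> (LINT z:Omega (Tper p q)|lebesgue. y z * Aop u psi z)
        - (LINT z:Omega (Tper p q)|lebesgue. f (fst z) (snd z) (y z) * psi z) = 0)"

end

theory Submission
  imports Defs "HOL-Complex_Analysis.Great_Picard"
begin

text \<open>
  Let \<open>v = f(t,x,y)/u\<close> for a weak solution \<open>y\<close>. Testing the equation with the basis functions shows that the
  Fourier coefficients of \<open>v\<close> are those of \<open>y\<close> multiplied by \<open>\<mu>\<^sub>m\<^sub>n\<close>. By Parseval, the integral of
  \<open>u (v - ll y) (v - lh y)\<close> is the sum of \<open>(\<mu>\<^sub>m\<^sub>n - ll) (\<mu>\<^sub>m\<^sub>n - lh)\<close> times squared coefficients of \<open>y\<close>; its
  terms are nonnegative, because \<open>ll\<close> and \<open>lh\<close> are consecutive and only odd \<open>m\<close> contribute. On the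
  other hand the bounds on the difference quotients make the integrand nonpositive. So both vanish,
  whence \<open>v - ll y\<close> and \<open>v - lh y\<close> lie in the kernels belonging to \<open>lh\<close> and \<open>ll\<close>, and
  \<open>(lh - \<beta>) (v - ll y)\<^sup>2\<close> and \<open>(\<alpha> - ll) (v - lh y)\<^sup>2\<close> vanish almost everywhere. The nonresonance
  conditions force both functions to vanish, hence also their difference \<open>(lh - ll) y\<close>.

  Completeness of the Sturm-Liouville eigenfunctions: on the continuous functions orthogonal to all
  eigenfunctions, the solution operator of the Dirichlet problem would, if this space were nonzero,
  attain its norm by Arzela-Ascoli and so produce an eigenfunction orthogonal to itself.
\<close>

section \<open>Integration by parts\<close>

text \<open>\<open>lam2\<close> is a \<open>THE\<close> and \<open>phi\<close> a
  \<open>SOME\<close>, so they say nothing until the spectrum is known to be infinite, finite below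
  every bound and simple; only then do the \<open>phi u n\<close> with n \<ge> 1 exhaust all
  eigenfunctions up to scaling. Continuous functions are not complete for the weighted norm, but
  \<open>K\<close> maps a bounded sequence to a uniformly Lipschitz one, whose uniform limits are
  again continuous. One-variable completeness is formulated for integrable functions, with a
  vanishing primitive as conclusion: this fits the partial integrals that Fubini delivers and so
  yields completeness of the product system. The weak equation is tested only with smooth functions,
  while \<open>phi u n\<close> need not be smooth; polynomials vanishing at 0 and \<open>pi\<close>
  take its place. The slope bounds hold off a null set that depends on the two arguments; rational
  arguments and continuity produce a common null set, so that v = c y with a pointwise slope c
  between \<alpha> and \<beta>.\<close>

lemma integral_by_parts_C1:
  fixes F G :: "real \<Rightarrow> real"
  assumes "a \<le> b"
    and F: "\<And>x. x \<in> {a..b} \<Longrightarrow> (F has_real_derivative f x) (at x within {a..b})"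
    and G: "\<And>x. x \<in> {a..b} \<Longrightarrow> (G has_real_derivative g x) (at x within {a..b})"
    and f: "continuous_on {a..b} f" and g: "continuous_on {a..b} g"
  shows "integral {a..b} (\<lambda>x. F x * g x) = F b * G b - F a * G a - integral {a..b} (\<lambda>x. f x * G x)"
proof -
  have cF: "continuous_on {a..b} F" and cG: "continuous_on {a..b} G"
    using F G by (blast intro: DERIV_continuous_on)+
  have "((\<lambda>x. F x * g x + f x * G x) has_integral F b * G b - F a * G a) {a..b}"
    using \<open>a \<le> b\<close>
    by (rule fundamental_theorem_of_calculus)
       (auto simp: has_real_derivative_iff_has_vector_derivative[symmetric] intro!: derivative_eq_intros F G)
  then have "integral {a..b} (\<lambda>x. F x * g x + f x * G x) = F b * G b - F a * G a"
    by (rule integral_unique)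
  moreover have "integral {a..b} (\<lambda>x. F x * g x + f x * G x)
      = integral {a..b} (\<lambda>x. F x * g x) + integral {a..b} (\<lambda>x. f x * G x)"
    by (intro Henstock_Kurzweil_Integration.integral_add integrable_continuous_real continuous_intros cF cG f g)
  ultimately show ?thesis by simp
qed

lemma integrable_lborel_product:
  fixes f g :: "real \<Rightarrow> real"
  assumes f: "integrable lborel f" and g: "integrable lborel g"
  shows "integrable (lborel \<Otimes>\<^sub>M lborel) (\<lambda>z. f (fst z) * g (snd z))"
proof (rule lborel_pair.Fubini_integrable)
  have [measurable]: "f \<in> borel_measurable borel" "g \<in> borel_measurable borel"
    using borel_measurable_integrable[OF f] borel_measurable_integrable[OF g] by auto
  show "(\<lambda>z. f (fst z) * g (snd z)) \<in> borel_measurable (lborel \<Otimes>\<^sub>M lborel)" by measurable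
  show "integrable lborel (\<lambda>x. LINT y|lborel. norm (f (fst (x, y)) * g (snd (x, y))))"
    using f by (auto simp: abs_mult)
  show "AE x in lborel. integrable lborel (\<lambda>y. f (fst (x, y)) * g (snd (x, y)))"
    using g by auto
qed

text \<open>By Fubini on the triangle \<open>a \<le> x \<le> s \<le> b\<close>, because \<open>g\<close> is merely integrable.\<close>
lemma integral_by_parts_L1:
  fixes g h :: "real \<Rightarrow> real"
  assumes "a \<le> b" and g: "set_integrable lborel {a..b} g"
    and h: "\<And>x. x \<in> {a..b} \<Longrightarrow> (h has_real_derivative h' x) (at x within {a..b})"
    and h': "continuous_on {a..b} h'"
  shows "integral {a..b} (\<lambda>x. g x * h x) = integral {a..b} g * h b
           - integral {a..b} (\<lambda>s. integral {a..s} g * h' s)"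
    and "set_integrable lborel {a..b} (\<lambda>x. g x * h x)"
proof -
  have ch: "continuous_on {a..b} h"
    using h by (rule DERIV_continuous_on)
  define G H where "G = (\<lambda>x. indicator {a..b} x * g x)" and "H = (\<lambda>x. indicator {a..b} x * h' x)"
  have iG: "integrable lborel G" using g by (simp add: set_integrable_def G_def)
  have iH: "integrable lborel H"
    using borel_integrable_atLeastAtMost'[OF h'] by (simp add: set_integrable_def H_def)
  \<comment> \<open>Kernel on the triangle: integrating out s leaves
    \<open>g x * (h b - h x)\<close>, integrating out x leaves the primitive of \<open>g\<close>
    times \<open>h'\<close>.\<close>
  define k where "k = (\<lambda>x s. if x \<le> s then G x * H s else 0)"
  have mG[measurable]: "G \<in> borel_measurable borel" and mH[measurable]: "H \<in> borel_measurable borel"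
    using iG iH by auto
  have ik: "integrable (lborel \<Otimes>\<^sub>M lborel) (case_prod k)"
    by (rule Bochner_Integration.integrable_bound[OF integrable_lborel_product[OF iG iH]])
       (auto simp: k_def split_beta')
  have gh: "set_integrable lborel {a..b} (\<lambda>x. g x * w x)" if w: "continuous_on {a..b} w" for w
  proof -
    obtain C where C: "\<forall>x\<in>{a..b}. \<bar>w x\<bar> \<le> C"
      using compact_imp_bounded[OF compact_continuous_image[OF w compact_Icc]]
      by (auto simp: bounded_iff)
    have m: "(\<lambda>x. indicator {a..b} x * w x) \<in> borel_measurable borel"
      using borel_integrable_atLeastAtMost'[OF w] by (auto simp: set_integrable_def)
    have "integrable lborel (\<lambda>x. G x * (indicator {a..b} x * w x))"
    proof (rule Bochner_Integration.integrable_bound[of _ "\<lambda>x. C * G x"])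
      show "integrable lborel (\<lambda>x. C * G x)" using iG by simp
      show "(\<lambda>x. G x * (indicator {a..b} x * w x)) \<in> borel_measurable lborel" using m by measurable
      have "\<bar>G x\<bar> * \<bar>indicator {a..b} x * w x\<bar> \<le> \<bar>C\<bar> * \<bar>G x\<bar>" for x
        using C by (force simp: G_def indicator_def mult.commute[of _ "\<bar>g x\<bar>"] intro!: mult_left_mono)
      then show "AE x in lborel. norm (G x * (indicator {a..b} x * w x)) \<le> norm (C * G x)"
        by (auto simp: abs_mult)
    qed
    moreover have "(\<lambda>x. G x * (indicator {a..b} x * w x)) = (\<lambda>x. indicator {a..b} x * (g x * w x))"
      by (auto simp: G_def indicator_def)
    ultimately show ?thesis by (simp add: set_integrable_def)
  qed
  show "set_integrable lborel {a..b} (\<lambda>x. g x * h x)" by (rule gh[OF ch])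
  have 1: "(LINT s|lborel. k x s) = indicator {a..b} x * (g x * (h b - h x))" for x
  proof (cases "x \<in> {a..b}")
    case True
    have "(LINT s|lborel. k x s) = g x * (LINT s:{x..b}|lborel. h' s)"
      using True by (auto simp: k_def G_def H_def set_lebesgue_integral_def integral_mult_right_zero[symmetric] simp del: integral_mult_right_zero
          intro!: Bochner_Integration.integral_cong split: split_indicator)
    also have "(LINT s:{x..b}|lborel. h' s) = integral {x..b} h'"
      by (rule set_borel_integral_eq_integral(2)[OF borel_integrable_atLeastAtMost'])
         (rule continuous_on_subset[OF h'], use True in auto)
    also have "integral {x..b} h' = h b - h x"
      using True
      by (intro integral_unique fundamental_theorem_of_calculus)
         (auto simp: has_real_derivative_iff_has_vector_derivative[symmetric] intro!: DERIV_subset[OF h])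
    finally show ?thesis using True by simp
  next
    case False
    then have "k x s = 0" for s by (simp add: k_def G_def)
    then show ?thesis using False by simp
  qed
  have 2: "(LINT x|lborel. k x s) = indicator {a..b} s * (integral {a..s} g * h' s)" for s
  proof (cases "s \<in> {a..b}")
    case True
    have "set_integrable lborel {a..s} g" by (rule set_integrable_subset[OF g]) (use True in auto)
    note gs = set_borel_integral_eq_integral(2)[OF this]
    have "(LINT x|lborel. k x s) = (LINT x:{a..s}|lborel. g x) * h' s"
      using True by (auto simp: k_def G_def H_def set_lebesgue_integral_def integral_mult_left_zero[symmetric] simp del: integral_mult_left_zero
          intro!: Bochner_Integration.integral_cong split: split_indicator)
    then show ?thesis using True gs by simp
  next
    case False
    then have "k x s = 0" for x by (simp add: k_def H_def)
    then show ?thesis using False by simp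
  qed
  have cG: "continuous_on {a..b} (\<lambda>s. integral {a..s} g * h' s)"
    by (intro continuous_intros indefinite_integral_continuous_1 set_borel_integral_eq_integral(1)[OF g] h')
  have "(LINT s|lborel. LINT x|lborel. k x s) = (LINT x|lborel. LINT s|lborel. k x s)"
    by (rule lborel_pair.Fubini_integral[OF ik])
  then have e: "(LINT s:{a..b}|lborel. integral {a..s} g * h' s) = (LINT x:{a..b}|lborel. g x * (h b - h x))"
    by (simp add: 1 2 set_lebesgue_integral_def)
  have "integral {a..b} (\<lambda>s. integral {a..s} g * h' s) = integral {a..b} (\<lambda>x. g x * (h b - h x))"
    using e set_borel_integral_eq_integral(2)[OF borel_integrable_atLeastAtMost'[OF cG]]
      set_borel_integral_eq_integral(2)[OF gh, of "\<lambda>x. h b - h x"] ch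
    by (simp add: continuous_on_diff)
  also have "\<dots> = integral {a..b} (\<lambda>x. g x * h b - g x * h x)" by (simp add: algebra_simps)
  also have "\<dots> = integral {a..b} (\<lambda>x. g x * h b) - integral {a..b} (\<lambda>x. g x * h x)"
    by (intro Henstock_Kurzweil_Integration.integral_diff set_borel_integral_eq_integral(1) gh ch continuous_intros)
  also have "integral {a..b} (\<lambda>x. g x * h b) = integral {a..b} g * h b"
    by (rule integral_mult_left)
  finally show "integral {a..b} (\<lambda>x. g x * h x) = integral {a..b} g * h b
           - integral {a..b} (\<lambda>s. integral {a..s} g * h' s)" by simp
qed

lemma integral_nonneg_eq_0_continuous:
  fixes f :: "real \<Rightarrow> real"
  assumes "a < b" "continuous_on {a..b} f" "\<And>x. x \<in> {a..b} \<Longrightarrow> 0 \<le> f x" "integral {a..b} f = 0" "x \<in> {a..b}"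
  shows "f x = 0"
  using integral_eq_0_iff[OF assms(2,1,3)] assms by auto

section \<open>The trigonometric system\<close>

text \<open>Boxes form an intersection-stable generator of the Borel sets, so a Dynkin induction
  carries the vanishing integral to all Borel sets, and a density is determined by its integrals
  over these.\<close>

lemma AE_zero_if_box_integrals_zero:
  fixes f :: "'a::euclidean_space \<Rightarrow> real"
  assumes f: "integrable lborel f" and z: "\<And>a b. (LINT x:box a b|lborel. f x) = 0"
  shows "AE x in lborel. f x = 0"
proof (rule density_unique_real[OF f integrable_zero])
  have si: "set_integrable lborel A f" if "A \<in> sets borel" for A
    unfolding set_integrable_def using that f by (intro integrable_mult_indicator) auto
  \<comment> \<open>The complement step of the induction needs the integral over the whole space,
    which is reached by growing boxes.\<close>
  define B where "B = (\<lambda>n::nat. box (- (real n *\<^sub>R One)) (real n *\<^sub>R One) :: 'a set)"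
  have B: "(\<Union>n. B n) = UNIV" unfolding B_def by (rule UN_box_eq_UNIV)
  have "incseq B" unfolding B_def incseq_def
  proof (intro allI impI subsetI)
    fix m n :: nat and x :: 'a assume mn: "m \<le> n" and x: "x \<in> box (- (real m *\<^sub>R One)) (real m *\<^sub>R One)"
    have "real m \<le> real n" using mn by simp
    then show "x \<in> box (- (real n *\<^sub>R One)) (real n *\<^sub>R One)"
      using x by (force simp: mem_box)
  qed
  then have "(\<lambda>n. LINT x:B n|lborel. f x) \<longlonglongrightarrow> (LINT x:(\<Union>n. B n)|lborel. f x)"
    by (intro set_integral_cont_up si) (auto simp: B_def)
  then have "(\<lambda>n. 0) \<longlonglongrightarrow> (LINT x:UNIV|lborel. f x)" unfolding B by (simp add: B_def z)
  then have tot: "(LINT x:UNIV|lborel. f x) = 0" by (simp add: LIMSEQ_const_iff)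
  fix A :: "'a set" assume "A \<in> sets lborel"
  then have A: "A \<in> sigma_sets UNIV (range (\<lambda>(a, b). box a b))" by (simp add: borel_eq_box)
  have "Int_stable (range (\<lambda>(a, b). box a b :: 'a set))" by (auto simp: Int_stable_def box_Int_box)
  moreover have "range (\<lambda>(a, b). box a b :: 'a set) \<subseteq> Pow UNIV" by auto
  ultimately have "(LINT x:A|lborel. f x) = 0" using A
  proof (induction rule: sigma_sets_induct_disjoint)
    case (basic A) then show ?case using z by auto
  next
    case empty show ?case by (simp add: set_lebesgue_integral_def)
  next
    case (compl A)
    then have [measurable]: "A \<in> sets borel" by (simp add: borel_eq_box)
    have "(LINT x:A \<union> (UNIV - A)|lborel. f x) = (LINT x:A|lborel. f x) + (LINT x:(UNIV - A)|lborel. f x)"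
      by (intro set_integral_Un si) auto
    then show ?case using compl tot by simp
  next
    case (union A)
    then have [measurable]: "A i \<in> sets borel" for i by (auto simp: borel_eq_box)
    have "(LINT x:(\<Union>i. A i)|lborel. f x) = (\<Sum>i. (LINT x:(A i)|lborel. f x))"
      using union(1) by (intro lebesgue_integral_countable_add si) (auto simp: disjoint_family_on_def)
    then show ?case using union by simp
  qed
  then show "(LINT x:A|lborel. f x) = (LINT x:A|lborel. 0)" by simp
qed

text \<open>An interval meets \<open>{0..L}\<close> in an interval, over which the integral is a
  difference of two vanishing primitives.\<close>

lemma AE_zero_if_primitive_zero:
  fixes g :: "real \<Rightarrow> real"
  assumes g: "integrable lborel g" and out: "\<And>x. x \<notin> {0..L} \<Longrightarrow> g x = 0"
    and z: "\<And>x. x \<in> {0..L} \<Longrightarrow> integral {0..x} g = 0"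
  shows "AE x in lborel. g x = 0"
proof (rule AE_zero_if_box_integrals_zero[OF g])
  have si: "set_integrable lborel A g" if "A \<in> sets borel" for A
    unfolding set_integrable_def using that g by (intro integrable_mult_indicator) auto
  fix a b :: real
  define a' b' where "a' = max a 0" and "b' = min b L"
  have "(LINT x:box a b|lborel. g x) = integral {a<..<b} g"
    using set_borel_integral_eq_integral(2)[OF si, of "{a<..<b}"] by (simp add: box_real)
  also have "\<dots> = integral {a..b} g" using integral_open_interval[of a b g] by (simp add: box_real)
  also have "\<dots> = integral {a..b} (\<lambda>x. if x \<in> {0..L} then g x else 0)"
    by (rule integral_cong) (use out in auto)
  also have "\<dots> = integral ({a..b} \<inter> {0..L}) g"
    using Henstock_Kurzweil_Integration.integral_restrict_Int[of "{a..b}" "{0..L}" g] by (simp add: Int_commute)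
  also have "{a..b} \<inter> {0..L} = {a'..b'}" by (auto simp: a'_def b'_def)
  also have "integral {a'..b'} g = 0"
  proof (cases "a' \<le> b'")
    case True
    have "integral {0..a'} g + integral {a'..b'} g = integral {0..b'} g"
      using True set_borel_integral_eq_integral(1)[OF si, of "{0..b'}"]
      by (intro Henstock_Kurzweil_Integration.integral_combine) (auto simp: a'_def)
    then show ?thesis using z[of a'] z[of b'] True by (auto simp: a'_def b'_def)
  qed simp
  finally show "(LINT x:box a b|lborel. g x) = 0" .
qed

section \<open>Density of trigonometric polynomials\<close>

text \<open>Integer frequencies, so that the difference k - l in the product formulas stays inside
  the class.\<close>

inductive trig_poly :: "real \<Rightarrow> (real \<Rightarrow> real) \<Rightarrow> bool" for w where
  tcos: "trig_poly w (\<lambda>t. cos (of_int k * w * t))"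
| tsin: "trig_poly w (\<lambda>t. sin (of_int k * w * t))"
| tadd: "trig_poly w f \<Longrightarrow> trig_poly w g \<Longrightarrow> trig_poly w (\<lambda>t. f t + g t)"
| tscale: "trig_poly w f \<Longrightarrow> trig_poly w (\<lambda>t. c * f t)"

lemma trig_poly_continuous: "trig_poly w f \<Longrightarrow> continuous_on S f"
  by (induction rule: trig_poly.induct) (intro continuous_intros | assumption)+

lemma trig_poly_cong: "trig_poly w f \<Longrightarrow> (\<And>t. f t = g t) \<Longrightarrow> trig_poly w g"
  by (metis ext)

lemma trig_poly_mult_cos:
  assumes "trig_poly w g" shows "trig_poly w (\<lambda>t. cos (of_int k * w * t) * g t)"
  using assms
proof induction
  case (tcos l)
  show ?case
    by (rule trig_poly_cong[OF trig_poly.tscale[OF trig_poly.tadd[OF trig_poly.tcos[of w "k - l"] trig_poly.tcos[of w "k + l"]], of "1/2"]])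
       (unfold cos_times_cos, simp add: algebra_simps)
next
  case (tsin l)
  show ?case
    by (rule trig_poly_cong[OF trig_poly.tscale[OF trig_poly.tadd[OF trig_poly.tsin[of w "k + l"] trig_poly.tscale[OF trig_poly.tsin[of w "k - l"], of "-1"]], of "1/2"]])
       (unfold cos_times_sin, simp add: algebra_simps)
next
  case (tadd f g) then show ?case by (simp add: distrib_left trig_poly.tadd)
next
  case (tscale f c)
  then show ?case using trig_poly.tscale[OF tscale.IH, of c] by (simp add: mult.left_commute)
qed

lemma trig_poly_mult_sin:
  assumes "trig_poly w g" shows "trig_poly w (\<lambda>t. sin (of_int k * w * t) * g t)"
  using assms
proof induction
  case (tcos l)
  show ?case
    by (rule trig_poly_cong[OF trig_poly.tscale[OF trig_poly.tadd[OF trig_poly.tsin[of w "k + l"] trig_poly.tsin[of w "k - l"]], of "1/2"]])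
       (unfold sin_times_cos, simp add: algebra_simps)
next
  case (tsin l)
  show ?case
    by (rule trig_poly_cong[OF trig_poly.tscale[OF trig_poly.tadd[OF trig_poly.tcos[of w "k - l"] trig_poly.tscale[OF trig_poly.tcos[of w "k + l"], of "-1"]], of "1/2"]])
       (unfold sin_times_sin, simp add: algebra_simps)
next
  case (tadd f g) then show ?case by (simp add: distrib_left trig_poly.tadd)
next
  case (tscale f c)
  then show ?case using trig_poly.tscale[OF tscale.IH, of c] by (simp add: mult.left_commute)
qed

lemma trig_poly_mult:
  assumes "trig_poly w f" "trig_poly w g" shows "trig_poly w (\<lambda>t. f t * g t)"
  using assms(1)
proof induction
  case (tcos l) show ?case by (rule trig_poly_mult_cos[OF assms(2)])
next
  case (tsin l) show ?case by (rule trig_poly_mult_sin[OF assms(2)])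
next
  case (tadd f h) then show ?case by (simp add: distrib_right trig_poly.tadd)
next
  case (tscale f c)
  then show ?case using trig_poly.tscale[OF tscale.IH, of c] by (simp add: mult.assoc)
qed

text \<open>On the unit circle a real-linear functional is a combination of cosine and sine of
  frequency 1, constants are multiples of the cosine of frequency 0, and \<open>trig_poly\<close> is
  closed under sums and products.\<close>

lemma trig_poly_of_polynomial:
  assumes "real_polynomial_function p" shows "trig_poly w (\<lambda>t. p (cis (w * t)))"
  using assms
proof induction
  case (linear f)
  then interpret bounded_linear f .
  have eq: "f (cis (w * t)) = f 1 * cos (of_int 1 * w * t) + f \<i> * sin (of_int 1 * w * t)" for t
  proof -
    have "cis (w * t) = cos (w * t) *\<^sub>R 1 + sin (w * t) *\<^sub>R \<i>" by (simp add: complex_eq_iff)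
    then have "f (cis (w * t)) = cos (w * t) *\<^sub>R f 1 + sin (w * t) *\<^sub>R f \<i>" by (simp only: add scaleR)
    then show ?thesis by simp
  qed
  show ?case unfolding eq by (intro trig_poly.intros)
next
  case (const c)
  show ?case by (rule trig_poly_cong[OF trig_poly.tscale[OF trig_poly.tcos[of w 0], of c]]) simp
qed (auto intro: trig_poly.tadd trig_poly_mult)

text \<open>Since \<open>H 0 = H T\<close>, \<open>H\<close> factors through the unit circle, a
  compact subset of the plane on which Stone-Weierstrass provides polynomial approximation.\<close>

lemma trig_poly_dense:
  assumes w: "w > 0" and T: "T = 2 * pi / w" and H: "continuous_on {0..T} H" "H 0 = H T" and e: "e > 0"
  obtains h where "trig_poly w h" "\<And>t. t \<in> {0..T} \<Longrightarrow> \<bar>H t - h t\<bar> < e"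
proof -
  define \<gamma> where "\<gamma> = (\<lambda>t. cis (w * t))"
  define F where "F = (\<lambda>z. H (Arg2pi z / w))"
  have F: "F (\<gamma> t) = H t" if t: "t \<in> {0..T}" for t
  proof (cases "t = T")
    case True
    then have "\<gamma> t = 1" using w by (simp add: \<gamma>_def T)
    moreover have "Arg2pi 1 = 0" by (rule Arg2pi_unique[of 1]) auto
    ultimately show ?thesis using True H(2) by (simp add: F_def)
  next
    case False
    then have "w * t < 2 * pi" using t w by (simp add: T field_simps)
    then have "Arg2pi (\<gamma> t) = w * t"
      using t w by (intro Arg2pi_unique[of 1]) (auto simp: \<gamma>_def cis_conv_exp)
    then show ?thesis using w by (simp add: F_def)
  qed
  define C where "C = \<gamma> ` {0..T}"
  have cg: "continuous_on A \<gamma>" for A unfolding \<gamma>_def by (intro continuous_intros)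
  have C: "compact C" unfolding C_def by (intro compact_continuous_image cg compact_Icc)
  \<comment> \<open>\<open>Arg2pi\<close> jumps at 1, so \<open>F\<close> is not visibly a
    composition of continuous maps. Instead, the preimage of a closed set under \<open>F\<close> is
    the image under \<gamma> of a compact subset of the interval.\<close>
  have "continuous_on C F"
    unfolding continuous_on_closed_vimage[OF compact_imp_closed[OF C]]
  proof (intro allI impI)
    fix B :: "real set" assume "closed B"
    have "F -` B \<inter> C = \<gamma> ` (H -` B \<inter> {0..T})" unfolding C_def using F by auto
    moreover have "closed (H -` B \<inter> {0..T})"
      using H(1) \<open>closed B\<close> continuous_on_closed_vimage[of "{0..T}" H] by simp
    then have "compact (H -` B \<inter> {0..T})" by (metis compact_Icc compact_Int_closed inf_commute inf_left_idem)
    ultimately show "closed (F -` B \<inter> C)"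
      by (simp add: compact_imp_closed compact_continuous_image cg)
  qed
  then obtain p where p: "real_polynomial_function p" "\<And>x. x \<in> C \<Longrightarrow> \<bar>F x - p x\<bar> < e"
    using Stone_Weierstrass_real_polynomial_function[OF C _ e] by metis
  show ?thesis
  proof (rule that[OF trig_poly_of_polynomial[OF p(1)]])
    fix t assume t: "t \<in> {0..T}"
    then have "\<bar>F (\<gamma> t) - p (\<gamma> t)\<bar> < e" by (intro p(2)) (simp add: C_def)
    then show "\<bar>H t - p (cis (w * t))\<bar> < e" using F[OF t] by (simp add: \<gamma>_def)
  qed
qed

text \<open>\<open>H\<close> is orthogonal to its own uniform approximants, so the integral of its
  square is at most the approximation error times the integral of its absolute value.\<close>

lemma trig_complete_continuous:
  assumes w: "w > 0" and T: "T = 2 * pi / w" and H: "continuous_on {0..T} H" "H 0 = H T"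
    and c: "\<And>m::nat. integral {0..T} (\<lambda>t. H t * cos (real m * w * t)) = 0"
    and s: "\<And>m::nat. integral {0..T} (\<lambda>t. H t * sin (real m * w * t)) = 0"
    and t: "t \<in> {0..T}"
  shows "H t = 0"
proof -
  have perp: "integral {0..T} (\<lambda>t. H t * h t) = 0" if "trig_poly w h" for h
    using that
  proof induction
    case (tcos k)
    show ?case
    proof (cases "k \<ge> 0")
      case True then show ?thesis using c[of "nat k"] by simp
    next
      case False
      then have "cos (real (nat (- k)) * w * t) = cos (of_int k * w * t)" for t
        using cos_minus[of "of_int k * w * t"] by simp
      then show ?thesis using c[of "nat (- k)"] by simp
    qed
  next
    case (tsin k)
    show ?case
    proof (cases "k \<ge> 0")
      case True then show ?thesis using s[of "nat k"] by simp
    next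
      case False
      then have "sin (real (nat (- k)) * w * t) = - sin (of_int k * w * t)" for t
        using sin_minus[of "of_int k * w * t"] by simp
      then show ?thesis using s[of "nat (- k)"] by simp
    qed
  next
    case (tadd f g)
    have "integral {0..T} (\<lambda>t. H t * f t + H t * g t) = 0"
      using tadd by (subst Henstock_Kurzweil_Integration.integral_add)
        (auto intro!: integrable_continuous_real continuous_intros H trig_poly_continuous[OF tadd.hyps(1)]
           trig_poly_continuous[OF tadd.hyps(2)])
    then show ?case by (simp add: distrib_left)
  next
    case (tscale f c)
    have "integral {0..T} (\<lambda>t. c * (H t * f t)) = 0" using tscale by simp
    then show ?case by (simp add: mult.left_commute)
  qed
  define A where "A = integral {0..T} (\<lambda>t. \<bar>H t\<bar>)"
  have "A \<ge> 0" unfolding A_def by (intro integral_nonneg integrable_continuous_real continuous_intros H) simp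
  have "integral {0..T} (\<lambda>t. H t * H t) \<le> 0 + e" if "e > 0" for e
  proof -
    \<comment> \<open>The summand 1 keeps the denominator positive and still gives e / (A + 1) times
      A at most e.\<close>
    have "e / (A + 1) > 0" using that \<open>A \<ge> 0\<close> by simp
    from trig_poly_dense[OF w T H this] obtain h
      where h: "trig_poly w h" "\<And>t. t \<in> {0..T} \<Longrightarrow> \<bar>H t - h t\<bar> < e / (A + 1)" by metis
    have ch: "continuous_on {0..T} h" by (rule trig_poly_continuous[OF h(1)])
    have "integral {0..T} (\<lambda>t. H t * H t) = integral {0..T} (\<lambda>t. H t * (H t - h t) + H t * h t)"
      by (simp add: algebra_simps)
    also have "\<dots> = integral {0..T} (\<lambda>t. H t * (H t - h t))"
      using perp[OF h(1)] by (subst Henstock_Kurzweil_Integration.integral_add)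
        (auto intro!: integrable_continuous_real continuous_intros H ch)
    also have "\<dots> \<le> integral {0..T} (\<lambda>t. e / (A + 1) * \<bar>H t\<bar>)"
    proof (intro integral_le integrable_continuous_real continuous_intros H ch)
      fix t assume t: "t \<in> {0..T}"
      have "H t * (H t - h t) \<le> \<bar>H t\<bar> * \<bar>H t - h t\<bar>" by (metis abs_ge_self abs_mult)
      also have "\<dots> \<le> \<bar>H t\<bar> * (e / (A + 1))" by (rule mult_left_mono) (use h(2)[OF t] in auto)
      finally show "H t * (H t - h t) \<le> e / (A + 1) * \<bar>H t\<bar>" by (simp add: mult.commute)
    qed
    also have "\<dots> = e / (A + 1) * A" unfolding A_def by (rule integral_mult_right)
    also have "\<dots> \<le> e" using that \<open>A \<ge> 0\<close> by (simp add: field_simps)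
    finally show ?thesis by simp
  qed
  then have "integral {0..T} (\<lambda>t. H t * H t) \<le> 0" by (rule field_le_epsilon)
  moreover have "integral {0..T} (\<lambda>t. H t * H t) \<ge> 0"
    by (intro integral_nonneg integrable_continuous_real continuous_intros H) simp
  ultimately have "integral {0..T} (\<lambda>t. H t * H t) = 0" by simp
  moreover have "0 < T" using w by (simp add: T)
  ultimately have "H t * H t = 0"
    using integral_nonneg_eq_0_continuous[of 0 T "\<lambda>t. H t * H t" t] t H(1) by (simp add: continuous_on_mult)
  then show ?thesis by simp
qed

text \<open>Uniform approximation does not reach an integrable \<open>S\<close>, but its primitive
  is continuous, and takes equal values at 0 and \<open>T\<close> because the coefficient of the
  constant mode vanishes. Integration by parts transfers orthogonality from \<open>S\<close> to the
  primitive.\<close>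

lemma trig_complete:
  assumes w: "w > 0" and T: "T = 2 * pi / w" and S: "set_integrable lborel {0..T} S"
    and c: "\<And>m::nat. integral {0..T} (\<lambda>t. S t * cos (real m * w * t)) = 0"
    and s: "\<And>m::nat. integral {0..T} (\<lambda>t. S t * sin (real m * w * t)) = 0"
    and t: "t \<in> {0..T}"
  shows "integral {0..t} S = 0"
proof -
  have T0: "T > 0" using w by (simp add: T)
  note Si = set_borel_integral_eq_integral(1)[OF S]
  define G where "G = (\<lambda>t. integral {0..t} S)"
  have cG: "continuous_on {0..T} G" unfolding G_def by (rule indefinite_integral_continuous_1[OF Si])
  have G0: "G 0 = 0" "G T = 0" using c[of 0] by (simp_all add: G_def)
  \<comment> \<open>Integration by parts gives no information on the constant mode of
    \<open>G\<close>, so the mean is subtracted; evaluation at 0 finally shows that it is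
    zero.\<close>
  define k where "k = integral {0..T} G / T"
  define H where "H = (\<lambda>t. G t - k)"
  have cH: "continuous_on {0..T} H" unfolding H_def by (intro continuous_intros cG)
  have Hh: "integral {0..T} (\<lambda>t. H t * h' t) = 0"
    if h: "\<And>t. (h has_real_derivative h' t) (at t)" and h': "continuous_on {0..T} h'"
      and per: "h 0 = h T" and Sh: "integral {0..T} (\<lambda>t. S t * h t) = 0" for h h'
  proof -
    have hd: "(h has_real_derivative h' t) (at t within {0..T})" for t using h by (rule DERIV_subset) simp
    have "integral {0..T} (\<lambda>t. G t * h' t) = 0"
      using integral_by_parts_L1(1)[OF _ S hd h'] T0 Sh G0(2) by (simp add: G_def)
    moreover have "integral {0..T} h' = 0"
    proof -
      have "(h' has_integral h T - h 0) {0..T}"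
        by (rule fundamental_theorem_of_calculus)
           (use T0 hd in \<open>auto simp: has_real_derivative_iff_has_vector_derivative[symmetric]\<close>)
      then show ?thesis using per by (simp add: integral_unique)
    qed
    moreover have "integral {0..T} (\<lambda>t. H t * h' t) = integral {0..T} (\<lambda>t. G t * h' t - k * h' t)"
      by (simp add: H_def left_diff_distrib)
    moreover have "\<dots> = integral {0..T} (\<lambda>t. G t * h' t) - integral {0..T} (\<lambda>t. k * h' t)"
      by (intro Henstock_Kurzweil_Integration.integral_diff integrable_continuous_real continuous_intros cG h')
    ultimately show ?thesis by simp
  qed
  have wT: "real m * w * T = of_nat m * (2 * pi)" for m using w by (simp add: T)
  have Hc: "integral {0..T} (\<lambda>t. H t * cos (real m * w * t)) = 0" for m :: nat
  proof (cases "m = 0")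
    case True
    have "integral {0..T} H = integral {0..T} G - integral {0..T} (\<lambda>t. k)"
      unfolding H_def by (intro Henstock_Kurzweil_Integration.integral_diff integrable_continuous_real continuous_intros cG)
    then show ?thesis using True T0 by (simp add: k_def)
  next
    case False
    have "integral {0..T} (\<lambda>t. H t * (real m * w * cos (real m * w * t))) = 0"
    proof (rule Hh[of "\<lambda>t. sin (real m * w * t)"])
      show "((\<lambda>t. sin (real m * w * t)) has_real_derivative real m * w * cos (real m * w * t)) (at t)" for t
        by (auto intro!: derivative_eq_intros)
      show "sin (real m * w * 0) = sin (real m * w * T)"
        unfolding wT using sin_int_2pin[of "int m"] by (simp add: mult_ac)
    qed (auto intro!: continuous_intros s)
    then have "integral {0..T} (\<lambda>t. (real m * w) * (H t * cos (real m * w * t))) = 0" by (simp add: mult_ac)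
    then show ?thesis using False w by simp
  qed
  have Hs: "integral {0..T} (\<lambda>t. H t * sin (real m * w * t)) = 0" for m :: nat
  proof (cases "m = 0")
    case False
    have "integral {0..T} (\<lambda>t. H t * (- (real m * w) * sin (real m * w * t))) = 0"
    proof (rule Hh[of "\<lambda>t. cos (real m * w * t)"])
      show "((\<lambda>t. cos (real m * w * t)) has_real_derivative - (real m * w) * sin (real m * w * t)) (at t)" for t
        by (auto intro!: derivative_eq_intros)
      show "cos (real m * w * 0) = cos (real m * w * T)"
        unfolding wT using cos_int_2pin[of "int m"] by (simp add: mult_ac)
    qed (auto intro!: continuous_intros c)
    moreover have "(\<lambda>t. H t * (- (real m * w) * sin (real m * w * t))) = (\<lambda>t. (- (real m * w)) * (H t * sin (real m * w * t)))"
      by (simp add: mult_ac)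
    ultimately have "(- (real m * w)) * integral {0..T} (\<lambda>t. H t * sin (real m * w * t)) = 0"
      by (simp only: integral_mult_right)
    then show ?thesis using False w by simp
  qed simp
  have Hz: "H t = 0" if "t \<in> {0..T}" for t
    by (rule trig_complete_continuous[OF w T cH _ Hc Hs that]) (simp add: H_def G0)
  have "k = 0" using Hz[of 0] T0 G0 by (simp add: H_def)
  then show ?thesis using Hz[OF t] by (simp add: H_def G_def)
qed

section \<open>Orthogonality of sines and cosines\<close>

lemma integral_cos_multiple:
  fixes k :: int
  assumes w: "w > 0" and T: "T = 2 * pi / w"
  shows "integral {0..T} (\<lambda>t. cos (of_int k * w * t)) = (if k = 0 then T else 0)"
    and "integral {0..T} (\<lambda>t. sin (of_int k * w * t)) = 0"
proof -
  have T0: "0 \<le> T" using w by (simp add: T)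
  have kT: "of_int k * w * T = 2 * pi * of_int k" using w by (simp add: T)
  show "integral {0..T} (\<lambda>t. cos (of_int k * w * t)) = (if k = 0 then T else 0)"
  proof (cases "k = 0")
    case False
    have "((\<lambda>t. cos (of_int k * w * t)) has_integral
       sin (of_int k * w * T) / (of_int k * w) - sin (of_int k * w * 0) / (of_int k * w)) {0..T}"
      by (rule fundamental_theorem_of_calculus[OF T0])
         (use False w in \<open>auto simp: has_real_derivative_iff_has_vector_derivative[symmetric] intro!: derivative_eq_intros\<close>)
    then show ?thesis unfolding kT using False by (simp add: integral_unique sin_int_2pin)
  qed (use T0 in simp)
  show "integral {0..T} (\<lambda>t. sin (of_int k * w * t)) = 0"
  proof (cases "k = 0")
    case False
    have "((\<lambda>t. sin (of_int k * w * t)) has_integral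
       - cos (of_int k * w * T) / (of_int k * w) - (- cos (of_int k * w * 0) / (of_int k * w))) {0..T}"
      by (rule fundamental_theorem_of_calculus[OF T0])
         (use False w in \<open>auto simp: has_real_derivative_iff_has_vector_derivative[symmetric] intro!: derivative_eq_intros\<close>)
    then show ?thesis unfolding kT using False by (simp add: integral_unique cos_int_2pin)
  qed simp
qed

text \<open>The Boolean merges both families, so that later arguments are made once; for m = 0 the
  sine member is the zero function.\<close>

definition trig :: "real \<Rightarrow> bool \<Rightarrow> nat \<Rightarrow> real \<Rightarrow> real" where
  "trig w b m t = (if b then cos (w * real m * t) else sin (w * real m * t))"

lemma trig_continuous: "continuous_on S (trig w b m)"
  unfolding trig_def[abs_def] by (cases b) (auto intro!: continuous_intros)

lemma abs_trig_le: "\<bar>trig w b m t\<bar> \<le> 1" by (simp add: trig_def)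

lemma integral_trig_trig:
  assumes w: "w > 0" and T: "T = 2 * pi / w"
  shows "integral {0..T} (\<lambda>t. trig w b m t * trig w b' m' t)
    = (if b = b' \<and> m = m' then (if m = 0 then (if b then T else 0) else T / 2) else 0)"
proof -
  define c s where "c = (\<lambda>k::int. \<lambda>t. cos (of_int k * w * t))" and "s = (\<lambda>k::int. \<lambda>t. sin (of_int k * w * t))"
  have ci: "(\<lambda>t. c k t / 2) integrable_on {0..T}" "(\<lambda>t. s k t / 2) integrable_on {0..T}" for k
    by (auto simp: c_def s_def intro!: integrable_continuous_real continuous_intros)
  have I: "integral {0..T} (\<lambda>t. c k t / 2) = (if k = 0 then T / 2 else 0)"
    "integral {0..T} (\<lambda>t. s k t / 2) = 0" for k
    using integral_cos_multiple[OF w T, of k] by (auto simp: c_def s_def)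
  have a: "(int m - int m' = 0) = (m = m')" "(int m + int m' = 0) = (m = 0 \<and> m' = 0)" by auto
  note add = Henstock_Kurzweil_Integration.integral_add Henstock_Kurzweil_Integration.integral_diff
  consider "b" "b'" | "b" "\<not> b'" | "\<not> b" "b'" | "\<not> b" "\<not> b'" by blast
  then show ?thesis
  proof cases
    case 1
    have "(\<lambda>t. trig w b m t * trig w b' m' t) = (\<lambda>t. c (int m - int m') t / 2 + c (int m + int m') t / 2)"
      using 1 by (intro ext) (simp only: trig_def if_True if_False cos_times_cos c_def, simp add: algebra_simps add_divide_distrib)
    then show ?thesis using 1 by (simp only: add ci I a) auto
  next
    case 2
    have "(\<lambda>t. trig w b m t * trig w b' m' t) = (\<lambda>t. s (int m + int m') t / 2 - s (int m - int m') t / 2)"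
      using 2 by (intro ext) (simp only: trig_def if_True if_False cos_times_sin s_def, simp add: algebra_simps diff_divide_distrib)
    then show ?thesis using 2 by (simp only: add ci I a) auto
  next
    case 3
    have "(\<lambda>t. trig w b m t * trig w b' m' t) = (\<lambda>t. s (int m + int m') t / 2 + s (int m - int m') t / 2)"
      using 3 by (intro ext) (simp only: trig_def if_True if_False sin_times_cos s_def, simp add: algebra_simps add_divide_distrib)
    then show ?thesis using 3 by (simp only: add ci I a) auto
  next
    case 4
    have "(\<lambda>t. trig w b m t * trig w b' m' t) = (\<lambda>t. c (int m - int m') t / 2 - c (int m + int m') t / 2)"
      using 4 by (intro ext) (simp only: trig_def if_True if_False sin_times_sin c_def, simp add: algebra_simps diff_divide_distrib)
    then show ?thesis using 4 by (simp only: add ci I a) auto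
  qed
qed

section \<open>Orthonormal bases of square integrable functions\<close>

definition sqint :: "'a measure \<Rightarrow> ('a \<Rightarrow> real) \<Rightarrow> bool" where
  "sqint M f \<longleftrightarrow> f \<in> borel_measurable M \<and> integrable M (\<lambda>x. (f x)\<^sup>2)"

lemma sqint_measurable: "sqint M f \<Longrightarrow> f \<in> borel_measurable M" by (simp add: sqint_def)

lemma sqint_mult:
  assumes f: "sqint M f" and g: "sqint M g" shows "integrable M (\<lambda>x. f x * g x)"
proof (rule Bochner_Integration.integrable_bound)
  show "integrable M (\<lambda>x. (f x)\<^sup>2 + (g x)\<^sup>2)" using assms by (simp add: sqint_def)
  show "(\<lambda>x. f x * g x) \<in> borel_measurable M" using assms by (auto simp: sqint_def)
  have "\<bar>f x\<bar> * \<bar>g x\<bar> \<le> (f x)\<^sup>2 + (g x)\<^sup>2" for x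
    using zero_le_power2[of "\<bar>f x\<bar> - \<bar>g x\<bar>"] mult_nonneg_nonneg[of "\<bar>f x\<bar>" "\<bar>g x\<bar>"]
    unfolding power2_diff power2_abs by linarith
  then show "AE x in M. norm (f x * g x) \<le> norm ((f x)\<^sup>2 + (g x)\<^sup>2)" by (simp add: abs_mult)
qed

lemma sqint_linear:
  assumes f: "sqint M f" and g: "sqint M g" shows "sqint M (\<lambda>x. a * f x + b * g x)"
proof -
  have "integrable M (\<lambda>x. a\<^sup>2 * (f x)\<^sup>2 + 2 * a * b * (f x * g x) + b\<^sup>2 * (g x)\<^sup>2)"
    using sqint_mult[OF f g] assms by (auto simp: sqint_def)
  moreover have "(\<lambda>x. a\<^sup>2 * (f x)\<^sup>2 + 2 * a * b * (f x * g x) + b\<^sup>2 * (g x)\<^sup>2) = (\<lambda>x. (a * f x + b * g x)\<^sup>2)"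
    by (simp add: power2_eq_square algebra_simps)
  moreover have "(\<lambda>x. a * f x + b * g x) \<in> borel_measurable M" using assms by (auto simp: sqint_def)
  ultimately show ?thesis by (simp add: sqint_def)
qed

lemma sqint_diff: "sqint M f \<Longrightarrow> sqint M g \<Longrightarrow> sqint M (\<lambda>x. f x - g x)"
  using sqint_linear[of M f g 1 "-1"] by simp

lemma sqint_add: "sqint M f \<Longrightarrow> sqint M g \<Longrightarrow> sqint M (\<lambda>x. f x + g x)"
  using sqint_linear[of M f g 1 1] by simp

lemma sqint_sum:
  assumes "finite F" "\<And>i. i \<in> F \<Longrightarrow> sqint M (f i)" shows "sqint M (\<lambda>x. \<Sum>i\<in>F. a i * f i x)"
  using assms
proof (induction F)
  case empty then show ?case by (simp add: sqint_def)
next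
  case (insert i F)
  then have "sqint M (\<lambda>x. a i * f i x + 1 * (\<Sum>i\<in>F. a i * f i x))" by (intro sqint_linear) auto
  then show ?case using insert by simp
qed

text \<open>Stands in for Cauchy-Schwarz. With t = 2^n it turns the decay 4^(-n) of a squared norm
  into the decay 2^(-n) of an integral.\<close>

lemma abs_mult_le_weighted:
  fixes a b t :: real
  assumes "t > 0" shows "\<bar>a * b\<bar> \<le> t * a\<^sup>2 + 1 / t * b\<^sup>2"
proof -
  have "2 * (\<bar>t * a\<bar> * \<bar>b\<bar>) \<le> (t * a)\<^sup>2 + b\<^sup>2"
    using zero_le_power2[of "\<bar>t * a\<bar> - \<bar>b\<bar>"] by (simp add: power2_diff)
  moreover have "\<bar>t * a\<bar> * \<bar>b\<bar> = t * \<bar>a * b\<bar>" using assms by (simp add: abs_mult)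
  moreover have "0 \<le> t * \<bar>a * b\<bar>" using assms by simp
  ultimately have "t * \<bar>a * b\<bar> \<le> (t * a)\<^sup>2 + b\<^sup>2" by linarith
  also have "\<dots> = t * (t * a\<^sup>2 + 1 / t * b\<^sup>2)"
    using assms by (simp add: power_mult_distrib distrib_left power2_eq_square)
  finally show ?thesis using assms by (simp only: mult_le_cancel_left_pos)
qed

text \<open>\<open>normal\<close> admits zero members because the sine with m = 0 belongs to the
  index set. On a finite measure, square integrable functions are integrable, which the almost
  everywhere convergence of partial sums relies on.\<close>

locale orthonormal_basis = finite_measure M for M :: "'a measure" +
  fixes e :: "'i \<Rightarrow> 'a \<Rightarrow> real" and I :: "'i set"
  assumes countable_I: "countable I"
    and sqint_e: "\<And>i. i \<in> I \<Longrightarrow> sqint M (e i)"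
    and orth: "\<And>i j. i \<in> I \<Longrightarrow> j \<in> I \<Longrightarrow> i \<noteq> j \<Longrightarrow> (LINT x|M. e i x * e j x) = 0"
    and normal: "\<And>i. i \<in> I \<Longrightarrow> (LINT x|M. e i x * e i x) = 1 \<or> e i = (\<lambda>_. 0)"
    and total: "\<And>r. sqint M r \<Longrightarrow> (\<And>i. i \<in> I \<Longrightarrow> (LINT x|M. r x * e i x) = 0) \<Longrightarrow> AE x in M. r x = 0"
begin

definition cf :: "('a \<Rightarrow> real) \<Rightarrow> 'i \<Rightarrow> real" where
  "cf f i = (LINT x|M. f x * e i x)"

lemma cf_linear:
  assumes "sqint M f" "sqint M g" "i \<in> I"
  shows "cf (\<lambda>x. a * f x + b * g x) i = a * cf f i + b * cf g i"
proof -
  have "cf (\<lambda>x. a * f x + b * g x) i = (LINT x|M. a * (f x * e i x) + b * (g x * e i x))"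
    by (simp add: cf_def algebra_simps)
  then show ?thesis
    using sqint_mult[OF assms(1) sqint_e[OF assms(3)]] sqint_mult[OF assms(2) sqint_e[OF assms(3)]]
    by (simp add: cf_def)
qed

text \<open>Treats zero members like the others: their coefficients vanish.\<close>

lemma cf_norm: "i \<in> I \<Longrightarrow> cf f i * (LINT x|M. e i x * e i x) = cf f i"
  using normal[of i] by (auto simp: cf_def)

lemma integral_times_partial_sum:
  assumes g: "sqint M g" and F: "finite F" "F \<subseteq> I"
  shows "(LINT x|M. g x * (\<Sum>i\<in>F. a i * e i x)) = (\<Sum>i\<in>F. a i * cf g i)"
proof -
  have "(LINT x|M. g x * (\<Sum>i\<in>F. a i * e i x)) = (LINT x|M. (\<Sum>i\<in>F. a i * (g x * e i x)))"
    by (simp add: sum_distrib_left mult_ac)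
  also have "\<dots> = (\<Sum>i\<in>F. a i * cf g i)"
    using F sqint_mult[OF g sqint_e] by (subst Bochner_Integration.integral_sum) (auto simp: cf_def)
  finally show ?thesis .
qed

lemma cf_partial_sum:
  assumes F: "finite F" "F \<subseteq> I" and i: "i \<in> I"
  shows "cf (\<lambda>x. \<Sum>j\<in>F. cf f j * e j x) i = (if i \<in> F then cf f i else 0)"
proof -
  have "cf (\<lambda>x. \<Sum>j\<in>F. cf f j * e j x) i = (\<Sum>j\<in>F. cf f j * cf (e i) j)"
    unfolding cf_def[of "\<lambda>x. \<Sum>j\<in>F. cf f j * e j x"]
    using integral_times_partial_sum[OF sqint_e[OF i] F, of "cf f"] by (simp add: mult.commute)
  also have "\<dots> = (\<Sum>j\<in>F. if i = j then cf f i else 0)"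
    using orth[OF i] cf_norm[OF i, of f] F by (intro sum.cong) (auto simp: cf_def[of "e i"])
  also have "\<dots> = (if i \<in> F then cf f i else 0)" using F by simp
  finally show ?thesis .
qed

lemma bessel_identity:
  assumes f: "sqint M f" and F: "finite F" "F \<subseteq> I"
  shows "(LINT x|M. (f x - (\<Sum>i\<in>F. cf f i * e i x))\<^sup>2) = (LINT x|M. (f x)\<^sup>2) - (\<Sum>i\<in>F. (cf f i)\<^sup>2)"
proof -
  define S where "S = (\<lambda>x. \<Sum>i\<in>F. cf f i * e i x)"
  have S: "sqint M S" unfolding S_def using F sqint_e by (intro sqint_sum) auto
  have fS: "(LINT x|M. f x * S x) = (\<Sum>i\<in>F. (cf f i)\<^sup>2)"
    unfolding S_def using integral_times_partial_sum[OF f F] by (simp add: power2_eq_square)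
  have "(LINT x|M. S x * S x) = (\<Sum>i\<in>F. cf f i * cf S i)"
    using integral_times_partial_sum[OF S F, of "cf f"] by (simp add: S_def)
  also have "\<dots> = (\<Sum>i\<in>F. (cf f i)\<^sup>2)"
    using F cf_partial_sum[OF F] by (intro sum.cong) (auto simp: S_def power2_eq_square)
  finally have SS: "(LINT x|M. S x * S x) = (\<Sum>i\<in>F. (cf f i)\<^sup>2)" .
  have "(LINT x|M. (f x - S x)\<^sup>2) = (LINT x|M. (f x)\<^sup>2 - 2 * (f x * S x) + S x * S x)"
    by (simp add: power2_eq_square algebra_simps)
  also have "\<dots> = (LINT x|M. (f x)\<^sup>2) - 2 * (LINT x|M. f x * S x) + (LINT x|M. S x * S x)"
    using f sqint_mult[OF f S] sqint_mult[OF S S] by (simp add: sqint_def)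
  finally have "(LINT x|M. (f x - S x)\<^sup>2) = (LINT x|M. (f x)\<^sup>2) - (\<Sum>i\<in>F. (cf f i)\<^sup>2)"
    using fS SS by simp
  then show ?thesis by (simp add: S_def)
qed

lemma integral_square_nonneg: "(LINT x|M. (f x :: real)\<^sup>2) \<ge> 0"
  by (rule integral_nonneg_AE) simp

lemma coefficients_summable:
  assumes f: "sqint M f" shows "(\<lambda>i. (cf f i)\<^sup>2) summable_on I"
proof (rule nonneg_bounded_partial_sums_imp_summable_on)
  show "\<forall>\<^sub>F F in finite_subsets_at_top I. (\<Sum>i\<in>F. (cf f i)\<^sup>2) \<le> (LINT x|M. (f x)\<^sup>2)"
  proof (rule eventually_finite_subsets_at_top_weakI)
    fix F assume "finite F" "F \<subseteq> I"
    then show "(\<Sum>i\<in>F. (cf f i)\<^sup>2) \<le> (LINT x|M. (f x)\<^sup>2)"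
      using bessel_identity[OF f, of F] integral_square_nonneg[of "\<lambda>x. f x - (\<Sum>i\<in>F. cf f i * e i x)"] by simp
  qed
qed simp

text \<open>By monotone convergence the sum of the absolute values has a finite integral, hence is
  finite almost everywhere.\<close>

lemma AE_summable_of_integrals:
  fixes d :: "nat \<Rightarrow> 'a \<Rightarrow> real"
  assumes i: "\<And>n. integrable M (d n)" and b: "\<And>n. (LINT x|M. \<bar>d n x\<bar>) \<le> B n" and s: "summable B"
  shows "AE x in M. summable (\<lambda>n. \<bar>d n x\<bar>)"
proof -
  have [measurable]: "d n \<in> borel_measurable M" for n using i by auto
  have B: "B n \<ge> 0" for n using order.trans[OF integral_nonneg_AE b[of n]] by simp
  have "(\<integral>\<^sup>+x. (\<Sum>n. ennreal \<bar>d n x\<bar>) \<partial>M) = (\<Sum>n. \<integral>\<^sup>+x. ennreal \<bar>d n x\<bar> \<partial>M)"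
    by (rule nn_integral_suminf) auto
  also have "\<dots> = (\<Sum>n. ennreal (LINT x|M. \<bar>d n x\<bar>))"
    using i by (intro suminf_cong nn_integral_eq_integral) auto
  also have "\<dots> \<le> (\<Sum>n. ennreal (B n))" using b by (intro suminf_le ennreal_leI) auto
  also have "\<dots> = ennreal (suminf B)" using B s by (intro suminf_ennreal2) auto
  finally have "(\<integral>\<^sup>+x. (\<Sum>n. ennreal \<bar>d n x\<bar>) \<partial>M) \<noteq> \<infinity>" by (auto simp: top_unique)
  then have "AE x in M. (\<Sum>n. ennreal \<bar>d n x\<bar>) \<noteq> \<infinity>" by (intro nn_integral_PInf_AE) auto
  then show ?thesis by eventually_elim (simp add: summable_suminf_not_top)
qed

text \<open>Riesz-Fischer: a rapidly converging subsequence of the partial sums converges almost everywhere,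
  and Fatou's lemma identifies the limit as an \<open>L\<^sup>2\<close> limit.\<close>
lemma partial_sums_approximate:
  assumes f: "sqint M f" and "\<epsilon> > 0"
  obtains F where "finite F" "F \<subseteq> I" "(LINT x|M. (f x - (\<Sum>i\<in>F. cf f i * e i x))\<^sup>2) < \<epsilon>"
proof -
  define c where "c = cf f"
  define s where "s = infsum (\<lambda>i. (c i)\<^sup>2) I"
  have "((\<lambda>i. (c i)\<^sup>2) has_sum s) I"
    unfolding s_def c_def by (rule has_sum_infsum[OF coefficients_summable[OF f]])
  then have hs: "(sum (\<lambda>i. (c i)\<^sup>2) \<longlongrightarrow> s) (finite_subsets_at_top I)" by (simp add: has_sum_def)
  have "\<exists>X. finite X \<and> X \<subseteq> I \<and> (\<forall>Y. finite Y \<and> X \<subseteq> Y \<and> Y \<subseteq> I \<longrightarrow> dist (\<Sum>i\<in>Y. (c i)\<^sup>2) s < (1/4)^n)" for n :: nat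
    using tendstoD[OF hs, of "(1/4)^n"] by (simp add: eventually_finite_subsets_at_top)
  then obtain X where X: "\<And>n. finite (X n)" "\<And>n. X n \<subseteq> I"
    "\<And>n Y. finite Y \<Longrightarrow> X n \<subseteq> Y \<Longrightarrow> Y \<subseteq> I \<Longrightarrow> dist (\<Sum>i\<in>Y. (c i)\<^sup>2) s < (1/4)^n"
    by metis
  \<comment> \<open>The union makes \<open>G\<close> increasing with the tail bounds of
    \<open>X\<close>; adjoining the indices numbered below n makes every index enter eventually,
    which the computation of the coefficients of the limit uses.\<close>
  define G where "G = (\<lambda>n. (\<Union>k\<le>n. X k) \<union> {i\<in>I. to_nat_on I i < n})"
  have "finite {i\<in>I. to_nat_on I i < n}" for n
    by (rule inj_on_finite[of "to_nat_on I" _ "{..<n}"])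
       (auto intro: inj_on_subset[OF inj_on_to_nat_on[OF countable_I]])
  then have G: "finite (G n)" "G n \<subseteq> I" "X n \<subseteq> G n" for n using X by (auto simp: G_def)
  have Gmono: "n \<le> m \<Longrightarrow> G n \<subseteq> G m" for n m unfolding G_def by force
  have Gsum: "(\<Sum>i\<in>G m - G n. (c i)\<^sup>2) \<le> 2 * (1/4)^n" if "n \<le> m" for n m
  proof -
    have "(\<Sum>i\<in>G m - G n. (c i)\<^sup>2) = (\<Sum>i\<in>G m. (c i)\<^sup>2) - (\<Sum>i\<in>G n. (c i)\<^sup>2)"
      by (rule sum_diff[OF G(1) Gmono[OF that]])
    moreover have "dist (\<Sum>i\<in>G m. (c i)\<^sup>2) s < (1/4)^n"
      using G[of m] G(3)[of n] Gmono[OF that] by (intro X(3)) auto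
    moreover have "dist (\<Sum>i\<in>G n. (c i)\<^sup>2) s < (1/4)^n" using G by (intro X(3)) auto
    ultimately show ?thesis unfolding dist_real_def by linarith
  qed
  define S where "S = (\<lambda>n x. \<Sum>i\<in>G n. c i * e i x)"
  have S: "sqint M (S n)" for n unfolding S_def using G(1,2)[of n] sqint_e by (intro sqint_sum) auto
  note [measurable] = sqint_measurable[OF S]
  have Sdiff: "(LINT x|M. (S m x - S n x)\<^sup>2) \<le> 2 * (1/4)^n" if "n \<le> m" for n m
  proof -
    define D where "D = (\<lambda>x. \<Sum>i\<in>G m - G n. c i * e i x)"
    have Dfin: "finite (G m - G n)" "G m - G n \<subseteq> I" using G by auto
    have D: "sqint M D" unfolding D_def using Dfin sqint_e by (intro sqint_sum) auto
    have "S m x - S n x = D x" for x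
      unfolding S_def D_def by (rule sum_diff[OF G(1) Gmono[OF that], symmetric])
    then have "(LINT x|M. (S m x - S n x)\<^sup>2) = (LINT x|M. D x * (\<Sum>i\<in>G m - G n. c i * e i x))"
      by (simp add: power2_eq_square D_def)
    also have "\<dots> = (\<Sum>i\<in>G m - G n. c i * cf D i)" by (rule integral_times_partial_sum[OF D Dfin])
    also have "\<dots> = (\<Sum>i\<in>G m - G n. (c i)\<^sup>2)"
      using cf_partial_sum[OF Dfin] Dfin(2)
      by (intro sum.cong) (auto simp: D_def c_def power2_eq_square)
    finally show ?thesis using Gsum[OF that] by simp
  qed
  define d where "d = (\<lambda>n x. S (Suc n) x - S n x)"
  have dsq: "sqint M (d n)" for n unfolding d_def by (intro sqint_diff S)
  have sq1: "sqint M (\<lambda>_. 1)" by (simp add: sqint_def)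
  have dint: "integrable M (d n)" for n using sqint_mult[OF dsq sq1] by simp
  have dB: "(LINT x|M. \<bar>d n x\<bar>) \<le> (measure M (space M) + 2) * (1/2)^n" for n
  proof -
    have am: "\<bar>d n x\<bar> \<le> (1/2)^n + 2^n * (d n x)\<^sup>2" for x
    proof -
      have "\<bar>d n x * 1\<bar> \<le> 2^n * (d n x)\<^sup>2 + 1 / 2^n * 1\<^sup>2" by (rule abs_mult_le_weighted) simp
      then show ?thesis by (simp add: power_divide)
    qed
    have "(LINT x|M. \<bar>d n x\<bar>) \<le> (LINT x|M. (1/2)^n + 2^n * (d n x)\<^sup>2)"
      using dint dsq am by (intro integral_mono) (auto simp: sqint_def)
    also have "\<dots> = measure M (space M) * (1/2)^n + 2^n * (LINT x|M. (d n x)\<^sup>2)"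
      using dsq by (simp add: sqint_def)
    also have "\<dots> \<le> measure M (space M) * (1/2)^n + 2^n * (2 * (1/4)^n)"
      using Sdiff[of n "Suc n"] by (simp add: d_def)
    also have "(2::real)^n * (2 * (1/4)^n) = 2 * (1/2)^n"
      by (simp add: power_mult_distrib[symmetric])
    finally show ?thesis by (simp add: algebra_simps)
  qed
  have "AE x in M. summable (\<lambda>n. \<bar>d n x\<bar>)"
    by (rule AE_summable_of_integrals[OF dint dB]) (intro summable_mult summable_geometric, simp)
  then have conv: "AE x in M. (\<lambda>n. S n x) \<longlonglongrightarrow> lim (\<lambda>n. S n x)"
  proof eventually_elim
    case (elim x)
    then have "summable (\<lambda>n. d n x)" by (rule summable_rabs_cancel)
    then have "convergent (\<lambda>n. \<Sum>k<n. d k x)" by (simp add: summable_iff_convergent)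
    moreover have "(\<Sum>k<n. d k x) = S n x - S 0 x" for n
      unfolding d_def by (rule sum_lessThan_telescope)
    ultimately have "convergent (\<lambda>n. S n x - S 0 x)" by simp
    then have "convergent (\<lambda>n. S n x)" by (simp add: convergent_diff_const_right_iff)
    then show ?case by (simp add: convergent_LIMSEQ_iff)
  qed
  define h where "h = (\<lambda>x. lim (\<lambda>n. S n x))"
  have [measurable]: "h \<in> borel_measurable M" unfolding h_def by measurable
  have fatou: "(\<integral>\<^sup>+x. ennreal ((h x - S n x)\<^sup>2) \<partial>M) \<le> ennreal (2 * (1/4)^n)" for n
  proof -
    have "(\<integral>\<^sup>+x. ennreal ((h x - S n x)\<^sup>2) \<partial>M) = (\<integral>\<^sup>+x. liminf (\<lambda>m. ennreal ((S m x - S n x)\<^sup>2)) \<partial>M)"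
    proof (rule nn_integral_cong_AE)
      show "AE x in M. ennreal ((h x - S n x)\<^sup>2) = liminf (\<lambda>m. ennreal ((S m x - S n x)\<^sup>2))"
        using conv
      proof eventually_elim
        case (elim x)
        then have "(\<lambda>m. ennreal ((S m x - S n x)\<^sup>2)) \<longlonglongrightarrow> ennreal ((h x - S n x)\<^sup>2)"
          unfolding h_def by (intro tendsto_intros)
        then show ?case using lim_imp_Liminf[of sequentially] by fastforce
      qed
    qed
    also have "\<dots> \<le> liminf (\<lambda>m. \<integral>\<^sup>+x. ennreal ((S m x - S n x)\<^sup>2) \<partial>M)"
      by (rule nn_integral_liminf) measurable
    also have "\<dots> \<le> liminf (\<lambda>m. ennreal (2 * (1/4)^n))"
    proof (rule Liminf_mono)
      show "\<forall>\<^sub>F m in sequentially. (\<integral>\<^sup>+x. ennreal ((S m x - S n x)\<^sup>2) \<partial>M) \<le> ennreal (2 * (1/4)^n)"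
        using eventually_ge_at_top[of n]
      proof eventually_elim
        case (elim m)
        have "(\<integral>\<^sup>+x. ennreal ((S m x - S n x)\<^sup>2) \<partial>M) = ennreal (LINT x|M. (S m x - S n x)\<^sup>2)"
          using sqint_diff[OF S S, of m n] by (intro nn_integral_eq_integral) (auto simp: sqint_def)
        then show ?case using Sdiff[OF elim] by (simp add: ennreal_leI)
      qed
    qed
    also have "\<dots> = ennreal (2 * (1/4)^n)" by (rule Liminf_const) simp
    finally show ?thesis .
  qed
  have hS: "sqint M (\<lambda>x. h x - S n x)" for n
  proof -
    have "(\<integral>\<^sup>+x. ennreal (norm ((h x - S n x)\<^sup>2)) \<partial>M) < \<infinity>"
      using le_less_trans[OF fatou[of n] ennreal_less_top] by simp
    then show ?thesis by (auto simp: sqint_def intro!: integrableI_bounded)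
  qed
  have hSn: "(LINT x|M. (h x - S n x)\<^sup>2) \<le> 2 * (1/4)^n" for n
  proof -
    have "ennreal (LINT x|M. (h x - S n x)\<^sup>2) = (\<integral>\<^sup>+x. ennreal ((h x - S n x)\<^sup>2) \<partial>M)"
      using hS[of n] by (intro nn_integral_eq_integral[symmetric]) (auto simp: sqint_def)
    also note fatou[of n]
    finally show ?thesis by simp
  qed
  have h: "sqint M h" using sqint_add[OF hS[of 0] S[of 0]] by simp
  have cfh: "cf h i = c i" if i: "i \<in> I" for i
  proof -
    have lim0: "(\<lambda>n. (1/2)^n * (2 + (LINT x|M. (e i x)\<^sup>2))) \<longlonglongrightarrow> 0 * (2 + (LINT x|M. (e i x)\<^sup>2))"
      by (intro tendsto_intros LIMSEQ_realpow_zero) auto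
    have "\<bar>cf h i - c i\<bar> \<le> (1/2)^n * (2 + (LINT x|M. (e i x)\<^sup>2))" if n: "to_nat_on I i < n" for n
    proof -
      have iG: "i \<in> G n" using n i by (auto simp: G_def)
      have "cf (\<lambda>x. 1 * h x + (-1) * S n x) i = cf h i - cf (S n) i"
        using cf_linear[OF h S[of n] i, of 1 "-1"] by simp
      also have "cf (S n) i = c i" using cf_partial_sum[OF G(1)[of n] G(2)[of n] i, of f] iG by (simp add: S_def c_def)
      finally have eq: "cf h i - c i = (LINT x|M. (h x - S n x) * e i x)" by (simp add: cf_def)
      \<comment> \<open>This weight balances the bound 2 / 4^n of the first square against the fixed
        norm of \<open>e i\<close>: both become multiples of 2^(-n).\<close>
      define t where "t = (2::real)^n"
      have t: "t > 0" "(1/2)^n = 1 / t" "(1/4)^n = 1 / t * (1 / t)"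
        by (simp_all add: t_def power_divide power_mult_distrib[symmetric])
      note am = abs_mult_le_weighted[OF t(1)]
      have "\<bar>cf h i - c i\<bar> \<le> (LINT x|M. \<bar>(h x - S n x) * e i x\<bar>)"
        unfolding eq by (rule integral_abs_bound)
      also have "\<dots> \<le> (LINT x|M. t * (h x - S n x)\<^sup>2 + 1 / t * (e i x)\<^sup>2)"
        using am sqint_mult[OF hS sqint_e[OF i], of n] hS[of n] sqint_e[OF i]
        by (intro integral_mono) (auto simp: sqint_def)
      also have "\<dots> = t * (LINT x|M. (h x - S n x)\<^sup>2) + 1 / t * (LINT x|M. (e i x)\<^sup>2)"
        using hS[of n] sqint_e[OF i] by (simp add: sqint_def)
      also have "\<dots> \<le> t * (2 * (1/4)^n) + 1 / t * (LINT x|M. (e i x)\<^sup>2)"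
        using hSn[of n] t(1) by (intro add_right_mono mult_left_mono) auto
      also have "\<dots> = (1/2)^n * (2 + (LINT x|M. (e i x)\<^sup>2))"
        unfolding t(2,3) using t(1) by (simp add: field_simps)
      finally show ?thesis .
    qed
    then have "eventually (\<lambda>n. \<bar>cf h i - c i\<bar> \<le> (1/2)^n * (2 + (LINT x|M. (e i x)\<^sup>2))) sequentially"
      by (intro eventually_sequentiallyI[of "Suc (to_nat_on I i)"]) auto
    from tendsto_lowerbound[OF lim0 this] show ?thesis by simp
  qed
  \<comment> \<open>The limit \<open>h\<close> has the coefficients of \<open>f\<close>, and it is
    totality that identifies the two.\<close>
  have "AE x in M. 1 * f x + (-1) * h x = 0"
  proof (rule total)
    show "sqint M (\<lambda>x. 1 * f x + (-1) * h x)" by (rule sqint_linear[OF f h])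
    show "(LINT x|M. (1 * f x + (-1) * h x) * e i x) = 0" if "i \<in> I" for i
      using cf_linear[OF f h that, of 1 "-1"] cfh[OF that] by (simp add: cf_def c_def)
  qed
  then have fh: "AE x in M. (f x - S n x)\<^sup>2 = (h x - S n x)\<^sup>2" for n by eventually_elim simp
  have fS: "(LINT x|M. (f x - S n x)\<^sup>2) \<le> 2 * (1/4)^n" for n
  proof -
    have "(LINT x|M. (f x - S n x)\<^sup>2) = (LINT x|M. (h x - S n x)\<^sup>2)"
      by (intro integral_cong_AE fh borel_measurable_power borel_measurable_diff sqint_measurable f h S)
    then show ?thesis using hSn[of n] by simp
  qed
  obtain n where "(1/4)^n < \<epsilon> / 2" using real_arch_pow_inv[of "\<epsilon> / 2" "1/4"] \<open>\<epsilon> > 0\<close> by auto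
  then have "(LINT x|M. (f x - S n x)\<^sup>2) < \<epsilon>" using fS[of n] by linarith
  then show ?thesis using that[of "G n"] G[of n] by (simp add: S_def c_def)
qed

text \<open>By Bessel's identity the error only decreases as the finite set grows, so one good set
  bounds all larger ones.\<close>

lemma expansion_tendsto:
  assumes f: "sqint M f"
  shows "((\<lambda>F. LINT x|M. (f x - (\<Sum>i\<in>F. cf f i * e i x))\<^sup>2) \<longlongrightarrow> 0) (finite_subsets_at_top I)"
proof (rule tendstoI)
  fix \<epsilon> :: real assume "\<epsilon> > 0"
  obtain F where F: "finite F" "F \<subseteq> I" "(LINT x|M. (f x - (\<Sum>i\<in>F. cf f i * e i x))\<^sup>2) < \<epsilon>"
    using partial_sums_approximate[OF f \<open>\<epsilon> > 0\<close>] .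
  show "\<forall>\<^sub>F F in finite_subsets_at_top I. dist (LINT x|M. (f x - (\<Sum>i\<in>F. cf f i * e i x))\<^sup>2) 0 < \<epsilon>"
    unfolding eventually_finite_subsets_at_top
  proof (intro exI[of _ F] conjI allI impI F)
    fix Y assume Y: "finite Y \<and> F \<subseteq> Y \<and> Y \<subseteq> I"
    have "(\<Sum>i\<in>F. (cf f i)\<^sup>2) \<le> (\<Sum>i\<in>Y. (cf f i)\<^sup>2)" using Y by (intro sum_mono2) auto
    then have "(LINT x|M. (f x - (\<Sum>i\<in>Y. cf f i * e i x))\<^sup>2) < \<epsilon>"
      using F(3) bessel_identity[OF f, of Y] bessel_identity[OF f F(1,2)] Y by auto
    then show "dist (LINT x|M. (f x - (\<Sum>i\<in>Y. cf f i * e i x))\<^sup>2) 0 < \<epsilon>"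
      using integral_square_nonneg[of "\<lambda>x. f x - (\<Sum>i\<in>Y. cf f i * e i x)"] by simp
  qed
qed

lemma parseval_square:
  assumes f: "sqint M f" shows "((\<lambda>i. (cf f i)\<^sup>2) has_sum (LINT x|M. (f x)\<^sup>2)) I"
  unfolding has_sum_def
proof -
  have "((\<lambda>F. (LINT x|M. (f x)\<^sup>2) - (LINT x|M. (f x - (\<Sum>i\<in>F. cf f i * e i x))\<^sup>2)) \<longlongrightarrow> (LINT x|M. (f x)\<^sup>2) - 0)
     (finite_subsets_at_top I)"
    by (intro tendsto_intros expansion_tendsto f)
  moreover have "\<forall>\<^sub>F F in finite_subsets_at_top I.
      (LINT x|M. (f x)\<^sup>2) - (LINT x|M. (f x - (\<Sum>i\<in>F. cf f i * e i x))\<^sup>2) = (\<Sum>i\<in>F. (cf f i)\<^sup>2)"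
    using bessel_identity[OF f] by (intro eventually_finite_subsets_at_top_weakI) auto
  ultimately show "(sum (\<lambda>i. (cf f i)\<^sup>2) \<longlongrightarrow> (LINT x|M. (f x)\<^sup>2)) (finite_subsets_at_top I)"
    by (simp add: tendsto_cong)
qed

text \<open>Polarization of \<open>parseval_square\<close>.\<close>

lemma parseval:
  assumes f: "sqint M f" and g: "sqint M g"
  shows "((\<lambda>i. cf f i * cf g i) has_sum (LINT x|M. f x * g x)) I"
proof -
  note p = parseval_square[OF sqint_linear[OF f g, of 1 1]] and m = parseval_square[OF sqint_linear[OF f g, of 1 "-1"]]
  define L where "L = (\<lambda>i. 1/4 * ((cf (\<lambda>x. 1 * f x + 1 * g x) i)\<^sup>2 + (-1) * (cf (\<lambda>x. 1 * f x + (-1) * g x) i)\<^sup>2))"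
  have hs: "(L has_sum
     1/4 * ((LINT x|M. (1 * f x + 1 * g x)\<^sup>2) + (-1) * (LINT x|M. (1 * f x + (-1) * g x)\<^sup>2))) I"
    unfolding L_def by (intro has_sum_cmult_right has_sum_add p m)
  have "1/4 * ((LINT x|M. (1 * f x + 1 * g x)\<^sup>2) + (-1) * (LINT x|M. (1 * f x + (-1) * g x)\<^sup>2))
     = (LINT x|M. 1/4 * ((1 * f x + 1 * g x)\<^sup>2 + (-1) * (1 * f x + (-1) * g x)\<^sup>2))"
    using sqint_linear[OF f g, of 1 1] sqint_linear[OF f g, of 1 "-1"] by (simp add: sqint_def)
  also have "\<dots> = (LINT x|M. f x * g x)"
    by (rule Bochner_Integration.integral_cong) (auto simp: power2_eq_square algebra_simps)
  finally have val: "1/4 * ((LINT x|M. (1 * f x + 1 * g x)\<^sup>2) + (-1) * (LINT x|M. (1 * f x + (-1) * g x)\<^sup>2))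
     = (LINT x|M. f x * g x)" .
  have co: "L i = cf f i * cf g i" if "i \<in> I" for i
    unfolding L_def cf_linear[OF f g that] by (simp add: power2_eq_square algebra_simps)
  show ?thesis using hs has_sum_cong[of I L "\<lambda>i. cf f i * cf g i"] co unfolding val by simp
qed

end

section \<open>The Sturm-Liouville problem\<close>

text \<open>What the definite description in \<open>lam2\<close> requires. Existence climbs from one
  element to the next larger one; uniqueness holds because the count of smaller elements increases
  strictly along \<open>S\<close>.\<close>

lemma infinite_finite_below_enumerates:
  fixes S :: "real set"
  assumes inf: "infinite S" and fin: "\<And>M. finite {s\<in>S. s < M}"
  shows "\<exists>!m. m \<in> S \<and> card {s\<in>S. s < m} = n"
proof (rule ex_ex1I)
  have next_ex: "\<exists>m. m \<in> S \<and> B < m \<and> (\<forall>s\<in>S. s < m \<longrightarrow> s \<le> B)" for B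
  proof -
    have "\<not> S \<subseteq> {s\<in>S. s < B + 1}" using inf fin[of "B + 1"] finite_subset by blast
    then obtain s0 where s0: "s0 \<in> S" "B < s0" by force
    \<comment> \<open>The bound s0 + 1 keeps s0 itself in this finite window, so the minimum exists
      and is at most s0.\<close>
    define X where "X = {s\<in>S. B < s \<and> s < s0 + 1}"
    have X: "finite X" "s0 \<in> X"
      using s0 by (auto simp: X_def intro: finite_subset[OF _ fin[of "s0 + 1"]])
    then have "Min X \<in> X" using Min_in by blast
    moreover have "s \<le> B" if "s \<in> S" "s < Min X" for s
    proof (rule ccontr)
      assume "\<not> s \<le> B"
      have "Min X \<le> s0" using X by simp
      then have "s \<in> X" using that \<open>\<not> s \<le> B\<close> by (simp add: X_def)
      then show False using X(1) that(2) by (simp add: leD)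
    qed
    ultimately show ?thesis unfolding X_def by blast
  qed
  show "\<exists>m. m \<in> S \<and> card {s\<in>S. s < m} = n"
  proof (induction n)
    case 0
    obtain s0 where "s0 \<in> S" using inf by fastforce
    define X where "X = {s\<in>S. s < s0 + 1}"
    have X: "finite X" "s0 \<in> X" using fin \<open>s0 \<in> S\<close> by (auto simp: X_def)
    then have m: "Min X \<in> X" using Min_in by blast
    have "\<not> s < Min X" if "s \<in> S" for s
    proof
      assume "s < Min X"
      moreover have "Min X \<le> s0" using X by simp
      ultimately have "s \<in> X" using that by (simp add: X_def)
      then show False using X(1) \<open>s < Min X\<close> by (simp add: leD)
    qed
    then have e: "{s\<in>S. s < Min X} = {}" by blast
    have "Min X \<in> S" using m by (simp add: X_def)
    then show ?case by (intro exI[of _ "Min X"] conjI) (simp_all only: e card.empty)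
  next
    case (Suc n)
    then obtain m where m: "m \<in> S" "card {s\<in>S. s < m} = n" by blast
    obtain m' where m': "m' \<in> S" "m < m'" "\<forall>s\<in>S. s < m' \<longrightarrow> s \<le> m" using next_ex by blast
    then have "{s\<in>S. s < m'} = insert m {s\<in>S. s < m}" using m(1) by force
    then show ?case using m m' fin[of m] by (intro exI[of _ m']) simp
  qed
next
  fix m m' assume m: "m \<in> S \<and> card {s\<in>S. s < m} = n" "m' \<in> S \<and> card {s\<in>S. s < m'} = n"
  have lt: "card {s\<in>S. s < a} < card {s\<in>S. s < b}" if "a \<in> S" "a < b" for a b
    by (rule psubset_card_mono[OF fin]) (use that in force)
  show "m = m'"
  proof (rule ccontr)
    assume "m \<noteq> m'"
    then consider "m < m'" | "m' < m" by linarith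
    then show False using lt[of m m'] lt[of m' m] m by cases simp_all
  qed
qed

section \<open>The Dirichlet problem with given right-hand side\<close>

definition prim :: "(real \<Rightarrow> real) \<Rightarrow> real \<Rightarrow> real" where
  "prim g x = integral {0..x} g"

text \<open>\<open>sol u g\<close> is the solution of \<open>- (u y')' = g\<close>, \<open>y 0 = y pi = 0\<close>, and \<open>flux u g\<close> is \<open>u y'\<close>.\<close>
definition flux :: "(real \<Rightarrow> real) \<Rightarrow> (real \<Rightarrow> real) \<Rightarrow> real \<Rightarrow> real" where
  "flux u g x = integral {0..pi} (\<lambda>s. prim g s / u s) / integral {0..pi} (\<lambda>s. 1 / u s) - prim g x"

definition sol :: "(real \<Rightarrow> real) \<Rightarrow> (real \<Rightarrow> real) \<Rightarrow> real \<Rightarrow> real" where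
  "sol u g x = integral {0..x} (\<lambda>s. flux u g s / u s)"

definition ip :: "(real \<Rightarrow> real) \<Rightarrow> (real \<Rightarrow> real) \<Rightarrow> (real \<Rightarrow> real) \<Rightarrow> real" where
  "ip u f g = integral {0..pi} (\<lambda>x. u x * f x * g x)"

locale sl_weight =
  fixes u :: "real \<Rightarrow> real"
  assumes cont_u: "continuous_on {0..pi} u" and pos_u: "\<And>x. x \<in> {0..pi} \<Longrightarrow> u x > 0"
begin

lemma nz_u: "x \<in> {0..pi} \<Longrightarrow> u x \<noteq> 0"
  using pos_u[of x] by auto

lemma u_lower_bound: obtains m where "m > 0" "\<And>x. x \<in> {0..pi} \<Longrightarrow> m \<le> u x"
proof -
  obtain x0 where "x0 \<in> {0..pi}" "\<forall>y\<in>{0..pi}. u x0 \<le> u y"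
    using continuous_attains_inf[OF compact_Icc _ cont_u] pi_ge_zero by auto
  then show ?thesis using that[of "u x0"] pos_u by auto
qed

lemma u_upper_bound: obtains M where "M > 0" "\<And>x. x \<in> {0..pi} \<Longrightarrow> u x \<le> M"
proof -
  obtain x0 where "x0 \<in> {0..pi}" "\<forall>y\<in>{0..pi}. u y \<le> u x0"
    using continuous_attains_sup[OF compact_Icc _ cont_u] pi_ge_zero by auto
  then show ?thesis using that[of "u x0"] pos_u by auto
qed

lemma integral_inverse_u_pos: "integral {0..pi} (\<lambda>s. 1 / u s) > 0"
proof -
  have c: "continuous_on {0..pi} (\<lambda>s. 1 / u s)"
    using nz_u by (intro continuous_intros cont_u) auto
  have "integral {0..pi} (\<lambda>s. 1 / u s) \<ge> 0"
    using pos_u by (intro integral_nonneg integrable_continuous_real c) (auto intro: less_imp_le)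
  moreover have "integral {0..pi} (\<lambda>s. 1 / u s) \<noteq> 0"
    using integral_nonneg_eq_0_continuous[OF pi_gt_zero c, of 0] pos_u nz_u[of 0] by (force intro: less_imp_le)
  ultimately show ?thesis by linarith
qed

lemma continuous_on_prim:
  assumes "g integrable_on {0..pi}" shows "continuous_on {0..pi} (prim g)"
  unfolding prim_def[abs_def] by (rule indefinite_integral_continuous_1[OF assms])

lemma continuous_on_flux:
  assumes "g integrable_on {0..pi}" shows "continuous_on {0..pi} (flux u g)"
  unfolding flux_def[abs_def] by (intro continuous_intros continuous_on_prim assms)

lemma continuous_on_flux_div:
  assumes "g integrable_on {0..pi}" shows "continuous_on {0..pi} (\<lambda>s. flux u g s / u s)"
  using nz_u by (intro continuous_intros continuous_on_flux assms cont_u) auto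

lemma sol_deriv:
  assumes "g integrable_on {0..pi}" "x \<in> {0..pi}"
  shows "(sol u g has_real_derivative flux u g x / u x) (at x within {0..pi})"
  unfolding sol_def[abs_def] by (rule integral_has_real_derivative[OF continuous_on_flux_div[OF assms(1)] assms(2)])

lemma continuous_on_sol:
  assumes "g integrable_on {0..pi}" shows "continuous_on {0..pi} (sol u g)"
  by (rule DERIV_continuous_on[OF sol_deriv[OF assms]])

lemma sol_0: "sol u g 0 = 0" by (simp add: sol_def)

text \<open>The constant in \<open>flux\<close> is chosen to produce this boundary value.\<close>

lemma sol_pi: assumes "g integrable_on {0..pi}" shows "sol u g pi = 0"
proof -
  define c where "c = integral {0..pi} (\<lambda>s. prim g s / u s) / integral {0..pi} (\<lambda>s. 1 / u s)"
  have "sol u g pi = integral {0..pi} (\<lambda>s. c * (1 / u s) - prim g s / u s)"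
    by (simp add: sol_def flux_def c_def diff_divide_distrib)
  also have "\<dots> = integral {0..pi} (\<lambda>s. c * (1 / u s)) - integral {0..pi} (\<lambda>s. prim g s / u s)"
    using nz_u by (intro Henstock_Kurzweil_Integration.integral_diff integrable_continuous_real continuous_intros cont_u
        continuous_on_prim assms) auto
  also have "\<dots> = 0" using integral_inverse_u_pos by (subst integral_mult_right) (simp add: c_def)
  finally show ?thesis .
qed

lemma flux_deriv:
  assumes "continuous_on {0..pi} g" "x \<in> {0..pi}"
  shows "(flux u g has_real_derivative - g x) (at x within {0..pi})"
  unfolding flux_def[abs_def] prim_def[abs_def]
  by (auto intro!: derivative_eq_intros integral_has_real_derivative[OF assms])

lemma prim_cong:
  assumes "\<And>x. x \<in> {0..pi} \<Longrightarrow> g x = h x" "x \<in> {0..pi}"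
  shows "prim g x = prim h x"
  unfolding prim_def by (rule integral_cong) (use assms in auto)

lemma flux_cong:
  assumes "\<And>x. x \<in> {0..pi} \<Longrightarrow> g x = h x" "x \<in> {0..pi}"
  shows "flux u g x = flux u h x"
proof -
  have "integral {0..pi} (\<lambda>s. prim g s / u s) = integral {0..pi} (\<lambda>s. prim h s / u s)"
    by (rule integral_cong) (use prim_cong[OF assms(1)] in auto)
  then show ?thesis using prim_cong[OF assms] by (simp add: flux_def)
qed

lemma sol_cong:
  assumes "\<And>x. x \<in> {0..pi} \<Longrightarrow> g x = h x" "x \<in> {0..pi}"
  shows "sol u g x = sol u h x"
  unfolding sol_def by (rule integral_cong) (use flux_cong[OF assms(1)] assms(2) in auto)

lemma prim_linear:
  assumes "g integrable_on {0..pi}" "h integrable_on {0..pi}" "x \<in> {0..pi}"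
  shows "prim (\<lambda>x. a * g x + b * h x) x = a * prim g x + b * prim h x"
proof -
  have "g integrable_on {0..x}" "h integrable_on {0..x}"
    using assms by (auto intro: integrable_on_subinterval)
  then have "(\<lambda>x. a * g x) integrable_on {0..x}" "(\<lambda>x. b * h x) integrable_on {0..x}"
    using integrable_cmul[of g _ a] integrable_cmul[of h _ b] by auto
  then show ?thesis
    unfolding prim_def by (subst Henstock_Kurzweil_Integration.integral_add) auto
qed

lemma flux_linear:
  assumes "g integrable_on {0..pi}" "h integrable_on {0..pi}" "x \<in> {0..pi}"
  shows "flux u (\<lambda>x. a * g x + b * h x) x = a * flux u g x + b * flux u h x"
proof -
  have c: "continuous_on {0..pi} (\<lambda>s. prim g s / u s)" "continuous_on {0..pi} (\<lambda>s. prim h s / u s)"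
    using nz_u by (auto intro!: continuous_intros cont_u continuous_on_prim assms)
  have "integral {0..pi} (\<lambda>s. prim (\<lambda>x. a * g x + b * h x) s / u s)
      = integral {0..pi} (\<lambda>s. a * (prim g s / u s) + b * (prim h s / u s))"
    by (rule integral_cong) (use prim_linear[OF assms(1,2)] in \<open>simp add: add_divide_distrib\<close>)
  also have "\<dots> = a * integral {0..pi} (\<lambda>s. prim g s / u s) + b * integral {0..pi} (\<lambda>s. prim h s / u s)"
    by (subst Henstock_Kurzweil_Integration.integral_add)
       (auto simp del: times_divide_eq_right intro!: integrable_continuous_real continuous_intros c)
  finally show ?thesis
    using prim_linear[OF assms] by (simp add: flux_def add_divide_distrib algebra_simps)
qed

lemma sol_linear:
  assumes "g integrable_on {0..pi}" "h integrable_on {0..pi}" "x \<in> {0..pi}"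
  shows "sol u (\<lambda>x. a * g x + b * h x) x = a * sol u g x + b * sol u h x"
proof -
  have c: "continuous_on {0..x} (\<lambda>s. flux u g s / u s)" "continuous_on {0..x} (\<lambda>s. flux u h s / u s)"
    using assms by (auto intro: continuous_on_subset[OF continuous_on_flux_div])
  have "sol u (\<lambda>x. a * g x + b * h x) x
      = integral {0..x} (\<lambda>s. a * (flux u g s / u s) + b * (flux u h s / u s))"
    unfolding sol_def
    by (rule integral_cong) (use flux_linear[OF assms(1,2)] assms(3) in \<open>simp add: add_divide_distrib\<close>)
  also have "\<dots> = a * sol u g x + b * sol u h x"
    unfolding sol_def by (subst Henstock_Kurzweil_Integration.integral_add)
       (auto simp del: times_divide_eq_right intro!: integrable_continuous_real continuous_intros c)
  finally show ?thesis .
qed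

text \<open>The boundary terms of the integration by parts vanish, and what remains is symmetric in
  \<open>g\<close> and \<open>h\<close>. Both symmetry and nonnegativity of \<open>K\<close> come
  from here.\<close>

lemma integral_sol_times:
  assumes g: "g integrable_on {0..pi}" and h: "continuous_on {0..pi} h"
  shows "integral {0..pi} (\<lambda>x. sol u g x * h x) = integral {0..pi} (\<lambda>x. flux u g x * flux u h x / u x)"
proof -
  have "integral {0..pi} (\<lambda>x. sol u g x * - h x) = sol u g pi * flux u h pi - sol u g 0 * flux u h 0
      - integral {0..pi} (\<lambda>x. flux u g x / u x * flux u h x)"
    by (rule integral_by_parts_C1) (auto intro!: sol_deriv flux_deriv g h continuous_on_flux_div continuous_intros)
  then show ?thesis by (simp add: sol_0 sol_pi[OF g] field_simps)
qed

section \<open>The weighted inner product and the solution operator\<close>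

lemma ip_commute: "ip u f g = ip u g f" by (simp add: ip_def mult_ac)

lemma ip_cong: "(\<And>x. x \<in> {0..pi} \<Longrightarrow> f x = f' x) \<Longrightarrow> (\<And>x. x \<in> {0..pi} \<Longrightarrow> g x = g' x) \<Longrightarrow> ip u f g = ip u f' g'"
  unfolding ip_def by (rule integral_cong) auto

lemma ip_linear:
  assumes "continuous_on {0..pi} f" "continuous_on {0..pi} g" "continuous_on {0..pi} h"
  shows "ip u (\<lambda>x. a * f x + b * g x) h = a * ip u f h + b * ip u g h"
proof -
  have "ip u (\<lambda>x. a * f x + b * g x) h = integral {0..pi} (\<lambda>x. a * (u x * f x * h x) + b * (u x * g x * h x))"
    by (simp add: ip_def algebra_simps)
  also have "\<dots> = a * ip u f h + b * ip u g h"
    unfolding ip_def by (subst Henstock_Kurzweil_Integration.integral_add)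
      (auto intro!: integrable_continuous_real continuous_intros cont_u assms)
  finally show ?thesis .
qed

lemma ip_combine:
  assumes f: "continuous_on {0..pi} f" and g: "continuous_on {0..pi} g"
  shows "ip u (\<lambda>x. a * f x + b * g x) (\<lambda>x. a * f x + b * g x)
     = a\<^sup>2 * ip u f f + 2 * a * b * ip u f g + b\<^sup>2 * ip u g g"
proof -
  have c: "continuous_on {0..pi} (\<lambda>x. a * f x + b * g x)" by (intro continuous_intros f g)
  show ?thesis
    using ip_linear[OF f g c, of a b] ip_linear[OF f g f, of a b] ip_linear[OF f g g, of a b]
      ip_commute[of f g] ip_commute[of f "\<lambda>x. a * f x + b * g x"] ip_commute[of g "\<lambda>x. a * f x + b * g x"]
    by (simp add: power2_eq_square algebra_simps)
qed

lemma ip_nonneg: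
  assumes "continuous_on {0..pi} f" shows "ip u f f \<ge> 0"
  unfolding ip_def using pos_u
  by (intro integral_nonneg integrable_continuous_real continuous_intros cont_u assms)
     (simp add: less_imp_le mult.assoc)

lemma ip_eq_0:
  assumes "continuous_on {0..pi} f" "ip u f f = 0" "x \<in> {0..pi}" shows "f x = 0"
proof -
  have "u x * f x * f x = 0"
    by (rule integral_nonneg_eq_0_continuous[OF pi_gt_zero _ _ assms(2)[unfolded ip_def] assms(3)])
       (auto intro!: continuous_intros cont_u assms(1) simp: mult.assoc less_imp_le pos_u)
  then show ?thesis using nz_u[OF assms(3)] by simp
qed

text \<open>The inverse of y \<mapsto> - (u y')' / u under the boundary conditions; an eigenvalue
  \<mu> of the Sturm-Liouville problem appears as the eigenvalue 1 / \<mu> of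
  \<open>K\<close>.\<close>

definition K :: "(real \<Rightarrow> real) \<Rightarrow> real \<Rightarrow> real" where
  "K f = sol u (\<lambda>x. u x * f x)"

lemma continuous_on_K: "continuous_on {0..pi} f \<Longrightarrow> continuous_on {0..pi} (K f)"
  unfolding K_def by (intro continuous_on_sol integrable_continuous_real continuous_intros cont_u)

lemma K_linear:
  assumes "continuous_on {0..pi} f" "continuous_on {0..pi} g" "x \<in> {0..pi}"
  shows "K (\<lambda>x. a * f x + b * g x) x = a * K f x + b * K g x"
proof -
  have "K (\<lambda>x. a * f x + b * g x) x = sol u (\<lambda>x. a * (u x * f x) + b * (u x * g x)) x"
    unfolding K_def by (rule sol_cong[OF _ assms(3)]) (simp add: algebra_simps)
  then show ?thesis
    using assms by (simp add: K_def sol_linear integrable_continuous_real continuous_on_mult cont_u)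
qed

lemma K_cong: "(\<And>x. x \<in> {0..pi} \<Longrightarrow> f x = g x) \<Longrightarrow> x \<in> {0..pi} \<Longrightarrow> K f x = K g x"
  unfolding K_def by (rule sol_cong) auto

lemma ip_K:
  assumes "continuous_on {0..pi} f" "continuous_on {0..pi} g"
  shows "ip u (K f) g = integral {0..pi} (\<lambda>x. flux u (\<lambda>x. u x * f x) x * flux u (\<lambda>x. u x * g x) x / u x)"
  using integral_sol_times[of "\<lambda>x. u x * f x" "\<lambda>x. u x * g x"] assms
  by (simp add: K_def ip_def integrable_continuous_real continuous_on_mult cont_u mult_ac)

lemma K_symmetric:
  assumes "continuous_on {0..pi} f" "continuous_on {0..pi} g"
  shows "ip u (K f) g = ip u f (K g)"
  using ip_K[OF assms] ip_K[OF assms(2,1)] ip_commute[of f "K g"] by (simp add: mult_ac)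

text \<open>On the diagonal, \<open>ip_K\<close> integrates a square divided by \<open>u\<close>.
  This later excludes a negative eigenvalue of \<open>K\<close>.\<close>

lemma K_nonneg:
  assumes "continuous_on {0..pi} f" shows "ip u (K f) f \<ge> 0"
  unfolding ip_K[OF assms assms] using pos_u nz_u assms
  by (intro integral_nonneg integrable_continuous_real continuous_intros cont_u continuous_on_flux)
     (auto simp: less_imp_le)

text \<open>Derivatives within the closed interval are unique at its endpoints as well, so the flux
  vanishes there too.\<close>

lemma sol_eq_0_imp:
  assumes g: "g integrable_on {0..pi}" and z: "\<And>x. x \<in> {0..pi} \<Longrightarrow> sol u g x = 0" and x: "x \<in> {0..pi}"
  shows "flux u g x = 0"
proof -
  have "(sol u g has_real_derivative 0) (at x within {0..pi})"
    by (rule has_field_derivative_transform_within[OF DERIV_const zero_less_one x]) (simp add: z)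
  moreover have "at x within {0..pi} \<noteq> bot"
    using x pi_gt_zero by (simp add: trivial_limit_within islimpt_Icc)
  ultimately have "flux u g x / u x = 0" using sol_deriv[OF g x]
    by (metis has_real_derivative_iff_has_vector_derivative vector_derivative_unique_within)
  then show ?thesis using nz_u[OF x] by simp
qed

lemma K_injective:
  assumes f: "continuous_on {0..pi} f" and z: "\<And>x. x \<in> {0..pi} \<Longrightarrow> K f x = 0" and x: "x \<in> {0..pi}"
  shows "f x = 0"
proof -
  have c: "continuous_on {0..pi} (\<lambda>x. u x * f x)" by (intro continuous_intros cont_u f)
  have z': "y \<in> {0..pi} \<Longrightarrow> flux u (\<lambda>x. u x * f x) y = 0" for y
    using sol_eq_0_imp[OF integrable_continuous_real[OF c]] z by (auto simp: K_def)
  have "(flux u (\<lambda>x. u x * f x) has_real_derivative 0) (at x within {0..pi})"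
    by (rule has_field_derivative_transform_within[OF DERIV_const zero_less_one x]) (simp add: z')
  moreover have "at x within {0..pi} \<noteq> bot"
    using x pi_gt_zero by (simp add: trivial_limit_within islimpt_Icc)
  ultimately have "- (u x * f x) = 0" using flux_deriv[OF c x]
    by (metis has_real_derivative_iff_has_vector_derivative vector_derivative_unique_within)
  then show ?thesis using nz_u[OF x] by simp
qed

section \<open>Eigenfunctions and their energy identity\<close>

lemma eigfunE:
  assumes "sl_eigfun u \<mu> \<phi>"
  obtains \<phi>' where
    "\<And>x. x \<in> {0..pi} \<Longrightarrow> (\<phi> has_real_derivative \<phi>' x) (at x within {0..pi})"
    "\<And>x. x \<in> {0..pi} \<Longrightarrow> ((\<lambda>s. u s * \<phi>' s) has_real_derivative (- \<mu> * u x * \<phi> x)) (at x within {0..pi})"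
    "continuous_on {0..pi} \<phi>" "continuous_on {0..pi} \<phi>'" "\<phi> 0 = 0" "\<phi> pi = 0"
proof -
  obtain \<phi>' where d: "\<And>x. x \<in> {0..pi} \<Longrightarrow> (\<phi> has_real_derivative \<phi>' x) (at x within {0..pi})"
    and d2: "\<And>x. x \<in> {0..pi} \<Longrightarrow> ((\<lambda>s. u s * \<phi>' s) has_real_derivative (- \<mu> * u x * \<phi> x)) (at x within {0..pi})"
    and z: "\<phi> 0 = 0" "\<phi> pi = 0"
    using assms unfolding sl_eigfun_def by blast
  have c: "continuous_on {0..pi} \<phi>" by (rule DERIV_continuous_on[OF d])
  \<comment> \<open>Continuity of the derivative is not part of \<open>sl_eigfun\<close>; it is
    recovered by dividing the differentiable product by \<open>u\<close>.\<close>
  have "continuous_on {0..pi} (\<lambda>s. (u s * \<phi>' s) / u s)"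
    using nz_u by (intro continuous_intros DERIV_continuous_on[OF d2] cont_u) auto
  then have "continuous_on {0..pi} \<phi>'"
    by (rule continuous_on_eq) (use nz_u in auto)
  then show ?thesis using that d d2 z c by blast
qed

lemma eigfun_continuous: "sl_eigfun u \<mu> \<phi> \<Longrightarrow> continuous_on {0..pi} \<phi>"
  by (erule eigfunE)

lemma eigfun_boundary: "sl_eigfun u \<mu> \<phi> \<Longrightarrow> \<phi> 0 = 0" "sl_eigfun u \<mu> \<phi> \<Longrightarrow> \<phi> pi = 0"
  by (simp_all add: sl_eigfun_def)

lemma eigfun_ip_pos: assumes "sl_eigfun u \<mu> \<phi>" shows "ip u \<phi> \<phi> > 0"
proof -
  have "ip u \<phi> \<phi> \<noteq> 0" using assms ip_eq_0[OF eigfun_continuous[OF assms]] by (auto simp: sl_eigfun_def)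
  then show ?thesis using ip_nonneg[OF eigfun_continuous[OF assms]] by simp
qed

text \<open>The weak form of the eigenvalue equation. With \<open>h\<close> the eigenfunction itself
  it gives positivity, with another eigenfunction orthogonality, with \<open>sol u g\<close> the
  identity \<open>eigfun_sol\<close>.\<close>

lemma eigfun_energy:
  assumes "sl_eigfun u \<mu> \<phi>" "continuous_on {0..pi} h'" "h 0 = 0" "h pi = 0"
    and h: "\<And>x. x \<in> {0..pi} \<Longrightarrow> (h has_real_derivative h' x) (at x within {0..pi})"
    and d: "\<And>x. x \<in> {0..pi} \<Longrightarrow> (\<phi> has_real_derivative \<phi>' x) (at x within {0..pi})"
      "\<And>x. x \<in> {0..pi} \<Longrightarrow> ((\<lambda>s. u s * \<phi>' s) has_real_derivative (- \<mu> * u x * \<phi> x)) (at x within {0..pi})"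
  shows "\<mu> * ip u \<phi> h = integral {0..pi} (\<lambda>x. h' x * (u x * \<phi>' x))"
proof -
  have "integral {0..pi} (\<lambda>x. h x * (- \<mu> * u x * \<phi> x)) = h pi * (u pi * \<phi>' pi) - h 0 * (u 0 * \<phi>' 0)
     - integral {0..pi} (\<lambda>x. h' x * (u x * \<phi>' x))"
    by (rule integral_by_parts_C1[OF _ h d(2) assms(2)])
       (auto intro!: continuous_intros cont_u eigfun_continuous[OF assms(1)])
  moreover have "integral {0..pi} (\<lambda>x. h x * (- \<mu> * u x * \<phi> x)) = integral {0..pi} (\<lambda>x. - \<mu> * (u x * \<phi> x * h x))"
    by (rule integral_cong) simp
  ultimately show ?thesis using assms by (simp add: ip_def)
qed

lemma eigval_pos: assumes "sl_eigfun u \<mu> \<phi>" shows "\<mu> > 0"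
proof -
  obtain \<phi>' where d: "\<And>x. x \<in> {0..pi} \<Longrightarrow> (\<phi> has_real_derivative \<phi>' x) (at x within {0..pi})"
    "\<And>x. x \<in> {0..pi} \<Longrightarrow> ((\<lambda>s. u s * \<phi>' s) has_real_derivative (- \<mu> * u x * \<phi> x)) (at x within {0..pi})"
    "continuous_on {0..pi} \<phi>" "continuous_on {0..pi} \<phi>'" "\<phi> 0 = 0" "\<phi> pi = 0"
    using eigfunE[OF assms] by blast
  have e: "\<mu> * ip u \<phi> \<phi> = ip u \<phi>' \<phi>'"
    using eigfun_energy[OF assms d(4,5,6,1,1,2)] by (simp add: ip_def mult_ac)
  have "ip u \<phi>' \<phi>' \<noteq> 0"
  proof
    assume "ip u \<phi>' \<phi>' = 0"
    then have z: "\<phi>' x = 0" if "x \<in> {0..pi}" for x using ip_eq_0[OF d(4)] that by blast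
    have "\<phi> x = 0" if "x \<in> {0..pi}" for x
    proof -
      have "\<exists>c. \<forall>x\<in>{0..pi}. \<phi> x = c"
        by (rule has_field_derivative_zero_constant) (use d(1) z in force)+
      then show ?thesis using that d(5) by force
    qed
    then show False using assms by (auto simp: sl_eigfun_def)
  qed
  then have "\<mu> * ip u \<phi> \<phi> > 0" using e ip_nonneg[OF d(4)] by simp
  then show ?thesis using eigfun_ip_pos[OF assms] by (simp add: zero_less_mult_iff)
qed

lemma eigfun_orthogonal:
  assumes "sl_eigfun u \<mu> \<phi>" "sl_eigfun u \<nu> \<psi>" "\<mu> \<noteq> \<nu>"
  shows "ip u \<phi> \<psi> = 0"
proof -
  obtain \<phi>' where d: "\<And>x. x \<in> {0..pi} \<Longrightarrow> (\<phi> has_real_derivative \<phi>' x) (at x within {0..pi})"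
    "\<And>x. x \<in> {0..pi} \<Longrightarrow> ((\<lambda>s. u s * \<phi>' s) has_real_derivative (- \<mu> * u x * \<phi> x)) (at x within {0..pi})"
    "continuous_on {0..pi} \<phi>" "continuous_on {0..pi} \<phi>'" "\<phi> 0 = 0" "\<phi> pi = 0"
    using eigfunE[OF assms(1)] by blast
  obtain \<psi>' where e: "\<And>x. x \<in> {0..pi} \<Longrightarrow> (\<psi> has_real_derivative \<psi>' x) (at x within {0..pi})"
    "\<And>x. x \<in> {0..pi} \<Longrightarrow> ((\<lambda>s. u s * \<psi>' s) has_real_derivative (- \<nu> * u x * \<psi> x)) (at x within {0..pi})"
    "continuous_on {0..pi} \<psi>" "continuous_on {0..pi} \<psi>'" "\<psi> 0 = 0" "\<psi> pi = 0"
    using eigfunE[OF assms(2)] by blast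
  have "\<mu> * ip u \<phi> \<psi> = integral {0..pi} (\<lambda>x. \<psi>' x * (u x * \<phi>' x))"
    by (rule eigfun_energy[OF assms(1) e(4,5,6,1) d(1,2)])
  moreover have "\<nu> * ip u \<psi> \<phi> = integral {0..pi} (\<lambda>x. \<phi>' x * (u x * \<psi>' x))"
    by (rule eigfun_energy[OF assms(2) d(4,5,6,1) e(1,2)])
  moreover have "(\<lambda>x. \<psi>' x * (u x * \<phi>' x)) = (\<lambda>x. \<phi>' x * (u x * \<psi>' x))" by (simp add: mult_ac)
  ultimately have "\<mu> * ip u \<phi> \<psi> = \<nu> * ip u \<phi> \<psi>" using ip_commute[of \<phi> \<psi>] by simp
  then show ?thesis using assms(3) by simp
qed

text \<open>Admits integrable \<open>g\<close>, as completeness is wanted for such functions. The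
  constant in the flux drops out because \<phi> vanishes at both ends, and the primitive of
  \<open>g\<close> is handled by \<open>integral_by_parts_L1\<close>.\<close>

lemma eigfun_sol:
  assumes e: "sl_eigfun u \<mu> \<phi>" and g: "set_integrable lborel {0..pi} g"
  shows "\<mu> * ip u (sol u g) \<phi> = integral {0..pi} (\<lambda>x. g x * \<phi> x)"
proof -
  note gi = set_borel_integral_eq_integral(1)[OF g]
  obtain \<phi>' where d: "\<And>x. x \<in> {0..pi} \<Longrightarrow> (\<phi> has_real_derivative \<phi>' x) (at x within {0..pi})"
    "\<And>x. x \<in> {0..pi} \<Longrightarrow> ((\<lambda>s. u s * \<phi>' s) has_real_derivative (- \<mu> * u x * \<phi> x)) (at x within {0..pi})"
    "continuous_on {0..pi} \<phi>" "continuous_on {0..pi} \<phi>'" "\<phi> 0 = 0" "\<phi> pi = 0"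
    using eigfunE[OF e] by blast
  define c where "c = integral {0..pi} (\<lambda>s. prim g s / u s) / integral {0..pi} (\<lambda>s. 1 / u s)"
  have fl: "flux u g x = c - prim g x" for x by (simp add: flux_def c_def)
  have "\<mu> * ip u \<phi> (sol u g) = integral {0..pi} (\<lambda>x. flux u g x / u x * (u x * \<phi>' x))"
    by (rule eigfun_energy[OF e continuous_on_flux_div[OF gi] sol_0 sol_pi[OF gi] sol_deriv[OF gi] d(1,2)])
  also have "\<dots> = integral {0..pi} (\<lambda>x. c * \<phi>' x - prim g x * \<phi>' x)"
    by (rule integral_cong) (use nz_u in \<open>auto simp: fl field_simps\<close>)
  also have "\<dots> = integral {0..pi} (\<lambda>x. c * \<phi>' x) - integral {0..pi} (\<lambda>x. prim g x * \<phi>' x)"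
    by (intro Henstock_Kurzweil_Integration.integral_diff integrable_continuous_real continuous_intros continuous_on_prim gi d)
  also have "integral {0..pi} (\<lambda>x. c * \<phi>' x) = c * integral {0..pi} \<phi>'" by simp
  also have "integral {0..pi} \<phi>' = \<phi> pi - \<phi> 0"
    by (intro integral_unique fundamental_theorem_of_calculus)
       (auto simp: has_real_derivative_iff_has_vector_derivative[symmetric] d(1))
  also have "integral {0..pi} (\<lambda>x. prim g x * \<phi>' x) = - integral {0..pi} (\<lambda>x. g x * \<phi> x)"
    using integral_by_parts_L1(1)[OF _ g d(1,4)] d(6) by (simp add: prim_def)
  finally show ?thesis using ip_commute[of \<phi> "sol u g"] d(5,6) by simp
qed

lemma eigfun_K:
  assumes e: "sl_eigfun u \<mu> \<phi>" and f: "continuous_on {0..pi} f"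
  shows "\<mu> * ip u (K f) \<phi> = ip u f \<phi>"
  using eigfun_sol[OF e, of "\<lambda>x. u x * f x"] f
  by (simp add: K_def borel_integrable_atLeastAtMost' continuous_on_mult cont_u ip_def)

text \<open>The equation itself supplies the regularity: a merely continuous \<open>p\<close> equals
  \<open>K p / s\<close>, which is differentiable with differentiable flux.\<close>

lemma K_eigen_imp:
  assumes p: "continuous_on {0..pi} p" and s: "s > 0"
    and eq: "\<And>x. x \<in> {0..pi} \<Longrightarrow> K p x = s * p x" and nz: "\<exists>x\<in>{0..pi}. p x \<noteq> 0"
  shows "sl_eigfun u (1 / s) p"
proof -
  define fl where "fl = flux u (\<lambda>x. u x * p x)"
  have c: "continuous_on {0..pi} (\<lambda>x. u x * p x)" by (intro continuous_intros cont_u p)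
  note ci = integrable_continuous_real[OF c]
  have p_eq: "p x = K p x / s" if "x \<in> {0..pi}" for x using eq[OF that] s by simp
  have "(p has_real_derivative fl x / (s * u x)) (at x within {0..pi}) \<and>
     ((\<lambda>y. u y * (fl y / (s * u y))) has_real_derivative - (1 / s) * u x * p x) (at x within {0..pi})"
    if x: "x \<in> {0..pi}" for x
  proof
    have "((\<lambda>x. K p x / s) has_real_derivative (fl x / u x) / s) (at x within {0..pi})"
      unfolding K_def fl_def by (intro DERIV_cdivide sol_deriv ci x)
    then have "(p has_real_derivative (fl x / u x) / s) (at x within {0..pi})"
      by (rule has_field_derivative_transform_within[OF _ zero_less_one x]) (simp add: p_eq)
    then show "(p has_real_derivative fl x / (s * u x)) (at x within {0..pi})" by (simp add: mult.commute)
    have "((\<lambda>y. fl y / s) has_real_derivative (- (u x * p x)) / s) (at x within {0..pi})"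
      unfolding fl_def by (intro DERIV_cdivide flux_deriv c x)
    then have "((\<lambda>y. u y * (fl y / (s * u y))) has_real_derivative (- (u x * p x)) / s) (at x within {0..pi})"
      by (rule has_field_derivative_transform_within[OF _ zero_less_one x]) (use nz_u s in \<open>simp add: field_simps\<close>)
    then show "((\<lambda>y. u y * (fl y / (s * u y))) has_real_derivative - (1 / s) * u x * p x) (at x within {0..pi})"
      by simp
  qed
  moreover have "p 0 = 0" "p pi = 0" using p_eq[of 0] p_eq[of pi] sol_pi[OF ci] by (auto simp: K_def sol_0)
  ultimately show ?thesis unfolding sl_eigfun_def using nz
    by (intro conjI exI[of _ "\<lambda>x. fl x / (s * u x)"] ballI) auto
qed

section \<open>Compactness of the solution operator\<close>

lemma K_lipschitz:
  obtains L where "L \<ge> 0"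
    "\<And>f x y. continuous_on {0..pi} f \<Longrightarrow> ip u f f \<le> 1 \<Longrightarrow> x \<in> {0..pi} \<Longrightarrow> y \<in> {0..pi} \<Longrightarrow>
       \<bar>K f x - K f y\<bar> \<le> L * \<bar>x - y\<bar>"
proof -
  obtain m where m: "m > 0" "\<And>x. x \<in> {0..pi} \<Longrightarrow> m \<le> u x" using u_lower_bound by blast
  \<comment> \<open>Bounds the integral of u |f|, by 2 |f| \<le> 1 + f^2 and
    \<open>ip u f f \<le> 1\<close>. Both terms of the flux are then at most \<open>B\<close> in
    absolute value, whence the Lipschitz constant 2 B / m.\<close>
  define B where "B = (integral {0..pi} u + 1) / 2"
  have "integral {0..pi} u \<ge> 0"
    by (intro integral_nonneg integrable_continuous_real cont_u) (use pos_u in \<open>force intro: less_imp_le\<close>)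
  then have B0: "B \<ge> 0" by (simp add: B_def)
  have "\<bar>K f x - K f y\<bar> \<le> 2 * B / m * \<bar>x - y\<bar>"
    if f: "continuous_on {0..pi} f" and n: "ip u f f \<le> 1" and xy: "x \<in> {0..pi}" "y \<in> {0..pi}" for f x y
  proof -
    define g where "g = (\<lambda>x. u x * f x)"
    have g: "continuous_on {0..pi} g" unfolding g_def by (intro continuous_intros cont_u f)
    note gi = integrable_continuous_real[OF g]
    define w where "w = (\<lambda>x. (u x + u x * f x * f x) / 2)"
    have cw: "continuous_on {0..pi} w" unfolding w_def by (intro continuous_intros cont_u f) simp
    have gw: "\<bar>g x\<bar> \<le> w x" if "x \<in> {0..pi}" for x
    proof -
      have "2 * \<bar>f x\<bar> \<le> 1 + f x * f x"
        using zero_le_power2[of "\<bar>f x\<bar> - 1"] by (simp add: power2_eq_square algebra_simps)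
      then have "u x * (2 * \<bar>f x\<bar>) \<le> u x * (1 + f x * f x)"
        using pos_u[OF that] by (intro mult_left_mono) auto
      then show ?thesis using pos_u[OF that] by (simp add: g_def w_def abs_mult algebra_simps)
    qed
    have pw: "\<bar>prim g x\<bar> \<le> B" if x: "x \<in> {0..pi}" for x
    proof -
      have "norm (prim g x) \<le> integral {0..x} w"
        unfolding prim_def using gw x
        by (intro Henstock_Kurzweil_Integration.integral_norm_bound_integral integrable_continuous_real continuous_on_subset[OF g]
            continuous_on_subset[OF cw]) auto
      also have "\<dots> \<le> integral {0..pi} w"
      proof (rule integral_subset_le)
        show "\<forall>x\<in>{0..pi}. 0 \<le> w x" using gw by fastforce
      qed (use x in \<open>auto intro!: integrable_continuous_real continuous_on_subset[OF cw]\<close>)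
      also have "integral {0..pi} w = (integral {0..pi} u + ip u f f) / 2"
        unfolding w_def ip_def
        by (subst integral_divide, subst Henstock_Kurzweil_Integration.integral_add)
           (auto intro!: integrable_continuous_real continuous_intros cont_u f)
      also have "\<dots> \<le> B" using n by (simp add: B_def)
      finally show ?thesis by simp
    qed
    have "norm (integral {0..pi} (\<lambda>s. prim g s / u s)) \<le> integral {0..pi} (\<lambda>s. B * (1 / u s))"
    proof (intro Henstock_Kurzweil_Integration.integral_norm_bound_integral integrable_continuous_real)
      show "continuous_on {0..pi} (\<lambda>s. prim g s / u s)" "continuous_on {0..pi} (\<lambda>s. B * (1 / u s))"
        using nz_u by (auto intro!: continuous_intros cont_u continuous_on_prim gi)
      show "norm (prim g x / u x) \<le> B * (1 / u x)" if "x \<in> {0..pi}" for x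
        using pw[OF that] pos_u[OF that] by (simp add: divide_right_mono)
    qed
    also have "\<dots> = B * integral {0..pi} (\<lambda>s. 1 / u s)" by (rule integral_mult_right)
    finally have "\<bar>integral {0..pi} (\<lambda>s. prim g s / u s) / integral {0..pi} (\<lambda>s. 1 / u s)\<bar> \<le> B"
      using integral_inverse_u_pos by (simp add: abs_of_pos divide_le_eq)
    then have fl: "\<bar>flux u g x\<bar> \<le> 2 * B" if "x \<in> {0..pi}" for x
      using pw[OF that] unfolding flux_def by linarith
    have "norm (sol u g x - sol u g y) \<le> 2 * B / m * norm (x - y)"
    proof (rule field_differentiable_bound)
      show "norm (flux u g z / u z) \<le> 2 * B / m" if "z \<in> {0..pi}" for z
        using fl[OF that] m(1) m(2)[OF that] B0 by (auto simp: abs_of_pos intro!: frac_le)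
    qed (use sol_deriv[OF gi] xy in auto)
    then show ?thesis by (simp add: K_def g_def)
  qed
  then show ?thesis using that[of "2 * B / m"] B0 m by simp
qed

text \<open>The common Lipschitz constant gives equicontinuity and, as every image under
  \<open>K\<close> vanishes at 0, the uniform bound for Arzela-Ascoli.\<close>

lemma K_compact:
  assumes f: "\<And>n. continuous_on {0..pi} (f n)" and n: "\<And>n. ip u (f n) (f n) \<le> 1"
  obtains g k where "continuous_on {0..pi} g" "strict_mono (k :: nat \<Rightarrow> nat)"
    "\<And>e. 0 < e \<Longrightarrow> \<exists>N. \<forall>n x. n \<ge> N \<and> x \<in> {0..pi} \<longrightarrow> \<bar>K (f (k n)) x - g x\<bar> < e"
proof -
  obtain L where L: "L \<ge> 0"
    "\<And>f x y. continuous_on {0..pi} f \<Longrightarrow> ip u f f \<le> 1 \<Longrightarrow> x \<in> {0..pi} \<Longrightarrow> y \<in> {0..pi} \<Longrightarrow>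
       \<bar>K f x - K f y\<bar> \<le> L * \<bar>x - y\<bar>"
    using K_lipschitz by blast
  note Lf = L(2)[OF f n]
  have b: "norm (K (f n) x) \<le> L * pi" if "x \<in> {0..pi}" for n x
  proof -
    have "\<bar>K (f n) x - K (f n) 0\<bar> \<le> L * \<bar>x - 0\<bar>" using that by (intro Lf) auto
    also have "\<dots> \<le> L * pi" using that L(1) by (intro mult_left_mono) auto
    finally show ?thesis by (simp add: K_def sol_0)
  qed
  have eq: "\<exists>d. 0 < d \<and> (\<forall>n y. y \<in> {0..pi} \<and> norm (x - y) < d \<longrightarrow> norm (K (f n) x - K (f n) y) < e)"
    if "x \<in> {0..pi}" "0 < e" for x e
  proof (intro exI[of _ "e / (L + 1)"] conjI allI impI)
    show "0 < e / (L + 1)" using that L(1) by simp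
    fix n y assume y: "y \<in> {0..pi} \<and> norm (x - y) < e / (L + 1)"
    have "\<bar>K (f n) x - K (f n) y\<bar> \<le> L * \<bar>x - y\<bar>" using that y by (intro Lf) auto
    also have "\<dots> \<le> (L + 1) * \<bar>x - y\<bar>" by (simp add: mult_right_mono)
    also have "\<dots> < e" using y L(1) by (simp add: pos_less_divide_eq mult.commute)
    finally show "norm (K (f n) x - K (f n) y) < e" by simp
  qed
  obtain g k where "continuous_on {0..pi} g" "strict_mono (k :: nat \<Rightarrow> nat)"
    "\<And>e. 0 < e \<Longrightarrow> \<exists>N. \<forall>n x. n \<ge> N \<and> x \<in> {0..pi} \<longrightarrow> norm (K (f (k n)) x - g x) < e"
    using Arzela_Ascoli[of "{0..pi}" "\<lambda>n. K (f n)", OF compact_Icc b eq] by blast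
  then show ?thesis using that[of g k] by auto
qed

lemma abs_ip_le:
  assumes f: "continuous_on {0..pi} f" and g: "continuous_on {0..pi} g"
    and e: "\<And>x. x \<in> {0..pi} \<Longrightarrow> \<bar>f x\<bar> \<le> e"
  shows "\<bar>ip u f g\<bar> \<le> e * integral {0..pi} (\<lambda>x. u x * \<bar>g x\<bar>)"
proof -
  have "norm (ip u f g) \<le> integral {0..pi} (\<lambda>x. e * (u x * \<bar>g x\<bar>))"
    unfolding ip_def
  proof (intro Henstock_Kurzweil_Integration.integral_norm_bound_integral integrable_continuous_real continuous_intros cont_u f g)
    fix x assume x: "x \<in> {0..pi}"
    have "\<bar>f x\<bar> * (u x * \<bar>g x\<bar>) \<le> e * (u x * \<bar>g x\<bar>)"
      using pos_u[OF x] by (intro mult_right_mono e x) auto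
    then show "norm (u x * f x * g x) \<le> e * (u x * \<bar>g x\<bar>)"
      using pos_u[OF x] by (simp add: abs_mult mult_ac)
  qed
  then show ?thesis by simp
qed

section \<open>The orthogonal complement of the eigenfunctions is trivial\<close>

definition perp :: "(real \<Rightarrow> real) \<Rightarrow> bool" where
  "perp f \<longleftrightarrow> continuous_on {0..pi} f \<and> (\<forall>\<mu> \<phi>. sl_eigfun u \<mu> \<phi> \<longrightarrow> ip u f \<phi> = 0)"

lemma perp_continuous: "perp f \<Longrightarrow> continuous_on {0..pi} f" by (simp add: perp_def)

lemma perp_K: assumes "perp f" shows "perp (K f)"
  unfolding perp_def
proof (intro conjI allI impI)
  fix \<mu> \<phi> assume e: "sl_eigfun u \<mu> \<phi>"
  have "\<mu> * ip u (K f) \<phi> = 0" using eigfun_K[OF e] assms e by (auto simp: perp_def)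
  then show "ip u (K f) \<phi> = 0" using eigval_pos[OF e] by simp
qed (use assms in \<open>auto simp: perp_def intro: continuous_on_K\<close>)

lemma perp_linear: assumes "perp f" "perp g" shows "perp (\<lambda>x. a * f x + b * g x)"
  unfolding perp_def
proof (intro conjI allI impI)
  fix \<mu> \<phi> assume e: "sl_eigfun u \<mu> \<phi>"
  show "ip u (\<lambda>x. a * f x + b * g x) \<phi> = 0"
    using ip_linear[OF _ _ eigfun_continuous[OF e], of f g a b] assms e by (simp add: perp_def)
qed (use assms in \<open>auto simp: perp_def intro!: continuous_intros\<close>)

lemma perp_limit:
  fixes f :: "nat \<Rightarrow> real \<Rightarrow> real"
  assumes f: "\<And>n. perp (f n)" and g: "continuous_on {0..pi} g"
    and lim: "\<And>e. 0 < e \<Longrightarrow> \<exists>N. \<forall>n x. n \<ge> N \<and> x \<in> {0..pi} \<longrightarrow> \<bar>f n x - g x\<bar> < e"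
  shows "perp g"
  unfolding perp_def
proof (intro conjI allI impI g)
  fix \<mu> \<phi> assume e: "sl_eigfun u \<mu> \<phi>"
  note c = eigfun_continuous[OF e]
  define C where "C = integral {0..pi} (\<lambda>x. u x * \<bar>\<phi> x\<bar>)"
  have "C \<ge> 0" unfolding C_def
  proof (intro integral_nonneg integrable_continuous_real continuous_intros cont_u c)
    show "0 \<le> u x * \<bar>\<phi> x\<bar>" if "x \<in> {0..pi}" for x using pos_u[OF that] by simp
  qed
  have "\<bar>ip u g \<phi>\<bar> \<le> 0 + \<epsilon>" if "\<epsilon> > 0" for \<epsilon>
  proof -
    have "\<epsilon> / (C + 1) > 0" using that \<open>C \<ge> 0\<close> by simp
    then obtain N where M: "\<forall>n x. n \<ge> N \<and> x \<in> {0..pi} \<longrightarrow> \<bar>f n x - g x\<bar> < \<epsilon> / (C + 1)" using lim by metis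
    have N: "\<bar>1 * f N x + (-1) * g x\<bar> \<le> \<epsilon> / (C + 1)" if "x \<in> {0..pi}" for x
    proof -
      have "\<bar>f N x - g x\<bar> < \<epsilon> / (C + 1)" using M that by (metis order_refl)
      then show ?thesis by simp
    qed
    note cf = perp_continuous[OF f]
    have "\<bar>ip u (\<lambda>x. 1 * f N x + (-1) * g x) \<phi>\<bar> \<le> \<epsilon> / (C + 1) * C"
      unfolding C_def by (rule abs_ip_le[OF _ c N[unfolded C_def]]) (intro continuous_intros cf g)
    also have "\<dots> \<le> \<epsilon>" using that \<open>C \<ge> 0\<close> by (simp add: field_simps)
    also have "ip u (\<lambda>x. 1 * f N x + (-1) * g x) \<phi> = - ip u g \<phi>"
      using ip_linear[OF cf[of N] g c, of 1 "-1"] f[of N] e by (simp add: perp_def)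
    finally show ?thesis by simp
  qed
  then have "\<bar>ip u g \<phi>\<bar> \<le> 0" by (rule field_le_epsilon)
  then show "ip u g \<phi> = 0" by simp
qed

text \<open>If \<open>perp\<close> had a nonzero element, \<open>K\<close> restricted to \<open>perp\<close> would attain its norm, which
  produces an eigenfunction that is orthogonal to itself.\<close>
lemma perp_eq_0:
  assumes "perp f0" "x0 \<in> {0..pi}" shows "f0 x0 = 0"
proof (rule ccontr)
  assume nz: "f0 x0 \<noteq> 0"
  define N where "N = (\<lambda>f. ip u f f)"
  define B where "B = {N (K f) |f. perp f \<and> N f \<le> 1}"
  obtain L where L: "L \<ge> 0"
    "\<And>f x y. continuous_on {0..pi} f \<Longrightarrow> ip u f f \<le> 1 \<Longrightarrow> x \<in> {0..pi} \<Longrightarrow> y \<in> {0..pi} \<Longrightarrow>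
       \<bar>K f x - K f y\<bar> \<le> L * \<bar>x - y\<bar>"
    using K_lipschitz by blast
  have Nn: "perp f \<Longrightarrow> N f \<ge> 0" for f using ip_nonneg perp_continuous by (simp add: N_def)
  have N0: "perp f \<Longrightarrow> N f = 0 \<Longrightarrow> x \<in> {0..pi} \<Longrightarrow> f x = 0" for f x
    using ip_eq_0 perp_continuous by (simp add: N_def)
  have Nsc: "N (\<lambda>x. a * f x) = a\<^sup>2 * N f" if "perp f" for a f
    using ip_combine[OF perp_continuous[OF that] perp_continuous[OF that], of a 0] by (simp add: N_def)
  have Ksc: "N (K (\<lambda>x. a * f x)) = a\<^sup>2 * N (K f)" if "perp f" for a f
  proof -
    have "K (\<lambda>x. a * f x) x = a * K f x" if "x \<in> {0..pi}" for x
      using K_linear[of f f x a 0] perp_continuous[OF \<open>perp f\<close>] that by simp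
    then have "N (K (\<lambda>x. a * f x)) = N (\<lambda>x. a * K f x)" unfolding N_def by (intro ip_cong) auto
    then show ?thesis using Nsc[OF perp_K[OF that]] by simp
  qed
  have psc: "perp (\<lambda>x. a * f x)" if "perp f" for a f using perp_linear[OF that that, of a 0] by simp
  have bdd: "bdd_above B"
  proof (rule bdd_aboveI)
    fix b assume "b \<in> B"
    then obtain f where f: "perp f" "N f \<le> 1" "b = N (K f)" by (auto simp: B_def)
    note c = perp_continuous[OF f(1)]
    have Kb: "\<bar>K f x\<bar> \<le> L * pi" if "x \<in> {0..pi}" for x
    proof -
      have "\<bar>K f x - K f 0\<bar> \<le> L * \<bar>x - 0\<bar>"
        using L(2)[OF c, of x 0] f(2) that by (auto simp: N_def)
      also have "\<dots> \<le> L * pi" using that L(1) by (intro mult_left_mono) auto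
      finally show ?thesis by (simp add: K_def sol_0)
    qed
    have "\<bar>ip u (K f) (K f)\<bar> \<le> L * pi * integral {0..pi} (\<lambda>x. u x * \<bar>K f x\<bar>)"
      by (intro abs_ip_le continuous_on_K c Kb)
    also have "\<dots> \<le> L * pi * integral {0..pi} (\<lambda>x. u x * (L * pi))"
    proof (intro mult_left_mono integral_le integrable_continuous_real continuous_intros cont_u continuous_on_K c)
      show "\<bar>K f x\<bar> \<le> L * pi" "0 \<le> u x" if "x \<in> {0..pi}" for x
        using Kb[OF that] pos_u[OF that] by simp_all
    qed (use L(1) in simp)
    finally show "b \<le> L * pi * integral {0..pi} (\<lambda>x. u x * (L * pi))" by (simp add: f(3) N_def)
  qed
  \<comment> \<open>\<open>A\<close> is the square of the norm of \<open>K\<close> on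
    \<open>perp\<close>.\<close>
  define A where "A = Sup B"
  have KA: "N (K f) \<le> A * N f" if f: "perp f" for f
  proof (cases "N f = 0")
    case True
    then have "K f x = 0 * K f x" if "x \<in> {0..pi}" for x
      using K_cong[of f "\<lambda>x. 0 * f x" x] K_linear[of f f x 0 0] perp_continuous[OF f] that N0[OF f True] by simp
    then have "N (K f) = N (\<lambda>x. 0 * K f x)" unfolding N_def by (intro ip_cong) auto
    then show ?thesis using True Nsc[OF perp_K[OF f], of 0] by simp
  next
    case False
    then have p: "N f > 0" using Nn[OF f] by simp
    define a where "a = 1 / sqrt (N f)"
    have a2: "a\<^sup>2 = 1 / N f" using p by (simp add: a_def power_divide)
    have "N (K (\<lambda>x. a * f x)) \<in> B" unfolding B_def using Nsc[OF f, of a] a2 p psc[OF f] by auto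
    then have "N (K (\<lambda>x. a * f x)) \<le> A" unfolding A_def using bdd by (rule cSup_upper)
    then show ?thesis using Ksc[OF f, of a] a2 p by (simp add: field_simps)
  qed
  \<comment> \<open>Injectivity of \<open>K\<close> is what makes the supremum \<open>A\<close>
    positive.\<close>
  have Kf0: "N (K f0) > 0"
  proof -
    have "N (K f0) \<noteq> 0"
      using N0[OF perp_K[OF assms(1)]] K_injective[OF perp_continuous[OF assms(1)] _ assms(2)] nz by blast
    then show ?thesis using Nn[OF perp_K[OF assms(1)]] by simp
  qed
  have A0: "A > 0"
  proof (rule ccontr)
    assume "\<not> A > 0"
    then have "A * N f0 \<le> 0" using Nn[OF assms(1)] by (simp add: mult_nonpos_nonneg)
    then show False using KA[OF assms(1)] Kf0 by linarith
  qed
  have B_ne: "B \<noteq> {}"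
  proof -
    have "N (K (\<lambda>x. 0 * f0 x)) \<in> B" unfolding B_def using Nsc[OF assms(1), of 0] psc[OF assms(1), of 0] by auto
    then show ?thesis by auto
  qed
  have "\<exists>f. perp f \<and> N f \<le> 1 \<and> A - 1 / real (Suc n) < N (K f)" for n
  proof -
    have "A - 1 / real (Suc n) < Sup B" by (simp add: A_def)
    then obtain b where "b \<in> B" "A - 1 / real (Suc n) < b" using less_cSup_iff[OF B_ne bdd] by blast
    then show ?thesis unfolding B_def by blast
  qed
  then obtain F where F: "\<And>n. perp (F n)" "\<And>n. N (F n) \<le> 1" "\<And>n. A - 1 / real (Suc n) < N (K (F n))"
    by metis
  note cF = perp_continuous[OF F(1)]
  obtain g k where g: "continuous_on {0..pi} g" and k: "strict_mono (k :: nat \<Rightarrow> nat)"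
    and lim: "\<And>e. 0 < e \<Longrightarrow> \<exists>M. \<forall>n x. n \<ge> M \<and> x \<in> {0..pi} \<longrightarrow> \<bar>K (F (k n)) x - g x\<bar> < e"
    using K_compact[of F, OF cF F(2)[unfolded N_def]] by metis
  have pg: "perp g" by (rule perp_limit[OF perp_K[OF F(1)] g lim])
  define D where "D = (\<lambda>n x. 1 * K (F (k n)) x + (-1) * g x)"
  have pD: "perp (D n)" for n unfolding D_def by (intro perp_linear perp_K F pg)
  have ND: "\<exists>M. \<forall>n\<ge>M. N (D n) < e" if "e > 0" for e
  proof -
    define U where "U = integral {0..pi} u"
    have "U \<ge> 0" unfolding U_def
      by (intro integral_nonneg integrable_continuous_real cont_u) (use pos_u in \<open>force intro: less_imp_le\<close>)
    \<comment> \<open>The cap 1 lets a uniform bound d on \<open>D n\<close> bound its square as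
      well.\<close>
    define d where "d = min 1 (e / (U + 1))"
    have d: "d > 0" "d \<le> 1" "d \<le> e / (U + 1)" using that \<open>U \<ge> 0\<close> by (auto simp: d_def)
    obtain M where M: "\<forall>n x. n \<ge> M \<and> x \<in> {0..pi} \<longrightarrow> \<bar>K (F (k n)) x - g x\<bar> < d" using lim[OF d(1)] by blast
    have "N (D n) < e" if "n \<ge> M" for n
    proof -
      have Dd: "\<bar>D n x\<bar> \<le> d" if "x \<in> {0..pi}" for x using M \<open>n \<ge> M\<close> that by (force simp: D_def)
      note cD = perp_continuous[OF pD, of n]
      have "\<bar>ip u (D n) (D n)\<bar> \<le> d * integral {0..pi} (\<lambda>x. u x * \<bar>D n x\<bar>)"
        by (rule abs_ip_le[OF cD cD Dd])
      also have "\<dots> \<le> d * integral {0..pi} u"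
      proof (intro mult_left_mono integral_le integrable_continuous_real continuous_intros cont_u cD)
        fix x assume x: "x \<in> {0..pi}"
        have "\<bar>D n x\<bar> \<le> 1" using Dd[OF x] d(2) by linarith
        then show "u x * \<bar>D n x\<bar> \<le> u x" using pos_u[OF x] by (simp add: mult_left_le)
      qed (use d in simp)
      also have "\<dots> \<le> e / (U + 1) * U" using d \<open>U \<ge> 0\<close> unfolding U_def by (intro mult_right_mono) auto
      also have "\<dots> < e" using that \<open>U \<ge> 0\<close> \<open>e > 0\<close> by (simp add: field_simps)
      finally show ?thesis by (simp add: N_def)
    qed
    then show ?thesis by blast
  qed
  \<comment> \<open>The defect of the equation K (K f) = A f. Expanding its square and bounding
    \<open>N (K (K f))\<close> by \<open>A * N (K f)\<close> shows that it tends to zero along a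
    maximizing sequence.\<close>
  define H where "H = (\<lambda>f x. 1 * K (K f) x + (- A) * f x)"
  have pH: "perp (H f)" if "perp f" for f unfolding H_def by (intro perp_linear perp_K that)
  have NH: "N (H f) \<le> A\<^sup>2 * N f - A * N (K f)" if f: "perp f" for f
  proof -
    have "N (H f) = N (K (K f)) + 2 * (- A) * ip u (K (K f)) f + A\<^sup>2 * N f"
      using ip_combine[of "K (K f)" f 1 "- A"] perp_continuous[OF f] by (simp add: N_def H_def continuous_on_K)
    also have "ip u (K (K f)) f = N (K f)"
      using K_symmetric[of "K f" f] perp_continuous[OF f] by (simp add: N_def continuous_on_K)
    finally show ?thesis using KA[OF perp_K[OF f]] by simp
  qed
  have sq2: "N (\<lambda>x. 1 * a x + b * c x) \<le> 2 * N a + 2 * b\<^sup>2 * N c" if "perp a" "perp c" for a c b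
  proof -
    have "N (\<lambda>x. 1 * a x + b * c x) + N (\<lambda>x. 1 * a x + (- b) * c x) = 2 * N a + 2 * b\<^sup>2 * N c"
      using that[THEN perp_continuous] ip_combine[of a c 1 b] ip_combine[of a c 1 "- b"] by (simp add: N_def)
    then show ?thesis using Nn[OF perp_linear[OF that, of 1 "- b"]] by linarith
  qed
  have HK: "H (K f) x = K (H f) x" if f: "perp f" and x: "x \<in> {0..pi}" for f x
    using K_linear[of "K (K f)" f x 1 "- A"] perp_continuous[OF f] x by (simp add: H_def continuous_on_K)
  \<comment> \<open>Only the images \<open>K (F (k n))\<close> are known to converge, so
    \<open>H g\<close> is compared with \<open>H (K f)\<close>; this equals \<open>K (H f)\<close>
    and is small because \<open>H f\<close> is.\<close>
  have NHg: "N (H g) \<le> 2 * A * A / real (Suc n) + 2 * (A\<^sup>2 * N (D n))" for n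
  proof -
    define f where "f = F (k n)"
    have pf: "perp f" by (simp add: f_def F)
    have "H g x = 1 * H (K f) x + (-1) * H (D n) x" if x: "x \<in> {0..pi}" for x
    proof -
      have "K (D n) y = 1 * K (K f) y + (-1) * K g y" if "y \<in> {0..pi}" for y
        unfolding D_def f_def[symmetric] using perp_continuous[OF pf] that g
        by (intro K_linear) (auto intro: continuous_on_K)
      then have "K (K (D n)) x = K (\<lambda>y. 1 * K (K f) y + (-1) * K g y) x" by (rule K_cong[OF _ x])
      also have "\<dots> = 1 * K (K (K f)) x + (-1) * K (K g) x"
        using perp_continuous[OF pf] x g by (intro K_linear) (auto intro: continuous_on_K)
      finally show ?thesis by (simp add: H_def D_def f_def algebra_simps)
    qed
    then have "N (H g) = N (\<lambda>x. 1 * H (K f) x + (-1) * H (D n) x)" unfolding N_def by (intro ip_cong) auto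
    also have "\<dots> \<le> 2 * N (H (K f)) + 2 * (-1)\<^sup>2 * N (H (D n))"
      by (intro sq2 pH perp_K pf pD)
    also have "N (H (K f)) = N (K (H f))" unfolding N_def using HK[OF pf] by (intro ip_cong) auto
    also have "\<dots> \<le> A * N (H f)" by (rule KA[OF pH[OF pf]])
    also have "\<dots> \<le> A * (A / real (Suc n))"
    proof (rule mult_left_mono)
      have "n \<le> k n" by (rule strict_mono_imp_increasing[OF k])
      then have "1 / real (Suc (k n)) \<le> 1 / real (Suc n)" by (intro divide_left_mono) auto
      then have 1: "A - 1 / real (Suc n) \<le> N (K f)" using F(3)[of "k n"] by (simp add: f_def)
      have "N (H f) \<le> A\<^sup>2 * N f - A * N (K f)" by (rule NH[OF pf])
      also have "\<dots> \<le> A\<^sup>2 * 1 - A * (A - 1 / real (Suc n))"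
        using F(2)[of "k n"] 1 A0 by (intro diff_mono mult_left_mono) (auto simp: f_def)
      finally show "N (H f) \<le> A / real (Suc n)" by (simp add: power2_eq_square algebra_simps)
    qed (use A0 in simp)
    also have "N (H (D n)) \<le> A\<^sup>2 * N (D n)"
    proof -
      have "A * N (K (D n)) \<ge> 0" using A0 Nn[OF perp_K[OF pD, of n]] by simp
      then show ?thesis using NH[OF pD, of n] by linarith
    qed
    finally show ?thesis by (simp add: mult_ac)
  qed
  have "N (H g) \<le> 0 + e" if "e > 0" for e
  proof -
    have "0 < e / (4 * A\<^sup>2)" using that A0 by simp
    then obtain M where M: "\<forall>n\<ge>M. N (D n) < e / (4 * A\<^sup>2)" using ND by blast
    obtain n1 :: nat where n1: "4 * A * A / e < real n1" using reals_Archimedean2 by blast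
    define n where "n = max M n1"
    have "2 * A * A / real (Suc n) \<le> e / 2"
    proof -
      have "4 * A * A / e \<le> real (Suc n)" using n1 by (simp add: n_def max_def)
      then show ?thesis using that by (simp add: field_simps)
    qed
    moreover have "2 * (A\<^sup>2 * N (D n)) \<le> e / 2"
    proof -
      have "N (D n) < e / (4 * A\<^sup>2)" using M by (simp add: n_def)
      then show ?thesis using A0 by (simp add: field_simps)
    qed
    ultimately show ?thesis using NHg[of n] by linarith
  qed
  then have "N (H g) \<le> 0" by (rule field_le_epsilon)
  then have "N (H g) = 0" using Nn[OF pH[OF pg]] by simp
  then have KKg: "K (K g) x = A * g x" if "x \<in> {0..pi}" for x
    using N0[OF pH[OF pg] _ that] by (simp add: H_def)
  \<comment> \<open>The limit is nonzero because \<open>N (K (F (k n)))\<close> approaches the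
    positive supremum.\<close>
  have Ng: "N g > 0"
  proof -
    have "\<exists>n. N (D n) < A / 8 \<and> 1 / real (Suc n) < A / 2"
    proof -
      obtain M where M: "\<forall>n\<ge>M. N (D n) < A / 8" using ND[of "A / 8"] A0 by auto
      obtain n1 :: nat where n1: "2 / A < real n1" using reals_Archimedean2 by blast
      have "1 / real (Suc (max M n1)) < A / 2"
      proof -
        have "2 / A < real (Suc (max M n1))" using n1 by (simp add: max_def)
        then show ?thesis using A0 by (simp add: field_simps)
      qed
      then show ?thesis using M by (intro exI[of _ "max M n1"]) auto
    qed
    then obtain n where n: "N (D n) < A / 8" "1 / real (Suc n) < A / 2" by blast
    have "n \<le> k n" by (rule strict_mono_imp_increasing[OF k])
    then have "1 / real (Suc (k n)) \<le> 1 / real (Suc n)" by (intro divide_left_mono) auto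
    then have "A / 2 < N (K (F (k n)))" using F(3)[of "k n"] n(2) by linarith
    also have "N (K (F (k n))) = N (\<lambda>x. 1 * D n x + 1 * g x)" by (simp add: D_def)
    also have "\<dots> \<le> 2 * N (D n) + 2 * 1\<^sup>2 * N g" by (rule sq2[OF pD pg])
    finally show ?thesis using n(1) A0 by simp
  qed
  \<comment> \<open>Factorization of K^2 - A into (K - s) (K + s): the function \<open>p\<close>,
    which is (K + s) g, satisfies K p = s p and lies in \<open>perp\<close>, hence is zero. This
    leaves K g = - s g, against nonnegativity of \<open>K\<close>.\<close>
  define s where "s = sqrt A"
  have s: "s > 0" "s * s = A" using A0 by (auto simp: s_def)
  define p where "p = (\<lambda>x. 1 * K g x + s * g x)"
  have pp: "perp p" unfolding p_def by (intro perp_linear perp_K pg)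
  have Kp: "K p x = s * p x" if "x \<in> {0..pi}" for x
  proof -
    have "K p x = 1 * K (K g) x + s * K g x"
      unfolding p_def using g that by (intro K_linear) (auto intro: continuous_on_K)
    then show ?thesis using KKg[OF that] s(2) by (simp add: p_def algebra_simps)
  qed
  have p0: "p x = 0" if "x \<in> {0..pi}" for x
  proof (rule ccontr)
    assume "p x \<noteq> 0"
    then have "sl_eigfun u (1 / s) p"
      using K_eigen_imp[OF perp_continuous[OF pp] s(1) Kp] that by blast
    then have "ip u p p = 0" using pp by (auto simp: perp_def)
    then show False using N0[OF pp _ that] \<open>p x \<noteq> 0\<close> by (simp add: N_def)
  qed
  have "ip u (K g) g = ip u (\<lambda>x. (- s) * g x) g"
    by (rule ip_cong) (use p0 in \<open>force simp: p_def\<close>)+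
  also have "\<dots> = - s * N g" using ip_linear[OF g g g, of "- s" 0] by (simp add: N_def)
  finally have "ip u (K g) g < 0" using s(1) Ng by simp
  then show False using K_nonneg[OF g] by linarith
qed

section \<open>Simplicity and discreteness of the eigenvalues\<close>

text \<open>A Gronwall argument for the first-order system in \<open>w\<close> and v = u w': the
  energy w^2 + v^2 grows at most at the rate C = 1 / m + |\<mu>| M, so its product with exp (- C x)
  cannot rise above the initial value 0.\<close>

lemma sl_initial_value_unique:
  assumes d: "\<And>x. x \<in> {0..pi} \<Longrightarrow> (w has_real_derivative w' x) (at x within {0..pi})"
    and d2: "\<And>x. x \<in> {0..pi} \<Longrightarrow> ((\<lambda>s. u s * w' s) has_real_derivative (- \<mu> * u x * w x)) (at x within {0..pi})"
    and z: "w 0 = 0" "w' 0 = 0" and x: "x \<in> {0..pi}"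
  shows "w x = 0"
proof -
  obtain m where m: "m > 0" "\<And>x. x \<in> {0..pi} \<Longrightarrow> m \<le> u x" using u_lower_bound by blast
  obtain M where M: "M > 0" "\<And>x. x \<in> {0..pi} \<Longrightarrow> u x \<le> M" using u_upper_bound by blast
  define v where "v = (\<lambda>s. u s * w' s)"
  define C where "C = 1 / m + \<bar>\<mu>\<bar> * M"
  define F where "F = (\<lambda>x. exp (- C * x) * ((w x)\<^sup>2 + (v x)\<^sup>2))"
  have dF: "(F has_real_derivative exp (- C * y) * (2 * w y * w' y + 2 * v y * (- \<mu> * u y * w y)
      - C * ((w y)\<^sup>2 + (v y)\<^sup>2))) (at y within {0..pi})" if y: "y \<in> {0..pi}" for y
    unfolding F_def
    by (auto intro!: derivative_eq_intros d[OF y] d2[OF y, folded v_def] simp: algebra_simps)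
  have neg: "2 * w y * w' y + 2 * v y * (- \<mu> * u y * w y) - C * ((w y)\<^sup>2 + (v y)\<^sup>2) \<le> 0"
    if y: "y \<in> {0..pi}" for y
  proof -
    have am: "2 * \<bar>w y * v y\<bar> \<le> (w y)\<^sup>2 + (v y)\<^sup>2"
      using zero_le_power2[of "\<bar>w y\<bar> - \<bar>v y\<bar>"] by (simp add: power2_eq_square algebra_simps abs_mult)
    have "w' y = v y / u y" using nz_u[OF y] by (simp add: v_def)
    then have "2 * w y * w' y + 2 * v y * (- \<mu> * u y * w y) = (1 / u y - \<mu> * u y) * (2 * (w y * v y))"
      by (simp add: algebra_simps)
    also have "\<dots> \<le> \<bar>1 / u y - \<mu> * u y\<bar> * (2 * \<bar>w y * v y\<bar>)"
      using abs_ge_self[of "(1 / u y - \<mu> * u y) * (2 * (w y * v y))"] by (simp only: abs_mult abs_numeral)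
    also have "\<dots> \<le> C * (2 * \<bar>w y * v y\<bar>)"
    proof (rule mult_right_mono)
      have "\<bar>1 / u y - \<mu> * u y\<bar> \<le> \<bar>1 / u y\<bar> + \<bar>\<mu> * u y\<bar>" by (rule abs_triangle_ineq4)
      also have "\<dots> \<le> 1 / m + \<bar>\<mu>\<bar> * M"
      proof (rule add_mono)
        show "\<bar>1 / u y\<bar> \<le> 1 / m" using m(1) m(2)[OF y] by (simp add: frac_le)
        show "\<bar>\<mu> * u y\<bar> \<le> \<bar>\<mu>\<bar> * M"
          unfolding abs_mult using M(2)[OF y] pos_u[OF y] by (intro mult_left_mono) auto
      qed
      finally show "\<bar>1 / u y - \<mu> * u y\<bar> \<le> C" by (simp add: C_def)
    qed simp
    also have "\<dots> \<le> C * ((w y)\<^sup>2 + (v y)\<^sup>2)"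
      using am m(1) M(1) by (intro mult_left_mono) (auto simp: C_def)
    finally show ?thesis by simp
  qed
  have "F x \<le> F 0"
  proof (rule DERIV_nonpos_imp_decreasing_open[of 0 x F])
    show "0 \<le> x" using x by simp
    show "\<exists>D. (F has_real_derivative D) (at y) \<and> D \<le> 0" if "0 < y" "y < x" for y
    proof -
      have y: "y \<in> {0..pi}" "at y within {0..pi} = at y" using that x by (auto intro: at_within_Icc_at)
      show ?thesis
        using dF[OF y(1)] mult_nonneg_nonpos[OF exp_ge_zero[of "- C * y"] neg[OF y(1)]] unfolding y(2) by blast
    qed
    show "continuous_on {0..x} F"
      by (rule continuous_on_subset[OF DERIV_continuous_on[OF dF]]) (use x in auto)
  qed
  then have "F x \<le> 0" using z by (simp add: F_def v_def)
  then have "(w x)\<^sup>2 + (v x)\<^sup>2 \<le> 0" by (simp add: F_def mult_le_0_iff)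
  then show ?thesis by (simp add: sum_power2_le_zero_iff)
qed

text \<open>An eigenfunction has nonzero slope at 0, so subtracting a suitable multiple of it leaves
  a solution with zero initial data.\<close>

lemma eigfun_simple:
  assumes "sl_eigfun u \<mu> \<phi>" "sl_eigfun u \<mu> \<psi>"
  obtains k where "\<And>x. x \<in> {0..pi} \<Longrightarrow> \<psi> x = k * \<phi> x"
proof -
  obtain \<phi>' where d: "\<And>x. x \<in> {0..pi} \<Longrightarrow> (\<phi> has_real_derivative \<phi>' x) (at x within {0..pi})"
    "\<And>x. x \<in> {0..pi} \<Longrightarrow> ((\<lambda>s. u s * \<phi>' s) has_real_derivative (- \<mu> * u x * \<phi> x)) (at x within {0..pi})"
    "continuous_on {0..pi} \<phi>" "continuous_on {0..pi} \<phi>'" "\<phi> 0 = 0" "\<phi> pi = 0"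
    using eigfunE[OF assms(1)] by blast
  obtain \<psi>' where e: "\<And>x. x \<in> {0..pi} \<Longrightarrow> (\<psi> has_real_derivative \<psi>' x) (at x within {0..pi})"
    "\<And>x. x \<in> {0..pi} \<Longrightarrow> ((\<lambda>s. u s * \<psi>' s) has_real_derivative (- \<mu> * u x * \<psi> x)) (at x within {0..pi})"
    "continuous_on {0..pi} \<psi>" "continuous_on {0..pi} \<psi>'" "\<psi> 0 = 0" "\<psi> pi = 0"
    using eigfunE[OF assms(2)] by blast
  have nz: "\<phi>' 0 \<noteq> 0"
    using sl_initial_value_unique[OF d(1,2) d(5)] assms(1) by (auto simp: sl_eigfun_def)
  define k where "k = \<psi>' 0 / \<phi>' 0"
  have "\<psi> x - k * \<phi> x = 0" if x: "x \<in> {0..pi}" for x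
  proof (rule sl_initial_value_unique[where w = "\<lambda>x. \<psi> x - k * \<phi> x" and w' = "\<lambda>x. \<psi>' x - k * \<phi>' x" and \<mu> = \<mu>])
    fix y assume y: "y \<in> {0..pi}"
    show "((\<lambda>x. \<psi> x - k * \<phi> x) has_real_derivative \<psi>' y - k * \<phi>' y) (at y within {0..pi})"
      by (auto intro!: derivative_eq_intros d(1)[OF y] e(1)[OF y])
    have "((\<lambda>s. u s * \<psi>' s - k * (u s * \<phi>' s)) has_real_derivative
         - \<mu> * u y * \<psi> y - k * (- \<mu> * u y * \<phi> y)) (at y within {0..pi})"
      by (intro DERIV_diff DERIV_cmult d(2)[OF y] e(2)[OF y])
    then show "((\<lambda>s. u s * (\<psi>' s - k * \<phi>' s)) has_real_derivative
         - \<mu> * u y * (\<psi> y - k * \<phi> y)) (at y within {0..pi})"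
      by (simp add: algebra_simps)
  qed (use d(5) e(5) nz x in \<open>auto simp: k_def\<close>)
  then show ?thesis using that[of k] by simp
qed

lemma ip_sum:
  assumes "finite I" "\<And>i. i \<in> I \<Longrightarrow> continuous_on {0..pi} (F i)" "continuous_on {0..pi} h"
  shows "ip u (\<lambda>x. \<Sum>i\<in>I. c i * F i x) h = (\<Sum>i\<in>I. c i * ip u (F i) h)"
  using assms(1,2)
proof (induction I)
  case empty
  then show ?case by (simp add: ip_def)
next
  case (insert i I)
  then have "ip u (\<lambda>x. c i * F i x + 1 * (\<Sum>i\<in>I. c i * F i x)) h
      = c i * ip u (F i) h + 1 * ip u (\<lambda>x. \<Sum>i\<in>I. c i * F i x) h"
    by (intro ip_linear assms(3)) (auto intro!: continuous_intros)
  then show ?case using insert by simp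
qed

lemma eigfun_scale:
  assumes "sl_eigfun u \<mu> \<phi>" "a \<noteq> 0" shows "sl_eigfun u \<mu> (\<lambda>x. a * \<phi> x)"
proof -
  obtain \<phi>' where d: "\<forall>x\<in>{0..pi}. (\<phi> has_real_derivative \<phi>' x) (at x within {0..pi})
      \<and> ((\<lambda>s. u s * \<phi>' s) has_real_derivative (- \<mu> * u x * \<phi> x)) (at x within {0..pi})"
    using assms(1) unfolding sl_eigfun_def by blast
  have "((\<lambda>x. a * \<phi> x) has_real_derivative a * \<phi>' x) (at x within {0..pi}) \<and>
    ((\<lambda>s. u s * (a * \<phi>' s)) has_real_derivative - \<mu> * u x * (a * \<phi> x)) (at x within {0..pi})"
    if x: "x \<in> {0..pi}" for x
    using DERIV_cmult[OF conjunct1[OF bspec[OF d x]], of a] DERIV_cmult[OF conjunct2[OF bspec[OF d x]], of a]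
    by (simp add: mult_ac)
  then show ?thesis using assms unfolding sl_eigfun_def
    by (intro conjI exI[of _ "\<lambda>x. a * \<phi>' x"]) auto
qed

lemma normalized_eigfun_exists:
  assumes "\<mu> \<in> sl_eigs u"
  shows "\<exists>\<phi>. sl_eigfun u \<mu> \<phi> \<and> ip u \<phi> \<phi> = 1"
proof -
  obtain \<phi> where p: "sl_eigfun u \<mu> \<phi>" using assms by (auto simp: sl_eigs_def)
  note c = eigfun_continuous[OF p] and i = eigfun_ip_pos[OF p]
  define a where "a = 1 / sqrt (ip u \<phi> \<phi>)"
  have "ip u (\<lambda>x. a * \<phi> x) (\<lambda>x. a * \<phi> x) = a\<^sup>2 * ip u \<phi> \<phi>"
    using ip_combine[OF c c, of a 0] by simp
  also have "\<dots> = 1" using i by (simp add: a_def power_divide)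
  finally show ?thesis using eigfun_scale[OF p, of a] i by (auto simp: a_def)
qed

text \<open>Were there finitely many eigenvalues, each simple, the constant 1 minus its projection
  would lie in \<open>perp\<close> and vanish; but the projection is 0 at the point 0.\<close>

lemma sl_eigs_infinite: "infinite (sl_eigs u)"
proof
  assume fin: "finite (sl_eigs u)"
  obtain E where E: "\<And>\<mu>. \<mu> \<in> sl_eigs u \<Longrightarrow> sl_eigfun u \<mu> (E \<mu>) \<and> ip u (E \<mu>) (E \<mu>) = 1"
    using normalized_eigfun_exists by metis
  have cE: "\<mu> \<in> sl_eigs u \<Longrightarrow> continuous_on {0..pi} (E \<mu>)" for \<mu> using E eigfun_continuous by blast
  define S where "S = (\<lambda>x. \<Sum>\<mu>\<in>sl_eigs u. ip u (\<lambda>_. 1) (E \<mu>) * E \<mu> x)"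
  have cS: "continuous_on {0..pi} S" unfolding S_def by (intro continuous_intros cE)
  have "perp (\<lambda>x. 1 * 1 + (-1) * S x)"
    unfolding perp_def
  proof (intro conjI allI impI)
    show "continuous_on {0..pi} (\<lambda>x. 1 * 1 + (-1) * S x)" by (intro continuous_intros cS)
    fix \<mu> \<phi> assume p: "sl_eigfun u \<mu> \<phi>"
    then have mu: "\<mu> \<in> sl_eigs u" by (auto simp: sl_eigs_def)
    obtain k where k: "\<And>x. x \<in> {0..pi} \<Longrightarrow> \<phi> x = k * E \<mu> x" using eigfun_simple[OF _ p] E[OF mu] by metis
    have "ip u S (E \<mu>) = (\<Sum>\<nu>\<in>sl_eigs u. ip u (\<lambda>_. 1) (E \<nu>) * ip u (E \<nu>) (E \<mu>))"
      unfolding S_def by (rule ip_sum[OF fin cE cE[OF mu]])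
    also have "\<dots> = (\<Sum>\<nu>\<in>sl_eigs u. if \<nu> = \<mu> then ip u (\<lambda>_. 1) (E \<mu>) else 0)"
    proof (intro sum.cong refl)
      fix \<nu> assume "\<nu> \<in> sl_eigs u"
      then show "ip u (\<lambda>_. 1) (E \<nu>) * ip u (E \<nu>) (E \<mu>) = (if \<nu> = \<mu> then ip u (\<lambda>_. 1) (E \<mu>) else 0)"
        using E[of \<nu>] E[OF mu] eigfun_orthogonal[of \<nu> "E \<nu>" \<mu> "E \<mu>"] by auto
    qed
    also have "\<dots> = ip u (\<lambda>_. 1) (E \<mu>)" using fin mu by simp
    finally have 1: "ip u (\<lambda>x. 1 * 1 + (-1) * S x) (E \<mu>) = 0"
      using ip_linear[OF continuous_on_const cS cE[OF mu], of 1 1 "-1"] by simp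
    have "ip u (\<lambda>x. 1 * 1 + (-1) * S x) \<phi> = ip u (\<lambda>x. k * E \<mu> x + 0 * E \<mu> x) (\<lambda>x. 1 * 1 + (-1) * S x)"
      by (subst ip_commute) (intro ip_cong, auto simp: k)
    also have "\<dots> = 0"
      by (subst ip_linear[OF cE[OF mu] cE[OF mu]]) (use 1 in \<open>auto intro!: continuous_intros cS simp: ip_commute[of "E \<mu>"]\<close>)
    finally show "ip u (\<lambda>x. 1 * 1 + (-1) * S x) \<phi> = 0" .
  qed
  from perp_eq_0[OF this, of 0] have "S 0 = 1" by simp
  moreover have "S 0 = 0" unfolding S_def using E eigfun_boundary(1) by (intro sum.neutral) auto
  ultimately show False by simp
qed

text \<open>By \<open>eigfun_K\<close> the difference of the two sides is orthogonal to every
  eigenfunction, so \<open>perp_eq_0\<close> takes the place of a uniqueness argument for the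
  differential equation.\<close>

lemma K_eigfun:
  assumes p: "sl_eigfun u \<mu> \<phi>" and x: "x \<in> {0..pi}"
  shows "K \<phi> x = \<phi> x / \<mu>"
proof -
  note c = eigfun_continuous[OF p]
  have "perp (\<lambda>x. 1 * K \<phi> x + (- (1 / \<mu>)) * \<phi> x)"
    unfolding perp_def
  proof (intro conjI allI impI)
    show "continuous_on {0..pi} (\<lambda>x. 1 * K \<phi> x + (- (1 / \<mu>)) * \<phi> x)"
      by (intro continuous_intros continuous_on_K c)
    fix \<nu> \<psi> assume q: "sl_eigfun u \<nu> \<psi>"
    have "ip u (\<lambda>x. 1 * K \<phi> x + (- (1 / \<mu>)) * \<phi> x) \<psi> = 1 * ip u (K \<phi>) \<psi> + (- (1 / \<mu>)) * ip u \<phi> \<psi>"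
      by (intro ip_linear continuous_on_K c eigfun_continuous[OF q])
    also have "ip u (K \<phi>) \<psi> = ip u \<phi> \<psi> / \<nu>"
      using eigfun_K[OF q c] eigval_pos[OF q] by (simp add: field_simps)
    also have "1 * (ip u \<phi> \<psi> / \<nu>) + (- (1 / \<mu>)) * ip u \<phi> \<psi> = 0"
      using eigfun_orthogonal[OF p q] by (cases "\<mu> = \<nu>") auto
    finally show "ip u (\<lambda>x. 1 * K \<phi> x + (- (1 / \<mu>)) * \<phi> x) \<psi> = 0" .
  qed
  from perp_eq_0[OF this x] show ?thesis by simp
qed

lemma ip_self_le:
  assumes c: "continuous_on {0..pi} f" and d: "\<And>x. x \<in> {0..pi} \<Longrightarrow> \<bar>f x\<bar> \<le> d"
  shows "ip u f f \<le> d\<^sup>2 * integral {0..pi} u"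
proof -
  have "ip u f f \<le> integral {0..pi} (\<lambda>x. d\<^sup>2 * u x)"
    unfolding ip_def
  proof (intro integral_le integrable_continuous_real continuous_intros cont_u c)
    fix x assume x: "x \<in> {0..pi}"
    have "(f x)\<^sup>2 \<le> d\<^sup>2" using d[OF x] by (metis abs_ge_zero power2_abs power_mono)
    then have "u x * (f x)\<^sup>2 \<le> u x * d\<^sup>2" using pos_u[OF x] by simp
    then show "u x * f x * f x \<le> d\<^sup>2 * u x" by (simp add: power2_eq_square mult_ac)
  qed
  then show ?thesis by simp
qed

text \<open>Images under \<open>K\<close> of orthonormal eigenfunctions with distinct eigenvalues a
  and b have squared distance 1 / a^2 + 1 / b^2. For eigenvalues below \<open>M\<close> this exceeds
  1 / M^2, so no subsequence of the images converges, contrary to compactness.\<close>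

lemma sl_eigs_below_finite: "finite {\<nu> \<in> sl_eigs u. \<nu> < M}"
proof (rule ccontr)
  assume "infinite {\<nu> \<in> sl_eigs u. \<nu> < M}"
  then obtain s :: "nat \<Rightarrow> real" where s: "inj s" "range s \<subseteq> {\<nu> \<in> sl_eigs u. \<nu> < M}"
    using infinite_countable_subset by blast
  then have sE: "s n \<in> sl_eigs u" "s n < M" for n by auto
  have "\<exists>\<phi>. sl_eigfun u (s n) \<phi> \<and> ip u \<phi> \<phi> = 1" for n
    by (rule normalized_eigfun_exists[OF sE(1)])
  then obtain F where F: "\<And>n. sl_eigfun u (s n) (F n)" "\<And>n. ip u (F n) (F n) = 1" by metis
  note cF = eigfun_continuous[OF F(1)]
  have spos: "s n > 0" for n by (rule eigval_pos[OF F(1)])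
  then have M: "M > 0" using sE(2)[of 0] by (rule less_trans)
  have F1: "ip u (F n) (F n) \<le> 1" for n by (simp add: F)
  obtain g k where cg: "continuous_on {0..pi} g" and k: "strict_mono (k :: nat \<Rightarrow> nat)"
    and lim: "\<And>e. 0 < e \<Longrightarrow> \<exists>N. \<forall>n x. n \<ge> N \<and> x \<in> {0..pi} \<longrightarrow> \<bar>K (F (k n)) x - g x\<bar> < e"
    using K_compact[of F, OF cF F1] by metis
  define U where "U = integral {0..pi} u"
  have "U \<ge> 0" unfolding U_def
    by (intro integral_nonneg integrable_continuous_real cont_u) (use pos_u in \<open>force intro: less_imp_le\<close>)
  \<comment> \<open>Chosen so that two images within \<open>d\<close> of the limit have squared
    distance at most (2 d)^2 U, which is below 1 / M^2; U + 1 makes this strict.\<close>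
  define d where "d = 1 / (2 * M * sqrt (U + 1))"
  have "d > 0" using M \<open>U \<ge> 0\<close> by (simp add: d_def)
  have "(2 * d)\<^sup>2 * U = 1 / M\<^sup>2 * (U / (U + 1))"
    using M \<open>U \<ge> 0\<close> by (simp add: d_def power_mult_distrib power_divide)
  also have "\<dots> < 1 / M\<^sup>2 * 1" using M \<open>U \<ge> 0\<close> by (intro mult_strict_left_mono) auto
  finally have d: "d > 0" "(2 * d)\<^sup>2 * U < 1 / M\<^sup>2" using \<open>d > 0\<close> by simp_all
  obtain N where N: "\<forall>n x. n \<ge> N \<and> x \<in> {0..pi} \<longrightarrow> \<bar>K (F (k n)) x - g x\<bar> < d" using lim[OF d(1)] by blast
  define a b where "a = k N" and "b = k (Suc N)"
  have "s a \<noteq> s b" using strict_monoD[OF k, of N "Suc N"] s(1) by (auto simp: a_def b_def inj_eq)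
  have D: "\<bar>1 * K (F a) x + (-1) * K (F b) x\<bar> \<le> 2 * d" if "x \<in> {0..pi}" for x
  proof -
    have "\<bar>K (F a) x - g x\<bar> < d" "\<bar>K (F b) x - g x\<bar> < d" using N that by (auto simp: a_def b_def)
    then show ?thesis by linarith
  qed
  have "ip u (\<lambda>x. 1 * K (F a) x + (-1) * K (F b) x) (\<lambda>x. 1 * K (F a) x + (-1) * K (F b) x) \<le> (2 * d)\<^sup>2 * U"
    unfolding U_def by (rule ip_self_le[OF _ D]) (intro continuous_intros continuous_on_K cF)
  also have "ip u (\<lambda>x. 1 * K (F a) x + (-1) * K (F b) x) (\<lambda>x. 1 * K (F a) x + (-1) * K (F b) x)
    = ip u (\<lambda>x. (1 / s a) * F a x + (- (1 / s b)) * F b x) (\<lambda>x. (1 / s a) * F a x + (- (1 / s b)) * F b x)"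
    using K_eigfun[OF F(1)] by (intro ip_cong) auto
  also have "\<dots> = (1 / s a)\<^sup>2 + (1 / s b)\<^sup>2"
    using eigfun_orthogonal[OF F(1) F(1) \<open>s a \<noteq> s b\<close>] by (subst ip_combine[OF cF cF]) (simp add: F)
  finally have "(1 / s a)\<^sup>2 < 1 / M\<^sup>2" using d(2) zero_le_power2[of "1 / s b"] by linarith
  moreover have "1 / M\<^sup>2 \<le> (1 / s a)\<^sup>2"
    using spos[of a] sE(2)[of a] M by (simp add: power_divide frac_le power_mono)
  ultimately show False by simp
qed

section \<open>The sequence of eigenvalues and eigenfunctions\<close>

lemma lam2_spec:
  "lam2 u n \<in> sl_eigs u \<and> card {\<nu> \<in> sl_eigs u. \<nu> < lam2 u n} = n - 1"
  unfolding lam2_def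
  by (rule theI'[OF infinite_finite_below_enumerates[OF sl_eigs_infinite sl_eigs_below_finite]])

text \<open>The index 0 has to stay out: by truncated subtraction it repeats the index 1.\<close>

lemma lam2_inj: assumes "n \<ge> 1" "m \<ge> 1" "lam2 u n = lam2 u m" shows "n = m"
  using lam2_spec[of n] lam2_spec[of m] assms by simp

lemma lam2_surj: assumes "\<mu> \<in> sl_eigs u" obtains n where "n \<ge> 1" "lam2 u n = \<mu>"
proof -
  define n where "n = Suc (card {\<nu> \<in> sl_eigs u. \<nu> < \<mu>})"
  have "lam2 u n = \<mu>"
    using infinite_finite_below_enumerates[OF sl_eigs_infinite sl_eigs_below_finite, of "n - 1"]
      lam2_spec[of n] assms by (auto simp: n_def)
  then show ?thesis using that[of n] by (simp add: n_def)
qed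

lemma phi_spec: "sl_eigfun u (lam2 u n) (phi u n) \<and> ip u (phi u n) (phi u n) = 1"
proof -
  have "\<exists>f. sl_eigfun u (lam2 u n) f \<and> integral {0..pi} (\<lambda>x. u x * (f x)\<^sup>2) = 1"
    using normalized_eigfun_exists[of "lam2 u n"] lam2_spec[of n]
    by (simp add: ip_def power2_eq_square mult.assoc)
  from someI_ex[OF this] show ?thesis unfolding phi_def by (simp add: ip_def power2_eq_square mult.assoc)
qed

lemma phi_eigfun: "sl_eigfun u (lam2 u n) (phi u n)" using phi_spec by blast
lemmas continuous_on_phi = eigfun_continuous[OF phi_eigfun]

lemma ip_phi:
  assumes "n \<ge> 1" "m \<ge> 1" shows "ip u (phi u n) (phi u m) = (if n = m then 1 else 0)"
  using phi_spec[of n] lam2_inj[OF assms] eigfun_orthogonal[OF phi_eigfun phi_eigfun, of n m] by auto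

text \<open>By \<open>eigfun_sol\<close> the function \<open>sol u g\<close> is orthogonal to all
  eigenfunctions along with \<open>g\<close>, so it vanishes. Its flux, a constant minus the
  primitive of \<open>g\<close>, is then zero, and the primitive keeps its value 0 at the left
  end.\<close>

lemma phi_complete:
  assumes g: "set_integrable lborel {0..pi} g"
    and orth: "\<And>n. n \<ge> 1 \<Longrightarrow> integral {0..pi} (\<lambda>x. g x * phi u n x) = 0" and x: "x \<in> {0..pi}"
  shows "integral {0..x} g = 0"
proof -
  note gi = set_borel_integral_eq_integral(1)[OF g]
  have "perp (sol u g)"
    unfolding perp_def
  proof (intro conjI allI impI continuous_on_sol gi)
    fix \<mu> \<psi> assume q: "sl_eigfun u \<mu> \<psi>"
    then have "\<mu> \<in> sl_eigs u" by (auto simp: sl_eigs_def)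
    then obtain n where n: "n \<ge> 1" "lam2 u n = \<mu>" by (rule lam2_surj)
    obtain k where k: "\<And>x. x \<in> {0..pi} \<Longrightarrow> \<psi> x = k * phi u n x"
      using eigfun_simple[OF phi_eigfun[of n]] q n(2) by metis
    have "\<mu> * ip u (sol u g) \<psi> = integral {0..pi} (\<lambda>x. g x * \<psi> x)" by (rule eigfun_sol[OF q g])
    also have "\<dots> = integral {0..pi} (\<lambda>x. k * (g x * phi u n x))" by (rule integral_cong) (simp add: k)
    also have "\<dots> = 0" using orth[OF n(1)] by simp
    finally show "ip u (sol u g) \<psi> = 0" using eigval_pos[OF q] by simp
  qed
  then have z: "sol u g y = 0" if "y \<in> {0..pi}" for y by (rule perp_eq_0[OF _ that])
  have "flux u g y = 0" if "y \<in> {0..pi}" for y by (rule sol_eq_0_imp[OF gi z that])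
  from this[of 0] this[OF x] have "prim g x = prim g 0" by (simp add: flux_def)
  then show ?thesis by (simp add: prim_def)
qed

end

section \<open>The product system\<close>

lemma integrable_mult_bounded:
  fixes f g :: "'a \<Rightarrow> real"
  assumes f: "integrable M f" and g: "g \<in> borel_measurable M" and b: "\<And>x. \<bar>g x\<bar> \<le> C"
  shows "integrable M (\<lambda>x. f x * g x)"
proof (rule Bochner_Integration.integrable_bound[of M "\<lambda>x. C * f x"])
  show "integrable M (\<lambda>x. C * f x)" using f by simp
  show "(\<lambda>x. f x * g x) \<in> borel_measurable M" using f g by (intro borel_measurable_times) auto
  have "\<bar>f x\<bar> * \<bar>g x\<bar> \<le> \<bar>C\<bar> * \<bar>f x\<bar>" for x
    using b[of x] by (subst mult.commute) (intro mult_right_mono, auto)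
  then show "AE x in M. norm (f x * g x) \<le> norm (C * f x)" by (simp add: abs_mult)
qed

context sl_weight begin

text \<open>Outside \<open>{0..pi}\<close> the chosen \<open>phi u n\<close> is uncontrolled;
  cutting it off there gives a bounded factor for integrals over the plane.\<close>

lemma bounded_indicator_phi:
  obtains C where "\<And>x. \<bar>indicator {0..pi} x * phi u n x\<bar> \<le> C"
proof -
  have "bounded (phi u n ` {0..pi})"
    by (intro compact_imp_bounded compact_continuous_image continuous_on_phi compact_Icc)
  then obtain C where C: "\<forall>x\<in>{0..pi}. \<bar>phi u n x\<bar> \<le> C" by (auto simp: bounded_iff)
  then have "C \<ge> 0" using pi_ge_zero by (meson abs_ge_zero atLeastAtMost_iff order.trans order_refl)
  then have "\<bar>indicator {0..pi} x * phi u n x\<bar> \<le> C" for x using C by (simp add: indicator_def)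
  then show ?thesis using that by blast
qed

lemma measurable_indicator_phi: "(\<lambda>x. indicator {0..pi} x * phi u n x) \<in> borel_measurable borel"
  using borel_measurable_continuous_on_indicator[OF _ continuous_on_phi[of n]] by simp

text \<open>Fubini separates the variables. For each time mode the integral over t is orthogonal to
  every \<open>phi u n\<close> and vanishes for almost all x; then, for each interval in x, the
  integral over that interval is orthogonal to every time mode and vanishes for almost all t. So all
  integrals over boxes are zero.\<close>

lemma product_system_complete:
  fixes \<rho> :: "real \<times> real \<Rightarrow> real"
  assumes w: "w > 0" and T: "T = 2 * pi / w"
    and \<rho>: "integrable lborel \<rho>" and out: "\<And>z. z \<notin> {0..T} \<times> {0..pi} \<Longrightarrow> \<rho> z = 0"
    and c: "\<And>m n. n \<ge> 1 \<Longrightarrow>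
      (LINT z|lborel. \<rho> z * cos (real m * w * fst z) * (indicator {0..pi} (snd z) * phi u n (snd z))) = 0"
    and s: "\<And>m n. n \<ge> 1 \<Longrightarrow>
      (LINT z|lborel. \<rho> z * sin (real m * w * fst z) * (indicator {0..pi} (snd z) * phi u n (snd z))) = 0"
  shows "AE z in lborel. \<rho> z = 0"
proof -
  have m\<rho>[measurable]: "\<rho> \<in> borel_measurable borel" using \<rho> by auto
  have R0: "AE x in lborel. (LINT t|lborel. \<rho> (t, x) * h t) = 0"
    if h: "h \<in> borel_measurable borel" "\<And>t. \<bar>h t\<bar> \<le> 1"
      and z: "\<And>n. n \<ge> 1 \<Longrightarrow> (LINT z|lborel. \<rho> z * h (fst z) * (indicator {0..pi} (snd z) * phi u n (snd z))) = 0" for h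
  proof -
    note [measurable] = h(1)
    have ih: "integrable lborel (\<lambda>z. \<rho> z * h (fst z))"
      by (rule integrable_mult_bounded[OF \<rho>, of _ 1]) (use h(2) in \<open>auto simp: borel_prod[symmetric]\<close>)
    then have ih': "integrable (lborel \<Otimes>\<^sub>M lborel) (case_prod (\<lambda>t x. \<rho> (t, x) * h t))"
      by (simp add: lborel_prod split_beta')
    define R where "R = (\<lambda>x. LINT t|lborel. \<rho> (t, x) * h t)"
    have R: "integrable lborel R" unfolding R_def by (rule lborel_pair.integrable_snd[OF ih'])
    then have siR: "set_integrable lborel {0..pi} R"
      unfolding set_integrable_def by (intro integrable_mult_indicator) auto
    have Rout: "R x = 0" if "x \<notin> {0..pi}" for x using out that by (simp add: R_def)
    have orth: "integral {0..pi} (\<lambda>x. R x * phi u n x) = 0" if n: "n \<ge> 1" for n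
    proof -
      define P where "P = (\<lambda>x. indicator {0..pi} x * phi u n x)"
      obtain C where C: "\<And>x. \<bar>P x\<bar> \<le> C" using bounded_indicator_phi[of n] unfolding P_def by metis
      have [measurable]: "P \<in> borel_measurable borel" unfolding P_def by (rule measurable_indicator_phi)
      have iR: "integrable lborel (\<lambda>x. R x * P x)" by (rule integrable_mult_bounded[OF R _ C]) simp
      have RP: "(\<lambda>x. R x * P x) = (\<lambda>x. indicator {0..pi} x *\<^sub>R (R x * phi u n x))"
        by (auto simp: P_def)
      have "integrable lborel (\<lambda>z. (\<rho> z * h (fst z)) * P (snd z))"
        by (rule integrable_mult_bounded[OF ih _ C]) (auto simp: borel_prod[symmetric])
      then have i3: "integrable (lborel \<Otimes>\<^sub>M lborel) (case_prod (\<lambda>t x. \<rho> (t, x) * h t * P x))"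
        by (simp add: lborel_prod split_beta')
      have "(LINT x|lborel. R x * P x) = (LINT x|lborel. LINT t|lborel. \<rho> (t, x) * h t * P x)"
        by (simp add: R_def)
      also have "\<dots> = (LINT z|(lborel \<Otimes>\<^sub>M lborel). case_prod (\<lambda>t x. \<rho> (t, x) * h t * P x) z)"
        by (rule lborel_pair.integral_snd[OF i3])
      also have "\<dots> = 0" using z[OF n] by (simp add: lborel_prod split_beta' P_def)
      finally have "(LINT x:{0..pi}|lborel. R x * phi u n x) = 0"
        by (simp add: set_lebesgue_integral_def RP)
      moreover have "set_integrable lborel {0..pi} (\<lambda>x. R x * phi u n x)"
        using iR unfolding RP set_integrable_def .
      ultimately show ?thesis using set_borel_integral_eq_integral(2) by metis
    qed
    have "AE x in lborel. R x = 0"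
      by (rule AE_zero_if_primitive_zero[OF R Rout]) (auto intro: phi_complete[OF siR orth])
    then show ?thesis by (simp add: R_def)
  qed
  show ?thesis
  proof (rule AE_zero_if_box_integrals_zero[OF \<rho>])
    fix za zb :: "real \<times> real"
    \<comment> \<open>With the interval in x fixed first, each time mode is integrated separately,
      and the exceptional sets of \<open>R0\<close> never have to be united over the modes.\<close>
    define b where "b = (\<lambda>x. indicator (box (snd za) (snd zb)) x :: real)"
    have [measurable]: "b \<in> borel_measurable borel" unfolding b_def by simp
    have b1: "\<bar>b x\<bar> \<le> 1" for x by (simp add: b_def indicator_def)
    have ib: "integrable lborel (\<lambda>z. \<rho> z * b (snd z))"
      by (rule integrable_mult_bounded[OF \<rho> _ b1]) (simp add: borel_prod[symmetric])
    then have ib': "integrable (lborel \<Otimes>\<^sub>M lborel) (case_prod (\<lambda>t x. \<rho> (t, x) * b x))"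
      by (simp add: lborel_prod split_beta')
    define S where "S = (\<lambda>t. LINT x|lborel. \<rho> (t, x) * b x)"
    have S: "integrable lborel S" unfolding S_def by (rule lborel_pair.integrable_fst[OF ib'])
    then have siS: "set_integrable lborel {0..T} S"
      unfolding set_integrable_def by (intro integrable_mult_indicator) auto
    have Sout: "S t = 0" if "t \<notin> {0..T}" for t
    proof -
      have "\<rho> (t, x) = 0" for x using that by (intro out) auto
      then show ?thesis by (simp add: S_def)
    qed
    have Sh: "integral {0..T} (\<lambda>t. S t * h t) = 0"
      if h: "h \<in> borel_measurable borel" "\<And>t. \<bar>h t\<bar> \<le> 1"
        and R: "AE x in lborel. (LINT t|lborel. \<rho> (t, x) * h t) = 0" for h
    proof -
      note [measurable] = h(1)
      have i3: "integrable (lborel \<Otimes>\<^sub>M lborel) (case_prod (\<lambda>t x. \<rho> (t, x) * b x * h t))"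
      proof -
        have "integrable lborel (\<lambda>z. (\<rho> z * b (snd z)) * h (fst z))"
          by (rule integrable_mult_bounded[OF ib _ h(2)]) (simp add: borel_prod[symmetric])
        then show ?thesis by (simp add: lborel_prod split_beta')
      qed
      have iS: "integrable lborel (\<lambda>t. S t * h t)" by (rule integrable_mult_bounded[OF S _ h(2)]) simp
      have Sx: "(\<lambda>t. S t * h t) = (\<lambda>t. indicator {0..T} t *\<^sub>R (S t * h t))"
        using Sout by (auto simp: indicator_def fun_eq_iff)
      have "(LINT t|lborel. S t * h t) = (LINT t|lborel. LINT x|lborel. \<rho> (t, x) * b x * h t)"
        by (simp add: S_def)
      also have "\<dots> = (LINT x|lborel. LINT t|lborel. \<rho> (t, x) * b x * h t)"
        by (rule lborel_pair.Fubini_integral[OF i3, symmetric])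
      also have "\<dots> = (LINT x|lborel. b x * (LINT t|lborel. \<rho> (t, x) * h t))"
        by (simp add: mult_ac flip: integral_mult_right_zero)
      also have "\<dots> = 0"
        by (rule integral_eq_zero_AE) (use R in eventually_elim, simp)
      finally have "(LINT t:{0..T}|lborel. S t * h t) = 0"
        unfolding set_lebesgue_integral_def Sx[symmetric] .
      moreover have "set_integrable lborel {0..T} (\<lambda>t. S t * h t)"
        unfolding set_integrable_def Sx[symmetric] by (rule iS)
      ultimately show ?thesis using set_borel_integral_eq_integral(2) by metis
    qed
    have Sc: "integral {0..T} (\<lambda>t. S t * cos (real m * w * t)) = 0" for m :: nat
      by (rule Sh[OF _ _ R0]) (use c in \<open>auto simp: abs_cos_le_one\<close>)
    have Ss: "integral {0..T} (\<lambda>t. S t * sin (real m * w * t)) = 0" for m :: nat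
      by (rule Sh[OF _ _ R0]) (use s in \<open>auto simp: abs_sin_le_one\<close>)
    have S0: "AE t in lborel. S t = 0"
      by (rule AE_zero_if_primitive_zero[OF S Sout trig_complete[OF w T siS Sc Ss]])
    define a where "a = (\<lambda>t. indicator (box (fst za) (fst zb)) t :: real)"
    have [measurable]: "a \<in> borel_measurable borel" unfolding a_def by simp
    have a1: "\<bar>a x\<bar> \<le> 1" for x by (simp add: a_def indicator_def)
    have i4: "integrable (lborel \<Otimes>\<^sub>M lborel) (case_prod (\<lambda>t x. \<rho> (t, x) * b x * a t))"
    proof -
      have "integrable lborel (\<lambda>z. (\<rho> z * b (snd z)) * a (fst z))"
        by (rule integrable_mult_bounded[OF ib _ a1]) (simp add: borel_prod[symmetric])
      then show ?thesis by (simp add: lborel_prod split_beta')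
    qed
    have "(LINT z:box za zb|lborel. \<rho> z) = (LINT z|(lborel \<Otimes>\<^sub>M lborel). case_prod (\<lambda>t x. \<rho> (t, x) * b x * a t) z)"
      unfolding lborel_prod set_lebesgue_integral_def
      by (rule Bochner_Integration.integral_cong) (auto simp: a_def b_def box_prod indicator_def split: prod.split)
    also have "\<dots> = (LINT t|lborel. LINT x|lborel. \<rho> (t, x) * b x * a t)"
      by (rule lborel_pair.integral_fst[OF i4, symmetric])
    also have "\<dots> = (LINT t|lborel. S t * a t)" by (simp add: S_def)
    also have "\<dots> = 0" by (rule integral_eq_zero_AE) (use S0 in eventually_elim, simp)
    finally show "(LINT z:box za zb|lborel. \<rho> z) = 0" .
  qed
qed

end

section \<open>Measurability and integration on the rectangle\<close>

lemma Omega_borel: "Omega T \<in> sets borel"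
  unfolding Omega_def by (intro borel_open open_Times) auto

lemma Omega_lebesgue: "Omega T \<inter> space lebesgue \<in> sets lebesgue"
  using Omega_borel[of T] by simp

lemma borel_measurable_lebesgue_on_iff:
  fixes f :: "real \<times> real \<Rightarrow> real"
  shows
  "f \<in> borel_measurable (restrict_space lebesgue (Omega T)) \<longleftrightarrow> set_borel_measurable lebesgue (Omega T) f"
  unfolding set_borel_measurable_def by (rule borel_measurable_restrict_space_iff[OF Omega_lebesgue])

lemma continuous_on_Omega_measurable:
  fixes f :: "real \<times> real \<Rightarrow> real"
  assumes "continuous_on (Omega T) f"
  shows "f \<in> borel_measurable (restrict_space lebesgue (Omega T))"
  using borel_measurable_continuous_on_indicator[OF Omega_borel assms]
  by (simp add: borel_measurable_lebesgue_on_iff set_borel_measurable_def measurable_completion)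

lemma integral_Omega_product:
  fixes a b :: "real \<Rightarrow> real"
  assumes a: "continuous_on {0..T} a" and b: "continuous_on {0..pi} b"
  shows "(LINT z:Omega T|lebesgue. a (fst z) * b (snd z)) = integral {0..T} a * integral {0..pi} b"
proof -
  define A B where "A = (\<lambda>t. indicator {0<..<T} t * a t)" and "B = (\<lambda>x. indicator {0<..<pi} x * b x)"
  have 1: "integrable lborel (\<lambda>t. indicator {0<..<L} t * f t) \<and> (LINT t|lborel. indicator {0<..<L} t * f t) = integral {0..L} f"
    if f: "continuous_on {0..L} f" for L and f :: "real \<Rightarrow> real"
  proof -
    have si: "set_integrable lborel {0<..<L} f"
      by (rule set_integrable_subset[OF borel_integrable_atLeastAtMost'[OF f]]) auto
    then show ?thesis
      using set_borel_integral_eq_integral(2)[OF si] integral_open_interval[of 0 L f]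
      by (simp add: set_integrable_def set_lebesgue_integral_def box_real)
  qed
  have A: "integrable lborel A" "(LINT t|lborel. A t) = integral {0..T} a" using 1[OF a] by (auto simp: A_def)
  have B: "integrable lborel B" "(LINT t|lborel. B t) = integral {0..pi} b" using 1[OF b] by (auto simp: B_def)
  have i: "integrable (lborel \<Otimes>\<^sub>M lborel) (case_prod (\<lambda>t x. A t * B x))"
    using integrable_lborel_product[OF A(1) B(1)] by (simp add: split_beta')
  have "(LINT z:Omega T|lebesgue. a (fst z) * b (snd z)) = (LINT z|lebesgue. A (fst z) * B (snd z))"
    unfolding set_lebesgue_integral_def
    by (rule Bochner_Integration.integral_cong) (auto simp: Omega_def A_def B_def indicator_def)
  also have "\<dots> = (LINT z|lborel. A (fst z) * B (snd z))"
    using borel_measurable_integrable[OF i] by (intro integral_completion) (simp add: lborel_prod split_beta')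
  also have "\<dots> = (LINT z|(lborel \<Otimes>\<^sub>M lborel). case_prod (\<lambda>t x. A t * B x) z)"
    by (simp add: lborel_prod split_beta')
  also have "\<dots> = (LINT t|lborel. LINT x|lborel. A t * B x)" by (rule lborel_pair.integral_fst[OF i, symmetric])
  also have "\<dots> = integral {0..T} a * integral {0..pi} b" by (simp add: A(2) B(2))
  finally show ?thesis .
qed

section \<open>The weighted space and its orthonormal basis\<close>

locale wave = sl_weight u for u :: "real \<Rightarrow> real" +
  fixes p q :: nat
  assumes p0: "p > 0" and q0: "q > 0"
begin

abbreviation "T \<equiv> Tper p q"
abbreviation "\<Omega> \<equiv> Omega (Tper p q)"
abbreviation "w \<equiv> real q / real p"

text \<open>With the weight moved into the measure, the inner product is a plain integral of a
  product, as in \<open>orthonormal_basis\<close>. The completed Lebesgue measure matches the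
  measurability in \<open>L2u\<close>.\<close>

definition M :: "(real \<times> real) measure" where
  "M = density (restrict_space lebesgue \<Omega>) (\<lambda>z. ennreal (u (snd z)))"

definition basis :: "bool \<times> nat \<times> nat \<Rightarrow> real \<times> real \<Rightarrow> real" where
  "basis = (\<lambda>(b, m, n). if b then ecos u p q m n else esin u p q m n)"

definition BI :: "(bool \<times> nat \<times> nat) set" where "BI = UNIV \<times> idx"

lemma w_pos: "w > 0" using p0 q0 by simp
lemma T_eq: "T = 2 * pi / w" by (simp add: Tper_def)
lemma T_pos: "T > 0" using p0 q0 by (simp add: Tper_def)

lemma basis_eq: "basis (b, m, n) z = Tm T m * phi u n (snd z) * trig w b m (fst z)"
  by (simp add: basis_def ecos_def esin_def trig_def)

lemma space_Omega: "z \<in> \<Omega> \<Longrightarrow> fst z \<in> {0..T} \<and> snd z \<in> {0..pi}" by (auto simp: Omega_def)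

lemma u_measurable: "(\<lambda>z. u (snd z)) \<in> borel_measurable (restrict_space lebesgue \<Omega>)"
  by (rule continuous_on_Omega_measurable)
     (auto intro!: continuous_on_compose2[OF cont_u] continuous_intros dest: space_Omega)

lemma u_nonneg_AE: "AE z in restrict_space lebesgue \<Omega>. 0 \<le> u (snd z)"
  unfolding AE_restrict_space_iff[OF Omega_lebesgue]
  by (rule AE_I2) (use pos_u space_Omega in \<open>force intro: less_imp_le\<close>)

lemma measurable_M: "borel_measurable M = borel_measurable (restrict_space lebesgue \<Omega>)"
  by (auto simp: M_def)

lemma measurable_M_iff:
  fixes f :: "real \<times> real \<Rightarrow> real"
  shows "f \<in> borel_measurable M \<longleftrightarrow> set_borel_measurable lebesgue \<Omega> f"
  unfolding measurable_M by (rule borel_measurable_lebesgue_on_iff)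

lemma integral_M:
  fixes f :: "real \<times> real \<Rightarrow> real"
  assumes "f \<in> borel_measurable M"
  shows "(LINT z|M. f z) = (LINT z:\<Omega>|lebesgue. u (snd z) * f z)"
  unfolding M_def set_lebesgue_integral_def
  using assms unfolding measurable_M
  by (subst integral_density[OF _ u_measurable u_nonneg_AE]) (auto simp: integral_restrict_space[OF Omega_lebesgue])

lemma integrable_M:
  fixes f :: "real \<times> real \<Rightarrow> real"
  assumes "f \<in> borel_measurable M"
  shows "integrable M f \<longleftrightarrow> set_integrable lebesgue \<Omega> (\<lambda>z. u (snd z) * f z)"
  unfolding M_def set_integrable_def
  using assms unfolding measurable_M
  by (subst integrable_density[OF _ u_measurable u_nonneg_AE]) (auto simp: integrable_restrict_space[OF Omega_lebesgue])

lemma AE_M: "(AE z in M. P z) \<longleftrightarrow> (AE z in lebesgue. z \<in> \<Omega> \<longrightarrow> P z)"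
proof -
  have "(\<lambda>z. ennreal (u (snd z))) \<in> borel_measurable (restrict_space lebesgue \<Omega>)"
    using u_measurable by measurable
  then have "(AE z in M. P z) \<longleftrightarrow> (AE z in restrict_space lebesgue \<Omega>. 0 < ennreal (u (snd z)) \<longrightarrow> P z)"
    unfolding M_def by (rule AE_density)
  also have "\<dots> \<longleftrightarrow> (AE z in lebesgue. z \<in> \<Omega> \<longrightarrow> 0 < ennreal (u (snd z)) \<longrightarrow> P z)"
    by (rule AE_restrict_space_iff[OF Omega_lebesgue])
  also have "\<dots> \<longleftrightarrow> (AE z in lebesgue. z \<in> \<Omega> \<longrightarrow> P z)"
    using pos_u space_Omega by (intro AE_cong) auto
  finally show ?thesis .
qed

lemma sqint_M_iff: "sqint M f \<longleftrightarrow> L2u u T f"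
proof (cases "f \<in> borel_measurable M")
  case True
  then have "(\<lambda>z. (f z)\<^sup>2) \<in> borel_measurable M" by measurable
  then show ?thesis using True integrable_M by (simp add: sqint_def L2u_def measurable_M_iff)
qed (simp add: sqint_def L2u_def measurable_M_iff)

lemma integrable_const_Omega: "set_integrable lebesgue \<Omega> (\<lambda>z. c :: real)"
proof -
  have "\<Omega> \<subseteq> cbox (0, 0) (T, pi)" by (auto simp: Omega_def)
  then have "\<Omega> \<in> lmeasurable" using Omega_borel[of T]
    by (intro bounded_set_imp_lmeasurable bounded_subset[OF bounded_cbox]) auto
  then show ?thesis unfolding set_integrable_def by (auto simp: fmeasurable_def)
qed

lemma finite_measure_M: "finite_measure M"
proof
  obtain C where C: "C > 0" "\<And>x. x \<in> {0..pi} \<Longrightarrow> u x \<le> C" using u_upper_bound by blast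
  have "integrable M (\<lambda>_. 1::real)"
  proof (subst integrable_M)
    show "set_integrable lebesgue \<Omega> (\<lambda>z. u (snd z) * 1)"
    proof (rule set_integrable_bound[OF integrable_const_Omega[of C]])
      show "set_borel_measurable lebesgue \<Omega> (\<lambda>z. u (snd z) * 1)"
        using u_measurable by (simp add: borel_measurable_lebesgue_on_iff)
      show "AE z in lebesgue. z \<in> \<Omega> \<longrightarrow> norm (u (snd z) * 1) \<le> norm C"
        using C pos_u space_Omega by (intro AE_I2) (auto simp: abs_of_pos)
    qed
  qed simp
  then show "emeasure M (space M) \<noteq> \<infinity>" by (auto simp: integrable_iff_bounded emeasure_eq_ennreal_measure top_unique)
qed

lemma continuous_on_phi_snd: "continuous_on \<Omega> (\<lambda>z. phi u n (snd z))"
  by (intro continuous_on_compose2[OF continuous_on_phi] continuous_intros) (auto dest: space_Omega)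

lemma basis_measurable: "basis i \<in> borel_measurable M"
proof -
  obtain b m n where i: "i = (b, m, n)" by (cases i) auto
  have "continuous_on \<Omega> (\<lambda>z. Tm T m * phi u n (snd z) * trig w b m (fst z))"
    by (intro continuous_intros continuous_on_phi_snd continuous_on_compose2[OF trig_continuous[of UNIV]]) auto
  then show ?thesis
    unfolding measurable_M i basis_eq[abs_def] by (rule continuous_on_Omega_measurable)
qed

lemma basis_bounded: obtains C where "\<And>z. z \<in> \<Omega> \<Longrightarrow> \<bar>basis i z\<bar> \<le> C"
proof -
  obtain b m n where i: "i = (b, m, n)" by (cases i) auto
  obtain C where C: "\<And>x. \<bar>indicator {0..pi} x * phi u n x\<bar> \<le> C" using bounded_indicator_phi by metis
  have "\<bar>basis i z\<bar> \<le> \<bar>Tm T m\<bar> * C" if "z \<in> \<Omega>" for z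
  proof -
    have "\<bar>phi u n (snd z)\<bar> \<le> C" using C[of "snd z"] space_Omega[OF that] by simp
    then have "\<bar>Tm T m\<bar> * \<bar>phi u n (snd z)\<bar> * \<bar>trig w b m (fst z)\<bar> \<le> \<bar>Tm T m\<bar> * C * 1"
      using abs_trig_le by (intro mult_mono mult_left_mono) auto
    then show ?thesis by (simp add: i basis_eq abs_mult)
  qed
  then show ?thesis using that by blast
qed

lemma sqint_bounded:
  assumes f: "f \<in> borel_measurable M" and b: "\<And>z. z \<in> \<Omega> \<Longrightarrow> \<bar>f z\<bar> \<le> C"
  shows "sqint M f"
proof -
  interpret finite_measure M by (rule finite_measure_M)
  have "integrable M (\<lambda>z. (f z)\<^sup>2)"
  proof (rule integrable_const_bound[of _ "C\<^sup>2"])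
    have "(f z)\<^sup>2 \<le> C\<^sup>2" if "z \<in> \<Omega>" for z using b[OF that] by (metis abs_ge_zero power2_abs power_mono)
    then show "AE z in M. norm ((f z)\<^sup>2) \<le> C\<^sup>2" unfolding AE_M by auto
    show "(\<lambda>z. (f z)\<^sup>2) \<in> borel_measurable M" using f by measurable
  qed
  then show ?thesis using f by (simp add: sqint_def)
qed

lemma sqint_basis: "sqint M (basis i)"
  using basis_bounded[of i] sqint_bounded[OF basis_measurable] by metis

lemma integral_basis_basis:
  assumes "n \<ge> 1" "n' \<ge> 1"
  shows "(LINT z|M. basis (b, m, n) z * basis (b', m', n') z)
    = (if b = b' \<and> m = m' \<and> n = n' then (if m = 0 \<and> \<not> b then 0 else 1) else 0)"
proof -
  have "(LINT z|M. basis (b, m, n) z * basis (b', m', n') z)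
     = (LINT z:\<Omega>|lebesgue. u (snd z) * (basis (b, m, n) z * basis (b', m', n') z))"
    using basis_measurable by (intro integral_M borel_measurable_times) auto
  also have "\<dots> = (LINT z:\<Omega>|lebesgue. (Tm T m * Tm T m' * (trig w b m (fst z) * trig w b' m' (fst z)))
      * (u (snd z) * phi u n (snd z) * phi u n' (snd z)))"
    by (simp add: basis_eq mult_ac)
  also have "\<dots> = integral {0..T} (\<lambda>t. Tm T m * Tm T m' * (trig w b m t * trig w b' m' t))
      * integral {0..pi} (\<lambda>x. u x * phi u n x * phi u n' x)"
    by (rule integral_Omega_product) (intro continuous_intros trig_continuous cont_u continuous_on_phi)+
  also have "integral {0..pi} (\<lambda>x. u x * phi u n x * phi u n' x) = (if n = n' then 1 else 0)"
    using ip_phi[OF assms] by (simp add: ip_def)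
  also have "integral {0..T} (\<lambda>t. Tm T m * Tm T m' * (trig w b m t * trig w b' m' t))
    = Tm T m * Tm T m' * integral {0..T} (\<lambda>t. trig w b m t * trig w b' m' t)" by simp
  also have "\<dots> = Tm T m * Tm T m' * (if b = b' \<and> m = m' then (if m = 0 then (if b then T else 0) else T / 2) else 0)"
    using integral_trig_trig[OF w_pos T_eq] by simp
  also have "\<dots> = (if b = b' \<and> m = m' then (if m = 0 \<and> \<not> b then 0 else 1) else 0)"
    using T_pos by (auto simp: Tm_def power_divide simp flip: power2_eq_square)
  finally show ?thesis by simp
qed

sublocale L2: orthonormal_basis M basis BI
proof -
  interpret finite_measure M by (rule finite_measure_M)
  show "orthonormal_basis M basis BI"
  proof
    show "countable BI" by simp
    show "sqint M (basis i)" for i by (rule sqint_basis)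
    show "(LINT z|M. basis i z * basis j z) = 0" if "i \<in> BI" "j \<in> BI" "i \<noteq> j" for i j
      using that by (cases i; cases j) (auto simp: BI_def idx_def integral_basis_basis)
    show "(LINT z|M. basis i z * basis i z) = 1 \<or> basis i = (\<lambda>_. 0)" if "i \<in> BI" for i
    proof -
      obtain b m n where i: "i = (b, m, n)" by (cases i) auto
      show ?thesis
      proof (cases "m = 0 \<and> \<not> b")
        case True then show ?thesis by (auto simp: i basis_eq trig_def fun_eq_iff)
      next
        case False
        then show ?thesis using that integral_basis_basis[of n n b m b m] by (auto simp: i BI_def idx_def)
      qed
    qed
    fix r assume r: "sqint M r" and orth: "\<And>i. i \<in> BI \<Longrightarrow> (LINT z|M. r z * basis i z) = 0"
    \<comment> \<open>The weight is absorbed into the function, so that the coefficients become the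
      unweighted integrals of \<open>product_system_complete\<close>.\<close>
    define \<rho>0 where "\<rho>0 = (\<lambda>z. indicator \<Omega> z * (u (snd z) * r z))"
    have "integrable M r" using sqint_mult[OF r, of "\<lambda>_. 1"] by (simp add: sqint_def)
    then have i0: "integrable lebesgue \<rho>0"
      using integrable_M[of r] sqint_measurable[OF r] by (simp add: set_integrable_def \<rho>0_def)
    \<comment> \<open>Fubini is available for Borel functions on the product of
      \<open>lborel\<close> with itself, so a Borel representative replaces \<rho>0; it is cut off
      to the rectangle once more, as it may differ from \<rho>0 on a null set outside.\<close>
    then obtain \<rho>1 where \<rho>1: "\<rho>1 \<in> borel_measurable lborel" "AE z in lborel. \<rho>0 z = \<rho>1 z"
      using completion_ex_borel_measurable_real[of \<rho>0 lborel] by auto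
    define \<rho> where "\<rho> = (\<lambda>z. indicator \<Omega> z * \<rho>1 z)"
    have m\<rho>[measurable]: "\<rho> \<in> borel_measurable borel"
      unfolding \<rho>_def using \<rho>1(1) Omega_borel[of T] by simp
    have eq: "AE z in lebesgue. \<rho>0 z = \<rho> z"
      using AE_completion[OF \<rho>1(2)] by eventually_elim (auto simp: \<rho>_def \<rho>0_def indicator_def)
    have m\<rho>L: "\<rho> \<in> borel_measurable lebesgue" by (rule measurable_completion) simp
    have "integrable lebesgue \<rho>"
      using integrable_cong_AE[OF borel_measurable_integrable[OF i0] m\<rho>L eq] i0 by simp
    then have i\<rho>: "integrable lborel \<rho>" using integrable_completion[of \<rho> lborel] by simp
    have co: "(LINT z|lborel. \<rho> z * trig w b m (fst z) * (indicator {0..pi} (snd z) * phi u n (snd z))) = 0"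
      if n: "n \<ge> 1" for b m n
    proof -
      have [measurable]: "(\<lambda>x. indicator {0..pi} x * phi u n x) \<in> borel_measurable borel"
        by (rule measurable_indicator_phi)
      have [measurable]: "trig w b m \<in> borel_measurable borel"
        by (rule borel_measurable_continuous_onI[OF trig_continuous])
      have mB0: "(\<lambda>z. trig w b m (fst z) * (indicator {0..pi} (snd z) * phi u n (snd z))) \<in> borel_measurable borel"
        by (simp add: borel_prod[symmetric])
      have mB: "(\<lambda>z. \<rho> z * trig w b m (fst z) * (indicator {0..pi} (snd z) * phi u n (snd z))) \<in> borel_measurable borel"
        unfolding mult.assoc by (intro borel_measurable_times m\<rho> mB0)
      have T0: "Tm T m \<noteq> 0" using T_pos by (simp add: Tm_def)
      have mr: "(\<lambda>z. r z * basis (b, m, n) z) \<in> borel_measurable M"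
        using sqint_measurable[OF r] basis_measurable by (intro borel_measurable_times)
      have "(LINT z|lborel. \<rho> z * trig w b m (fst z) * (indicator {0..pi} (snd z) * phi u n (snd z)))
        = (LINT z|lebesgue. \<rho> z * trig w b m (fst z) * (indicator {0..pi} (snd z) * phi u n (snd z)))"
        using mB by (intro integral_completion[symmetric]) simp
      also have "\<dots> = (LINT z|lebesgue. \<rho>0 z * (trig w b m (fst z) * (indicator {0..pi} (snd z) * phi u n (snd z))))"
      proof (rule integral_cong_AE)
        show "(\<lambda>z. \<rho>0 z * (trig w b m (fst z) * (indicator {0..pi} (snd z) * phi u n (snd z)))) \<in> borel_measurable lebesgue"
          by (intro borel_measurable_times[OF borel_measurable_integrable[OF i0]] measurable_completion) (simp add: mB0)
        show "(\<lambda>z. \<rho> z * trig w b m (fst z) * (indicator {0..pi} (snd z) * phi u n (snd z))) \<in> borel_measurable lebesgue"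
          using mB by (intro measurable_completion) simp
      qed (use eq in eventually_elim, simp)
      also have "\<dots> = (LINT z|lebesgue. (1 / Tm T m) * (indicator \<Omega> z *\<^sub>R (u (snd z) * (r z * basis (b, m, n) z))))"
        using T0 by (intro Bochner_Integration.integral_cong)
           (auto simp: \<rho>0_def basis_eq indicator_def dest: space_Omega)
      also have "\<dots> = (1 / Tm T m) * (LINT z|M. r z * basis (b, m, n) z)"
        unfolding integral_M[OF mr] set_lebesgue_integral_def by simp
      also have "\<dots> = 0" using orth[of "(b, m, n)"] n by (simp add: BI_def idx_def)
      finally show ?thesis .
    qed
    have "AE z in lborel. \<rho> z = 0"
    proof (rule product_system_complete[OF w_pos T_eq i\<rho>])
      show "\<rho> z = 0" if "z \<notin> {0..T} \<times> {0..pi}" for z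
      proof -
        have "z \<notin> \<Omega>" using that by (auto simp: Omega_def)
        then show ?thesis by (simp add: \<rho>_def)
      qed
      show "(LINT z|lborel. \<rho> z * cos (real m * w * fst z) * (indicator {0..pi} (snd z) * phi u n (snd z))) = 0"
        if "n \<ge> 1" for m n
        using co[OF that, of True m] by (simp only: trig_def if_True mult.commute[of "real m" w])
      show "(LINT z|lborel. \<rho> z * sin (real m * w * fst z) * (indicator {0..pi} (snd z) * phi u n (snd z))) = 0"
        if "n \<ge> 1" for m n
        using co[OF that, of False m] by (simp only: trig_def if_False mult.commute[of "real m" w])
    qed
    from AE_completion[OF this] eq have "AE z in lebesgue. \<rho>0 z = 0" by eventually_elim simp
    then show "AE z in M. r z = 0"
      unfolding AE_M
    proof eventually_elim
      case (elim z)
      show ?case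
      proof
        assume z: "z \<in> \<Omega>"
        then have "u (snd z) \<noteq> 0" using nz_u space_Omega by blast
        then show "r z = 0" using elim z by (simp add: \<rho>0_def)
      qed
    qed
  qed
qed

lemma acoef_eq: assumes "sqint M y" shows "acoef u p q y m n = L2.cf y (True, m, n)"
  unfolding L2.cf_def using sqint_measurable[OF assms] basis_measurable[of "(True, m, n)"]
  by (subst integral_M) (auto simp: acoef_def basis_def mult.assoc intro: borel_measurable_times)

lemma bcoef_eq: assumes "sqint M y" shows "bcoef u p q y m n = L2.cf y (False, m, n)"
  unfolding L2.cf_def using sqint_measurable[OF assms] basis_measurable[of "(False, m, n)"]
  by (subst integral_M) (auto simp: bcoef_def basis_def mult.assoc intro: borel_measurable_times)

end

section \<open>The weak formulation\<close>

text \<open>The class of functions \<open>P x cos (w m t) + Q x sin (w m t)\<close> is closed under directional derivatives.\<close>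
lemma Ck_poly_trig:
  fixes P Q :: "real poly" and a :: real
  shows "Ck k (\<lambda>z. poly P (snd z) * cos (a * fst z) + poly Q (snd z) * sin (a * fst z))"
proof (induction k arbitrary: P Q)
  case 0
  show ?case by (auto intro!: continuous_intros)
next
  case (Suc k)
  define g' where "g' = (\<lambda>z v :: real \<times> real.
     poly (smult (snd v) (pderiv P) + smult (a * fst v) Q) (snd z) * cos (a * fst z)
   + poly (smult (snd v) (pderiv Q) - smult (a * fst v) P) (snd z) * sin (a * fst z))"
  have "((\<lambda>z. poly P (snd z) * cos (a * fst z) + poly Q (snd z) * sin (a * fst z)) has_derivative g' z) (at z)" for z
    unfolding g'_def
    by (auto intro!: derivative_eq_intros DERIV_compose_FDERIV[OF poly_DERIV] simp: fun_eq_iff algebra_simps)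
  moreover have "Ck k (\<lambda>z. g' z v)" for v unfolding g'_def by (rule Suc)
  ultimately show ?case unfolding Ck.simps by blast
qed

lemma pderiv_sum: "pderiv (sum f A) = (\<Sum>i\<in>A. pderiv (f i))"
  by (induction A rule: infinite_finite_induct) (auto simp: pderiv_add)

lemma poly_antiderivative:
  fixes P :: "real poly" obtains Q where "pderiv Q = P"
proof -
  define Q where "Q = (\<Sum>i\<le>degree P. monom (coeff P i / real (Suc i)) (Suc i))"
  have "pderiv Q = (\<Sum>i\<le>degree P. monom (coeff P i) i)"
    unfolding Q_def pderiv_sum by (rule sum.cong) (auto simp: pderiv_monom)
  also have "\<dots> = P" by (rule poly_as_sum_of_monoms)
  finally show ?thesis using that by blast
qed

lemma poly_dense_continuous:
  fixes f :: "real \<Rightarrow> real"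
  assumes "continuous_on {a..b} f" "e > 0"
  obtains P :: "real poly" where "\<And>x. x \<in> {a..b} \<Longrightarrow> \<bar>f x - poly P x\<bar> < e"
proof -
  obtain g where g: "real_polynomial_function g" "\<And>x. x \<in> {a..b} \<Longrightarrow> \<bar>f x - g x\<bar> < e"
    using Stone_Weierstrass_real_polynomial_function[OF compact_Icc assms] by metis
  obtain c n where gc: "g = (\<lambda>x. \<Sum>i\<le>n. c i * x ^ i)"
    using g(1) unfolding real_polynomial_function_iff_sum by blast
  have "poly (\<Sum>i\<le>n. monom (c i) i) x = g x" for x by (simp add: poly_sum poly_monom gc)
  then show ?thesis using that[of "\<Sum>i\<le>n. monom (c i) i"] g(2) by simp
qed

text \<open>Approximate the second derivative and integrate twice.\<close>
lemma poly_dense_C2: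
  fixes f :: "real \<Rightarrow> real"
  assumes L: "L > 0" and d: "\<And>x. x \<in> {0..L} \<Longrightarrow> (f has_real_derivative f1 x) (at x within {0..L})"
    and d2: "\<And>x. x \<in> {0..L} \<Longrightarrow> (f1 has_real_derivative f2 x) (at x within {0..L})"
    and c: "continuous_on {0..L} f2" and z: "f 0 = 0" "f L = 0" and e: "e > 0"
  obtains P :: "real poly" where "poly P 0 = 0" "poly P L = 0"
    "\<And>x. x \<in> {0..L} \<Longrightarrow> \<bar>f x - poly P x\<bar> \<le> e * L * L"
    "\<And>x. x \<in> {0..L} \<Longrightarrow> \<bar>f1 x - poly (pderiv P) x\<bar> \<le> e * L"
    "\<And>x. x \<in> {0..L} \<Longrightarrow> \<bar>f2 x - poly (pderiv (pderiv P)) x\<bar> \<le> e"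
proof -
  obtain R where R: "\<And>x. x \<in> {0..L} \<Longrightarrow> \<bar>f2 x - poly R x\<bar> < e"
    using poly_dense_continuous[OF c e] by metis
  obtain R1 where R1: "pderiv R1 = R" by (rule poly_antiderivative)
  obtain R2 where R2: "pderiv R2 = R1" by (rule poly_antiderivative)
  \<comment> \<open>An affine correction restores both boundary values and leaves the second
    derivative alone.\<close>
  define k where "k = (poly R2 L - poly R2 0) / L"
  define P where "P = R2 - [:poly R2 0, k:]"
  have P1: "pderiv P = R1 - [:k:]" and P2: "pderiv (pderiv P) = R"
    by (simp_all add: P_def pderiv_diff pderiv_pCons R1 R2)
  have P0: "poly P 0 = 0" and PL: "poly P L = 0" using L by (simp_all add: P_def k_def)
  define g where "g = (\<lambda>x. f x - poly P x)"
  define g1 where "g1 = (\<lambda>x. f1 x - poly (pderiv P) x)"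
  have dg: "(g has_real_derivative g1 x) (at x within {0..L})" if "x \<in> {0..L}" for x
    unfolding g_def g1_def by (intro DERIV_diff d that DERIV_subset[OF poly_DERIV]) simp
  have dg1: "(g1 has_real_derivative f2 x - poly R x) (at x within {0..L})" if "x \<in> {0..L}" for x
    unfolding g1_def P2[symmetric] by (intro DERIV_diff d2 that DERIV_subset[OF poly_DERIV]) simp
  \<comment> \<open>The error \<open>g\<close> vanishes at both ends, so its derivative has a zero;
    starting there, the bound on the second derivatives integrates to one on the first derivatives,
    and from 0 to one on the values.\<close>
  have "\<exists>x>0. x < L \<and> (g has_real_derivative 0) (at x)"
  proof (rule Rolle[OF L])
    show "g 0 = g L" using z P0 PL by (simp add: g_def)
    show "continuous_on {0..L} g" by (rule DERIV_continuous_on[OF dg])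
    show "g differentiable (at x)" if "0 < x" "x < L" for x
    proof -
      have "(g has_real_derivative g1 x) (at x)"
        using dg[of x] that at_within_Icc_at[of 0 x L] by simp
      then show ?thesis using real_differentiable_def by blast
    qed
  qed
  then obtain x0 where x0: "0 < x0" "x0 < L" "(g has_real_derivative 0) (at x0)" by blast
  then have "g1 x0 = 0" using DERIV_unique dg[of x0] at_within_Icc_at[of 0 x0 L] by auto
  have b1: "\<bar>g1 x\<bar> \<le> e * L" if x: "x \<in> {0..L}" for x
  proof -
    have "norm (g1 x - g1 x0) \<le> e * norm (x - x0)"
      by (rule field_differentiable_bound[of "{0..L}" g1 "\<lambda>x. f2 x - poly R x"])
         (use dg1 R x x0 in \<open>auto intro: less_imp_le\<close>)
    also have "\<dots> \<le> e * L" using x x0 e by (intro mult_left_mono) auto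
    finally show ?thesis using \<open>g1 x0 = 0\<close> by simp
  qed
  have b0: "\<bar>g x\<bar> \<le> e * L * L" if x: "x \<in> {0..L}" for x
  proof -
    have "norm (g x - g 0) \<le> (e * L) * norm (x - 0)"
      by (rule field_differentiable_bound[of "{0..L}" g g1]) (use dg b1 x L in auto)
    also have "\<dots> \<le> e * L * L" using x L e by (intro mult_left_mono) auto
    finally show ?thesis using z(1) P0 by (simp add: g_def)
  qed
  show ?thesis
    by (rule that[OF P0 PL]) (use b0 b1 R in \<open>auto simp: g_def g1_def P2 intro: less_imp_le\<close>)
qed

text \<open>\<open>T\<close> is a whole number of periods of every mode, so the conditions in time
  hold exactly; the conditions in space are those on \<open>P\<close>.\<close>

lemma poly_trig_test_fn:
  fixes P :: "real poly"
  assumes w: "w > 0" and T: "T = 2 * pi / w" and z: "poly P 0 = 0" "poly P pi = 0"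
  shows "test_fn T (\<lambda>z. poly P (snd z) * trig w b m (fst z))"
  unfolding test_fn_def
proof (intro conjI ballI)
  have wT: "w * real m * T = 2 * pi * of_int (int m)" using w by (simp add: T)
  show "smooth (\<lambda>z. poly P (snd z) * trig w b m (fst z))"
    unfolding smooth_def
  proof
    fix k show "Ck k (\<lambda>z. poly P (snd z) * trig w b m (fst z))"
      using Ck_poly_trig[of k P "w * real m" 0] Ck_poly_trig[of k 0 "w * real m" P]
      by (cases b) (simp_all add: trig_def)
  qed
  have per: "trig w b m 0 = trig w b m T"
    unfolding trig_def wT sin_int_2pin cos_int_2pin by simp
  show "poly P (snd (t, 0)) * trig w b m (fst (t, 0)) = 0" "poly P (snd (t, pi)) * trig w b m (fst (t, pi)) = 0"
    if "t \<in> {0..T}" for t using z by simp_all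
  show "poly P (snd (0, x)) * trig w b m (fst (0, x)) = poly P (snd (T, x)) * trig w b m (fst (T, x))"
    if "x \<in> {0..pi}" for x using per by simp
  have dtr: "deriv (trig w b m) t = (if b then - (w * real m) * sin (w * real m * t) else w * real m * cos (w * real m * t))" for t
    by (rule DERIV_imp_deriv) (cases b, auto simp: trig_def[abs_def] intro!: derivative_eq_intros)
  have dd: "trig w b m field_differentiable at t" for t
    unfolding trig_def[abs_def] field_differentiable_def by (cases b) (auto intro!: derivative_eq_intros exI)
  have "deriv (trig w b m) 0 = deriv (trig w b m) T"
    unfolding dtr wT sin_int_2pin cos_int_2pin by simp
  then show "dt (\<lambda>z. poly P (snd z) * trig w b m (fst z)) (0, x) = dt (\<lambda>z. poly P (snd z) * trig w b m (fst z)) (T, x)"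
    if "x \<in> {0..pi}" for x
    unfolding dt_def by (simp add: dd)
qed

lemma Aop_poly_trig:
  fixes P :: "real poly"
  assumes x: "0 < x" "x < pi" and u: "(u has_real_derivative u1 x) (at x)"
  shows "Aop u (\<lambda>z. poly P (snd z) * trig w b m (fst z)) (t, x)
    = - (u x * poly P x * (w * real m)\<^sup>2 + u1 x * poly (pderiv P) x + u x * poly (pderiv (pderiv P)) x) * trig w b m t"
proof -
  define g1 where "g1 = (\<lambda>t. if b then - (w * real m) * sin (w * real m * t) else w * real m * cos (w * real m * t))"
  have d1: "(trig w b m has_real_derivative g1 t) (at t)" for t
    by (cases b) (auto simp: trig_def[abs_def] g1_def intro!: derivative_eq_intros)
  have d2: "(g1 has_real_derivative - (w * real m)\<^sup>2 * trig w b m t) (at t)" for t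
    by (cases b) (auto simp: trig_def[abs_def] g1_def power2_eq_square intro!: derivative_eq_intros)
  have "(\<lambda>s. deriv (\<lambda>r. poly P x * trig w b m r) s) = (\<lambda>s. poly P x * g1 s)"
    by (intro ext DERIV_imp_deriv DERIV_cmult d1)
  then have e1: "deriv (\<lambda>s. deriv (\<lambda>r. poly P x * trig w b m r) s) t = poly P x * (- (w * real m)\<^sup>2 * trig w b m t)"
    by (simp only:) (intro DERIV_imp_deriv DERIV_cmult d2)
  have "(\<lambda>xi. u xi * deriv (\<lambda>eta. poly P eta * trig w b m t) xi) = (\<lambda>xi. u xi * (poly (pderiv P) xi * trig w b m t))"
    by (intro ext arg_cong2[where f = "(*)"] refl DERIV_imp_deriv DERIV_cmult_right poly_DERIV)
  moreover have "((\<lambda>xi. u xi * (poly (pderiv P) xi * trig w b m t)) has_real_derivative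
      u1 x * (poly (pderiv P) x * trig w b m t) + (poly (pderiv (pderiv P)) x * trig w b m t) * u x) (at x)"
    by (intro DERIV_mult u DERIV_cmult_right poly_DERIV)
  ultimately have e2: "deriv (\<lambda>xi. u xi * deriv (\<lambda>eta. poly P eta * trig w b m t) xi) x
     = u1 x * (poly (pderiv P) x * trig w b m t) + (poly (pderiv (pderiv P)) x * trig w b m t) * u x"
    by (simp add: DERIV_imp_deriv)
  show ?thesis unfolding Aop_def fst_conv snd_conv e1 e2 by (simp add: algebra_simps)
qed

section \<open>Half-period symmetry and membership in the kernels\<close>

text \<open>The affine transformation law with unit factors, for the completed measure on which
  \<open>Mo\<close> is defined.\<close>

lemma lebesgue_integral_translation:
  fixes f :: "'a::euclidean_space \<Rightarrow> real"
  assumes "f \<in> borel_measurable lebesgue"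
  shows "(LINT x|lebesgue. f (a + x)) = (LINT x|lebesgue. f x)"
proof -
  have tr: "(\<lambda>x. a + (\<Sum>j\<in>Basis. (1 * (x \<bullet> j)) *\<^sub>R j)) = (+) a" by (auto simp: euclidean_representation)
  have m: "(+) a \<in> lebesgue \<rightarrow>\<^sub>M lebesgue"
    using lebesgue_affine_measurable[of "\<lambda>_::'a. 1" a] unfolding tr by simp
  have "lebesgue = density (distr lebesgue lebesgue ((+) a)) (\<lambda>_. ennreal (\<Prod>j\<in>(Basis::'a set). \<bar>1\<bar>))"
    using lebesgue_affine_euclidean[of "\<lambda>_::'a. 1" a] unfolding tr by simp
  then have "lebesgue = distr lebesgue lebesgue ((+) a)" by (simp add: density_1)
  then have "(LINT x|lebesgue. f x) = (LINT x|distr lebesgue lebesgue ((+) a). f x)" by simp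
  also have "\<dots> = (LINT x|lebesgue. f (a + x))" by (rule integral_distr[OF m assms])
  finally show ?thesis by simp
qed

lemma AE_fst_neq:
  "AE z in (lebesgue :: (real \<times> real) measure). fst z \<noteq> c"
proof -
  have "(1, 0) \<in> (Basis :: (real \<times> real) set)" by (simp add: Basis_prod_def)
  from AE_completion[OF AE_lborel_inner_neq[OF this, of c]] show ?thesis by (simp add: inner_prod_def)
qed

context wave begin

lemma pext_Omega: assumes "z \<in> \<Omega>" shows "pext T y z = y z"
proof -
  have "0 < fst z / T" "fst z / T < 1" using assms T_pos by (auto simp: Omega_def)
  then have "\<lfloor>fst z / T\<rfloor> = 0" by linarith
  then show ?thesis by (simp add: pext_def)
qed

lemma trig_half_period:
  assumes "even m" shows "trig w b m (t + T / 2) = trig w b m t"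
proof -
  obtain k where k: "m = 2 * k" using assms by (rule evenE)
  have "w * real m * (T / 2) = 2 * pi * of_int (int k)" using p0 q0 by (simp add: k Tper_def)
  then have "w * real m * (t + T / 2) = w * real m * t + 2 * pi * of_int (int k)" by (simp add: distrib_left)
  then show ?thesis unfolding trig_def
    by (simp only: sin_add cos_add sin_int_2pin cos_int_2pin) simp
qed

lemma integrable_Omega_of_M:
  assumes "integrable M f" shows "integrable lebesgue (\<lambda>z. indicator \<Omega> z * (u (snd z) * f z))"
  using assms integrable_M[OF borel_measurable_integrable[OF assms]] by (simp add: set_integrable_def)

text \<open>A shift by half a period carries the first half of the rectangle onto the second; it
  preserves an even mode and reverses the sign of \<open>y\<close>, so the two halves of the
  integral cancel.\<close>

lemma Mo_even_coefficient_zero: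
  assumes y: "Mo u T y" and m: "even m"
  shows "L2.cf y (b, m, n) = 0"
proof -
  have sy: "sqint M y" using y by (simp add: Mo_def sqint_M_iff)
  define H where "H = (\<lambda>z. indicator \<Omega> z * (u (snd z) * (y z * basis (b, m, n) z)))"
  have iH: "integrable lebesgue H"
    unfolding H_def by (rule integrable_Omega_of_M[OF sqint_mult[OF sy sqint_basis]])
  \<comment> \<open>Both inequalities are strict: the omitted line t = T / 2 is a null set.\<close>
  define A B where "A = (\<lambda>z :: real \<times> real. if fst z < T / 2 then 1 else 0 :: real)"
    and "B = (\<lambda>z :: real \<times> real. if fst z > T / 2 then 1 else 0 :: real)"
  have mA: "A \<in> borel_measurable lebesgue" and mB: "B \<in> borel_measurable lebesgue"
    unfolding A_def B_def by (rule measurable_completion, simp add: borel_prod[symmetric])+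
  have iA: "integrable lebesgue (\<lambda>z. H z * A z)"
    by (rule integrable_mult_bounded[OF iH mA, of 1]) (simp add: A_def)
  have iB: "integrable lebesgue (\<lambda>z. H z * B z)"
    by (rule integrable_mult_bounded[OF iH mB, of 1]) (simp add: B_def)
  have "(LINT z|lebesgue. H z * B z) = (LINT z|lebesgue. H ((T / 2, 0) + z) * B ((T / 2, 0) + z))"
    using lebesgue_integral_translation[OF borel_measurable_integrable[OF iB], of "(T / 2, 0)"] by simp
  also have "\<dots> = (LINT z|lebesgue. - (H z * A z))"
  proof (rule integral_cong_AE)
    have mt: "(\<lambda>z::real \<times> real. (T / 2, 0) + z) \<in> lebesgue \<rightarrow>\<^sub>M lebesgue"
      using lebesgue_affine_measurable[of "\<lambda>_::real \<times> real. 1" "(T / 2, 0)"] by (simp add: euclidean_representation)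
    show "(\<lambda>z. H ((T / 2, 0) + z) * B ((T / 2, 0) + z)) \<in> borel_measurable lebesgue"
      using measurable_compose[OF mt borel_measurable_integrable[OF iB]] by simp
    show "(\<lambda>z. - (H z * A z)) \<in> borel_measurable lebesgue" using iA by auto
    have "AE z in lebesgue. z \<in> \<Omega> \<longrightarrow> pext T y z = - pext T y (fst z + T / 2, snd z)"
      using y by (simp add: Mo_def)
    then show "AE z in lebesgue. H ((T / 2, 0) + z) * B ((T / 2, 0) + z) = - (H z * A z)"
    proof eventually_elim
      case (elim z)
      obtain t x where z: "z = (t, x)" by (cases z)
      show ?case
      proof (cases "z \<in> \<Omega> \<and> t < T / 2")
        case True
        then have z': "(t + T / 2, x) \<in> \<Omega>" and z0: "(t, x) \<in> \<Omega>" "0 < t" using T_pos by (auto simp: z Omega_def)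
        have "y (t, x) = - y (t + T / 2, x)"
          using elim z0 pext_Omega[OF z0(1), of y] pext_Omega[OF z', of y] by (simp add: z)
        then show ?thesis
          using z' z0 True by (simp add: z H_def A_def B_def basis_eq trig_half_period[OF m] add.commute[of "T / 2"])
      next
        case False
        then show ?thesis using T_pos by (auto simp: z H_def A_def B_def indicator_def Omega_def)
      qed
    qed
  qed
  finally have BA: "(LINT z|lebesgue. H z * B z) = - (LINT z|lebesgue. H z * A z)" by simp
  have "(LINT z|lebesgue. H z) = (LINT z|lebesgue. H z * A z + H z * B z)"
  proof (rule integral_cong_AE)
    show "AE z in lebesgue. H z = H z * A z + H z * B z"
      using AE_fst_neq[of "T / 2"] by eventually_elim (auto simp: A_def B_def)
  qed (use iH iA iB in auto)
  also have "\<dots> = 0" using iA iB BA by simp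
  finally have "(LINT z|lebesgue. H z) = 0" .
  moreover have "L2.cf y (b, m, n) = (LINT z|lebesgue. H z)"
    unfolding L2.cf_def
    using integral_M[OF borel_measurable_times[OF sqint_measurable[OF sy] basis_measurable], of "(b, m, n)"]
    by (simp add: set_lebesgue_integral_def H_def)
  ultimately show ?thesis by simp
qed

lemma sum_bool_times:
  assumes F: "finite F"
  shows "(\<Sum>i\<in>UNIV \<times> F. g i) = (\<Sum>(m, n)\<in>F. g (True, m, n) + g (False, m, n :: nat))"
proof -
  have "(\<Sum>i\<in>UNIV \<times> F. g i) = (\<Sum>b\<in>UNIV. \<Sum>j\<in>F. g (b, j))"
    by (simp add: sum.cartesian_product)
  also have "\<dots> = (\<Sum>j\<in>F. g (True, j)) + (\<Sum>j\<in>F. g (False, j))" by (simp add: UNIV_bool add.commute)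
  finally show ?thesis by (simp add: sum.distrib split_beta')
qed

text \<open>Reduces membership to Fourier coefficients: under the hypothesis the series for L v is
  termwise \<open>lam\<close> times the expansion of \<open>v\<close>.\<close>

lemma ker_LoI:
  assumes v: "Mo u T v" and eig: "\<And>b m n. n \<ge> 1 \<Longrightarrow> mu u p q m n * L2.cf v (b, m, n) = lam * L2.cf v (b, m, n)"
  shows "v \<in> ker_Lo u p q lam"
proof -
  have sv: "sqint M v" using v by (simp add: Mo_def sqint_M_iff)
  have F_BI: "UNIV \<times> F \<subseteq> BI" if "F \<subseteq> idx" for F using that by (auto simp: BI_def)
  have sq: "(mu u p q m n)\<^sup>2 * ((acoef u p q v m n)\<^sup>2 + (bcoef u p q v m n)\<^sup>2)
     = lam\<^sup>2 * ((L2.cf v (True, m, n))\<^sup>2 + (L2.cf v (False, m, n))\<^sup>2)" if "(m, n) \<in> idx" for m n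
  proof -
    have n: "n \<ge> 1" using that by (simp add: idx_def)
    have e: "(mu u p q m n)\<^sup>2 * (L2.cf v (b, m, n))\<^sup>2 = lam\<^sup>2 * (L2.cf v (b, m, n))\<^sup>2" for b
      by (simp only: power_mult_distrib[symmetric] eig[OF n])
    show ?thesis by (simp only: acoef_eq[OF sv] bcoef_eq[OF sv] distrib_left e)
  qed
  have DL: "inDL u p q v"
    unfolding inDL_def
  proof
    show "L2u u T v" using sv by (simp add: sqint_M_iff)
    show "(\<lambda>(m, n). (mu u p q m n)\<^sup>2 * ((acoef u p q v m n)\<^sup>2 + (bcoef u p q v m n)\<^sup>2)) summable_on idx"
    proof (rule nonneg_bounded_partial_sums_imp_summable_on)
      show "\<forall>\<^sub>F F in finite_subsets_at_top idx. (\<Sum>(m, n)\<in>F. (mu u p q m n)\<^sup>2 * ((acoef u p q v m n)\<^sup>2 + (bcoef u p q v m n)\<^sup>2))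
         \<le> lam\<^sup>2 * (LINT z|M. (v z)\<^sup>2)"
      proof (rule eventually_finite_subsets_at_top_weakI)
        fix F assume F: "finite F" "F \<subseteq> idx"
        have "(\<Sum>(m, n)\<in>F. (mu u p q m n)\<^sup>2 * ((acoef u p q v m n)\<^sup>2 + (bcoef u p q v m n)\<^sup>2))
          = (\<Sum>(m, n)\<in>F. lam\<^sup>2 * ((L2.cf v (True, m, n))\<^sup>2 + (L2.cf v (False, m, n))\<^sup>2))"
          using F(2) by (intro sum.cong refl) (use sq in auto)
        also have "\<dots> = lam\<^sup>2 * (\<Sum>i\<in>UNIV \<times> F. (L2.cf v i)\<^sup>2)"
          unfolding sum_bool_times[OF F(1)] by (simp add: sum_distrib_left split_beta')
        also have "\<dots> \<le> lam\<^sup>2 * (LINT z|M. (v z)\<^sup>2)"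
          using L2.bessel_identity[OF sv _ F_BI[OF F(2)]] F(1)
            L2.integral_square_nonneg[of "\<lambda>x. v x - (\<Sum>i\<in>UNIV \<times> F. L2.cf v i * basis i x)"]
          by (intro mult_left_mono) auto
        finally show "(\<Sum>(m, n)\<in>F. (mu u p q m n)\<^sup>2 * ((acoef u p q v m n)\<^sup>2 + (bcoef u p q v m n)\<^sup>2))
         \<le> lam\<^sup>2 * (LINT z|M. (v z)\<^sup>2)" .
      qed
    qed auto
  qed
  \<comment> \<open>\<open>L_eq\<close> takes cosine and sine of an index pair together, the
    expansion of \<open>v\<close> takes them separately; the sets \<open>UNIV \<times> F\<close> are
    cofinal among the finite subsets of \<open>BI\<close>.\<close>
  have lim: "filterlim (\<lambda>F. UNIV \<times> F) (finite_subsets_at_top BI) (finite_subsets_at_top idx)"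
    unfolding filterlim_iff
  proof (intro allI impI)
    fix P :: "(bool \<times> nat \<times> nat) set \<Rightarrow> bool"
    assume "eventually P (finite_subsets_at_top BI)"
    then obtain X where X: "finite X" "X \<subseteq> BI" "\<And>Y. finite Y \<Longrightarrow> X \<subseteq> Y \<Longrightarrow> Y \<subseteq> BI \<Longrightarrow> P Y"
      unfolding eventually_finite_subsets_at_top by metis
    have "P (UNIV \<times> Y)" if "finite Y" "snd ` X \<subseteq> Y" "Y \<subseteq> idx" for Y
      using that by (intro X(3) F_BI) force+
    moreover have "finite (snd ` X)" "snd ` X \<subseteq> idx" using X(1,2) by (auto simp: BI_def)
    ultimately show "\<forall>\<^sub>F F in finite_subsets_at_top idx. P (UNIV \<times> F)"
      unfolding eventually_finite_subsets_at_top by blast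
  qed
  have tends: "((\<lambda>F. lam\<^sup>2 * (LINT z|M. (v z - (\<Sum>i\<in>UNIV \<times> F. L2.cf v i * basis i z))\<^sup>2)) \<longlongrightarrow> lam\<^sup>2 * 0)
     (finite_subsets_at_top idx)"
    by (intro tendsto_mult tendsto_const filterlim_compose[OF L2.expansion_tendsto[OF sv] lim])
  have eqF: "lam\<^sup>2 * (LINT z|M. (v z - (\<Sum>i\<in>UNIV \<times> F. L2.cf v i * basis i z))\<^sup>2)
     = (LINT z:\<Omega>|lebesgue. u (snd z) * (lam * v z - (\<Sum>(m, n)\<in>F. mu u p q m n *
            (acoef u p q v m n * ecos u p q m n z + bcoef u p q v m n * esin u p q m n z)))\<^sup>2)"
    if F: "finite F" "F \<subseteq> idx" for F
  proof -
    have S: "lam * (\<Sum>i\<in>UNIV \<times> F. L2.cf v i * basis i z) = (\<Sum>(m, n)\<in>F. mu u p q m n *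
            (acoef u p q v m n * ecos u p q m n z + bcoef u p q v m n * esin u p q m n z))" for z
    proof -
      have "lam * (\<Sum>i\<in>UNIV \<times> F. L2.cf v i * basis i z)
        = (\<Sum>(m, n)\<in>F. lam * L2.cf v (True, m, n) * ecos u p q m n z + lam * L2.cf v (False, m, n) * esin u p q m n z)"
        unfolding sum_bool_times[OF F(1)]
        by (simp add: sum_distrib_left split_beta' basis_def distrib_left mult.assoc)
      also have "\<dots> = (\<Sum>(m, n)\<in>F. mu u p q m n *
            (acoef u p q v m n * ecos u p q m n z + bcoef u p q v m n * esin u p q m n z))"
      proof (intro sum.cong refl, clarify)
        fix m n assume "(m, n) \<in> F"
        then have n: "n \<ge> 1" using F(2) by (auto simp: idx_def)
        show "lam * L2.cf v (True, m, n) * ecos u p q m n z + lam * L2.cf v (False, m, n) * esin u p q m n z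
          = mu u p q m n * (acoef u p q v m n * ecos u p q m n z + bcoef u p q v m n * esin u p q m n z)"
          unfolding eig[OF n, symmetric] acoef_eq[OF sv] bcoef_eq[OF sv] by (simp add: algebra_simps)
      qed
      finally show ?thesis .
    qed
    have sS: "sqint M (\<lambda>z. \<Sum>i\<in>UNIV \<times> F. L2.cf v i * basis i z)"
      by (intro sqint_sum sqint_basis) (use F(1) in auto)
    have "lam\<^sup>2 * (LINT z|M. (v z - (\<Sum>i\<in>UNIV \<times> F. L2.cf v i * basis i z))\<^sup>2)
      = (LINT z|M. (lam * v z - lam * (\<Sum>i\<in>UNIV \<times> F. L2.cf v i * basis i z))\<^sup>2)"
      unfolding right_diff_distrib[symmetric] power_mult_distrib by simp
    also have "\<dots> = (LINT z:\<Omega>|lebesgue. u (snd z) * (lam * v z - lam * (\<Sum>i\<in>UNIV \<times> F. L2.cf v i * basis i z))\<^sup>2)"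
      by (intro integral_M borel_measurable_power borel_measurable_diff borel_measurable_times borel_measurable_const
          sqint_measurable[OF sv] sqint_measurable[OF sS])
    finally show ?thesis unfolding S .
  qed
  have "L_eq u p q v (\<lambda>z. lam * v z)"
    unfolding L_eq_def
  proof (rule Lim_transform_eventually)
    show "((\<lambda>F. lam\<^sup>2 * (LINT z|M. (v z - (\<Sum>i\<in>UNIV \<times> F. L2.cf v i * basis i z))\<^sup>2)) \<longlongrightarrow> 0) (finite_subsets_at_top idx)"
      using tends by simp
    show "\<forall>\<^sub>F F in finite_subsets_at_top idx. lam\<^sup>2 * (LINT z|M. (v z - (\<Sum>i\<in>UNIV \<times> F. L2.cf v i * basis i z))\<^sup>2)
     = (LINT z:\<Omega>|lebesgue. u (snd z) * (lam * v z - (\<Sum>(m, n)\<in>F. mu u p q m n *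
            (acoef u p q v m n * ecos u p q m n z + bcoef u p q v m n * esin u p q m n z)))\<^sup>2)"
      by (rule eventually_finite_subsets_at_top_weakI) (rule eqF)
  qed
  then show ?thesis using DL v by (simp add: ker_Lo_def)
qed

section \<open>Fourier coefficients from the weak equation\<close>

lemma sqint_tensor:
  assumes "continuous_on {0..pi} G"
  shows "sqint M (\<lambda>z. G (snd z) * trig w b m (fst z))"
proof -
  obtain C where C: "\<forall>x\<in>{0..pi}. \<bar>G x\<bar> \<le> C"
    using compact_imp_bounded[OF compact_continuous_image[OF assms compact_Icc]] by (auto simp: bounded_iff)
  show ?thesis
  proof (rule sqint_bounded)
    have "continuous_on \<Omega> (\<lambda>z. G (snd z) * trig w b m (fst z))"
      by (intro continuous_intros continuous_on_compose2[OF assms] continuous_on_compose2[OF trig_continuous[of UNIV]])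
         (auto dest: space_Omega)
    then show "(\<lambda>z. G (snd z) * trig w b m (fst z)) \<in> borel_measurable M"
      unfolding measurable_M by (rule continuous_on_Omega_measurable)
    fix z assume "z \<in> \<Omega>"
    then have "\<bar>G (snd z)\<bar> \<le> C" using C space_Omega by blast
    then have "\<bar>G (snd z)\<bar> * \<bar>trig w b m (fst z)\<bar> \<le> C * 1" using abs_trig_le by (intro mult_mono) auto
    then show "\<bar>G (snd z) * trig w b m (fst z)\<bar> \<le> C" by (simp add: abs_mult)
  qed
qed

lemma integral_tensor_close:
  assumes y: "sqint M y" and G: "continuous_on {0..pi} G" and H: "continuous_on {0..pi} H"
    and d: "\<And>x. x \<in> {0..pi} \<Longrightarrow> \<bar>G x - H x\<bar> \<le> \<delta>"
  shows "\<bar>(LINT z|M. y z * (G (snd z) * trig w b m (fst z))) - (LINT z|M. y z * (H (snd z) * trig w b m (fst z)))\<bar>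
     \<le> \<delta> * (LINT z|M. \<bar>y z\<bar>)"
proof -
  have sq1: "sqint M (\<lambda>_. 1)" using L2.finite_measure_axioms by (simp add: sqint_def finite_measure.integrable_const)
  have iy: "integrable M y" using sqint_mult[OF y sq1] by simp
  note iG = sqint_mult[OF y sqint_tensor[OF G, of b m]] and iH = sqint_mult[OF y sqint_tensor[OF H, of b m]]
  have eq: "(LINT z|M. y z * (G (snd z) * trig w b m (fst z))) - (LINT z|M. y z * (H (snd z) * trig w b m (fst z)))
    = (LINT z|M. y z * (G (snd z) * trig w b m (fst z)) - y z * (H (snd z) * trig w b m (fst z)))"
    using iG iH by simp
  have "\<bar>(LINT z|M. y z * (G (snd z) * trig w b m (fst z))) - (LINT z|M. y z * (H (snd z) * trig w b m (fst z)))\<bar>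
     \<le> (LINT z|M. \<bar>y z * (G (snd z) * trig w b m (fst z)) - y z * (H (snd z) * trig w b m (fst z))\<bar>)"
    unfolding eq by (rule integral_abs_bound)
  also have "\<dots> \<le> (LINT z|M. \<delta> * \<bar>y z\<bar>)"
  proof (rule integral_mono_AE)
    have "\<bar>y z * (G (snd z) * trig w b m (fst z)) - y z * (H (snd z) * trig w b m (fst z))\<bar> \<le> \<delta> * \<bar>y z\<bar>"
      if "z \<in> \<Omega>" for z
    proof -
      have gh: "\<bar>G (snd z) - H (snd z)\<bar> \<le> \<delta>" by (rule d[OF conjunct2[OF space_Omega[OF that]]])
      then have "0 \<le> \<delta>" by linarith
      then have "\<bar>G (snd z) - H (snd z)\<bar> * \<bar>trig w b m (fst z)\<bar> \<le> \<delta> * 1"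
        by (intro mult_mono gh abs_trig_le abs_ge_zero)
      then have "\<bar>y z\<bar> * (\<bar>G (snd z) - H (snd z)\<bar> * \<bar>trig w b m (fst z)\<bar>) \<le> \<bar>y z\<bar> * (\<delta> * 1)"
        by (rule mult_left_mono) (rule abs_ge_zero)
      also have "\<bar>y z\<bar> * (\<bar>G (snd z) - H (snd z)\<bar> * \<bar>trig w b m (fst z)\<bar>)
        = \<bar>y z * (G (snd z) * trig w b m (fst z)) - y z * (H (snd z) * trig w b m (fst z))\<bar>"
        by (simp only: abs_mult[symmetric] left_diff_distrib right_diff_distrib)
      finally show ?thesis by (simp only: mult_1_right mult.commute[of \<delta>])
    qed
    then show "AE z in M. \<bar>y z * (G (snd z) * trig w b m (fst z)) - y z * (H (snd z) * trig w b m (fst z))\<bar> \<le> \<delta> * \<bar>y z\<bar>"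
      unfolding AE_M by (intro AE_I2 impI)
    show "integrable M (\<lambda>z. \<bar>y z * (G (snd z) * trig w b m (fst z)) - y z * (H (snd z) * trig w b m (fst z))\<bar>)"
      by (intro integrable_abs Bochner_Integration.integrable_diff iG iH)
    show "integrable M (\<lambda>z. \<delta> * \<bar>y z\<bar>)" by (intro integrable_mult_right integrable_abs iy)
  qed
  also have "\<dots> = \<delta> * (LINT z|M. \<bar>y z\<bar>)" by simp
  finally show ?thesis .
qed

text \<open>The weak formulation extends from smooth test functions to \<open>\<phi>\<^sub>n\<close> times a trigonometric
  function by \<open>C\<^sup>2\<close> approximation, and there it reads off the Fourier coefficients.\<close>
lemma weak_coefficient:
  assumes u1: "\<And>x. x \<in> {0..pi} \<Longrightarrow> (u has_real_derivative u1 x) (at x within {0..pi})"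
    and cu1: "continuous_on {0..pi} u1"
    and y: "sqint M y" and v: "sqint M v"
    and weak: "\<And>psi. test_fn T psi \<Longrightarrow>
      (LINT z:\<Omega>|lebesgue. y z * Aop u psi z) = (LINT z:\<Omega>|lebesgue. u (snd z) * (v z * psi z))"
  shows "L2.cf v (b, m, n) = mu u p q m n * L2.cf y (b, m, n)"
proof -
  define ph la s where "ph = phi u n" and "la = lam2 u n" and "s = w * real m"
  have e: "sl_eigfun u la ph" unfolding ph_def la_def by (rule phi_eigfun)
  have "\<exists>f1. (\<forall>x\<in>{0..pi}. (ph has_real_derivative f1 x) (at x within {0..pi})
        \<and> ((\<lambda>s. u s * f1 s) has_real_derivative (- la * u x * ph x)) (at x within {0..pi}))"
    using e unfolding sl_eigfun_def by blast
  then obtain f1 where f1: "\<forall>x\<in>{0..pi}. (ph has_real_derivative f1 x) (at x within {0..pi})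
        \<and> ((\<lambda>s. u s * f1 s) has_real_derivative (- la * u x * ph x)) (at x within {0..pi})" by blast
  note d1 = conjunct1[OF bspec[OF f1]] and d2 = conjunct2[OF bspec[OF f1]]
  have cph: "continuous_on {0..pi} ph" by (rule DERIV_continuous_on[OF d1])
  have cf1: "continuous_on {0..pi} f1"
  proof -
    have "continuous_on {0..pi} (\<lambda>s. (u s * f1 s) / u s)"
      using nz_u by (intro continuous_intros DERIV_continuous_on[OF d2] cont_u) auto
    then show ?thesis by (rule continuous_on_eq) (use nz_u in auto)
  qed
  \<comment> \<open>The second derivative, solved from u' ph' + u ph'' = - la u ph.\<close>
  define f2 where "f2 = (\<lambda>x. (- la * u x * ph x - u1 x * f1 x) / u x)"
  have d3: "(f1 has_real_derivative f2 x) (at x within {0..pi})" if x: "x \<in> {0..pi}" for x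
  proof -
    have "((\<lambda>s. (u s * f1 s) / u s) has_real_derivative
        ((- la * u x * ph x) * u x - (u x * f1 x) * u1 x) / (u x * u x)) (at x within {0..pi})"
      by (intro DERIV_divide d2 u1 nz_u x)
    then have "(f1 has_real_derivative ((- la * u x * ph x) * u x - (u x * f1 x) * u1 x) / (u x * u x)) (at x within {0..pi})"
      by (rule has_field_derivative_transform_within[OF _ zero_less_one x]) (use nz_u in simp)
    also have "((- la * u x * ph x) * u x - (u x * f1 x) * u1 x) / (u x * u x) = f2 x"
      using nz_u[OF x] by (simp add: f2_def field_simps)
    finally show ?thesis .
  qed
  have cf2: "continuous_on {0..pi} f2"
    unfolding f2_def using nz_u by (intro continuous_intros cont_u cph cu1 cf1) auto
  \<comment> \<open>For \<open>g\<close> with derivatives \<open>g1\<close> and \<open>g2\<close>, u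
    times \<open>D\<close> times the trigonometric factor is what \<open>Aop\<close> makes of the
    product of \<open>g\<close> with that factor. On \<open>ph\<close> it is multiplication by la -
    s^2, which is \<open>mu u p q m n\<close>.\<close>
  define D where "D = (\<lambda>(g, g1, g2) x. - (g x * s\<^sup>2 + u1 x / u x * g1 x + g2 x))"
  have D0: "D (ph, f1, f2) x = (la - s\<^sup>2) * ph x" if "x \<in> {0..pi}" for x
    using nz_u[OF that] by (simp add: D_def f2_def field_simps)
  have cD: "continuous_on {0..pi} (D (g, g1, g2))"
    if "continuous_on {0..pi} g" "continuous_on {0..pi} g1" "continuous_on {0..pi} g2" for g g1 g2
    unfolding D_def split_conv using nz_u by (intro continuous_intros that cu1 cont_u) auto
  obtain C where C: "\<forall>x\<in>{0..pi}. \<bar>u1 x / u x\<bar> \<le> C"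
  proof -
    have "continuous_on {0..pi} (\<lambda>x. u1 x / u x)" using nz_u by (intro continuous_intros cu1 cont_u) auto
    from compact_imp_bounded[OF compact_continuous_image[OF this compact_Icc]] show ?thesis
      using that by (auto simp: bounded_iff)
  qed
  have C0: "C \<ge> 0" by (rule order.trans[OF abs_ge_zero bspec[OF C, of 0]]) simp
  define Y V where "Y = (LINT z|M. y z * (D (ph, f1, f2) (snd z) * trig w b m (fst z)))"
    and "V = (LINT z|M. v z * (ph (snd z) * trig w b m (fst z)))"
  \<comment> \<open>Collects the errors of the approximation: on the side of \<open>y\<close> those
    of the value, weighted by s^2, of the first derivative, weighted by C, and of the second; on the
    side of \<open>v\<close> that of the value.\<close>
  define K1 where "K1 = (pi * pi * s\<^sup>2 + C * pi + 1) * (LINT z|M. \<bar>y z\<bar>) + pi * pi * (LINT z|M. \<bar>v z\<bar>)"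
  have K1: "K1 \<ge> 0" unfolding K1_def using C0
    by (intro add_nonneg_nonneg mult_nonneg_nonneg integral_nonneg_AE) auto
  have close: "\<bar>Y - V\<bar> \<le> \<epsilon> * K1" if eps: "\<epsilon> > 0" for \<epsilon>
  proof -
    have z: "ph 0 = 0" "ph pi = 0" using eigfun_boundary[OF e] by auto
    obtain P :: "real poly" where P: "poly P 0 = 0" "poly P pi = 0"
      "\<And>x. x \<in> {0..pi} \<Longrightarrow> \<bar>ph x - poly P x\<bar> \<le> \<epsilon> * pi * pi"
      "\<And>x. x \<in> {0..pi} \<Longrightarrow> \<bar>f1 x - poly (pderiv P) x\<bar> \<le> \<epsilon> * pi"
      "\<And>x. x \<in> {0..pi} \<Longrightarrow> \<bar>f2 x - poly (pderiv (pderiv P)) x\<bar> \<le> \<epsilon>"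
      using poly_dense_C2[OF pi_gt_zero d1 d3 cf2 z eps] by metis
    define DP where "DP = D (poly P, poly (pderiv P), poly (pderiv (pderiv P)))"
    have cP: "continuous_on {0..pi} (poly R)" for R :: "real poly" by (intro continuous_intros)
    have cDP: "continuous_on {0..pi} DP" unfolding DP_def by (intro cD cP)
    have "\<bar>D (ph, f1, f2) x - DP x\<bar> \<le> \<epsilon> * (pi * pi * s\<^sup>2 + C * pi + 1)" if x: "x \<in> {0..pi}" for x
    proof -
      have "D (ph, f1, f2) x - DP x = - ((ph x - poly P x) * s\<^sup>2) - u1 x / u x * (f1 x - poly (pderiv P) x)
         - (f2 x - poly (pderiv (pderiv P)) x)"
        by (simp add: D_def DP_def algebra_simps)
      moreover have "\<bar>(ph x - poly P x) * s\<^sup>2\<bar> \<le> \<epsilon> * pi * pi * s\<^sup>2"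
        unfolding abs_mult using P(3)[OF x] by (simp add: mult_right_mono)
      moreover have "\<bar>u1 x / u x * (f1 x - poly (pderiv P) x)\<bar> \<le> C * (\<epsilon> * pi)"
        unfolding abs_mult[of "u1 x / u x"] using C x P(4)[OF x] C0 by (intro mult_mono) auto
      ultimately have "\<bar>D (ph, f1, f2) x - DP x\<bar> \<le> \<epsilon> * pi * pi * s\<^sup>2 + C * (\<epsilon> * pi) + \<epsilon>"
        using P(5)[OF x] by linarith
      then show ?thesis by (simp add: algebra_simps)
    qed
    then have 1: "\<bar>Y - (LINT z|M. y z * (DP (snd z) * trig w b m (fst z)))\<bar>
        \<le> \<epsilon> * (pi * pi * s\<^sup>2 + C * pi + 1) * (LINT z|M. \<bar>y z\<bar>)"
      unfolding Y_def by (intro integral_tensor_close[OF y] cD cph cf1 cf2 cDP)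
    have 2: "\<bar>V - (LINT z|M. v z * (poly P (snd z) * trig w b m (fst z)))\<bar> \<le> \<epsilon> * pi * pi * (LINT z|M. \<bar>v z\<bar>)"
      unfolding V_def by (intro integral_tensor_close[OF v] cph cP P(3))
    define psi where "psi = (\<lambda>z. poly P (snd z) * trig w b m (fst z))"
    have my: "(\<lambda>z. y z * (DP (snd z) * trig w b m (fst z))) \<in> borel_measurable M"
      by (intro borel_measurable_times sqint_measurable[OF y] sqint_measurable[OF sqint_tensor[OF cDP]])
    have mv: "(\<lambda>z. v z * psi z) \<in> borel_measurable M"
      unfolding psi_def by (intro borel_measurable_times sqint_measurable[OF v] sqint_measurable[OF sqint_tensor[OF cP]])
    have A: "y z * Aop u psi z = u (snd z) * (y z * (DP (snd z) * trig w b m (fst z)))" if "z \<in> \<Omega>" for z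
    proof -
      obtain t x where z: "z = (t, x)" by (cases z)
      have x: "0 < x" "x < pi" "x \<in> {0..pi}" using that by (auto simp: z Omega_def)
      \<comment> \<open>\<open>Aop\<close> is built from two-sided derivatives, which
        \<open>u1\<close> provides at interior points.\<close>
      have "(u has_real_derivative u1 x) (at x)" using u1[OF x(3)] at_within_Icc_at[of 0 x pi] x by simp
      then have "Aop u psi (t, x) = - (u x * poly P x * s\<^sup>2 + u1 x * poly (pderiv P) x
           + u x * poly (pderiv (pderiv P)) x) * trig w b m t"
        unfolding psi_def s_def by (rule Aop_poly_trig[OF x(1,2)])
      also have "- (u x * poly P x * s\<^sup>2 + u1 x * poly (pderiv P) x + u x * poly (pderiv (pderiv P)) x) = u x * DP x"
        using nz_u[OF x(3)] by (simp add: DP_def D_def distrib_left right_diff_distrib)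
      finally show ?thesis by (simp add: z)
    qed
    have "(LINT z|M. y z * (DP (snd z) * trig w b m (fst z)))
       = (LINT z:\<Omega>|lebesgue. u (snd z) * (y z * (DP (snd z) * trig w b m (fst z))))"
      by (rule integral_M[OF my])
    also have "\<dots> = (LINT z:\<Omega>|lebesgue. y z * Aop u psi z)"
      unfolding set_lebesgue_integral_def
    proof (rule Bochner_Integration.integral_cong[OF refl])
      show "indicator \<Omega> z *\<^sub>R (u (snd z) * (y z * (DP (snd z) * trig w b m (fst z))))
         = indicator \<Omega> z *\<^sub>R (y z * Aop u psi z)" for z
        by (cases "z \<in> \<Omega>") (simp_all only: A indicator_simps scaleR_zero_left simp_thms)
    qed
    also have "\<dots> = (LINT z:\<Omega>|lebesgue. u (snd z) * (v z * psi z))"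
      unfolding psi_def by (rule weak) (rule poly_trig_test_fn[OF w_pos T_eq P(1,2)])
    also have "\<dots> = (LINT z|M. v z * psi z)" by (rule integral_M[OF mv, symmetric])
    finally have "(LINT z|M. y z * (DP (snd z) * trig w b m (fst z))) = (LINT z|M. v z * (poly P (snd z) * trig w b m (fst z)))"
      by (simp add: psi_def)
    then have "\<bar>Y - V\<bar> \<le> \<epsilon> * (pi * pi * s\<^sup>2 + C * pi + 1) * (LINT z|M. \<bar>y z\<bar>) + \<epsilon> * pi * pi * (LINT z|M. \<bar>v z\<bar>)"
      using 1 2 by linarith
    then show ?thesis by (simp add: K1_def algebra_simps)
  qed
  have "\<bar>Y - V\<bar> \<le> 0 + \<epsilon>" if "\<epsilon> > 0" for \<epsilon>
  proof -
    have "\<bar>Y - V\<bar> \<le> \<epsilon> / (K1 + 1) * K1" using that K1 by (intro close) simp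
    also have "\<dots> \<le> \<epsilon>" using that K1 by (simp add: field_simps)
    finally show ?thesis by simp
  qed
  then have "\<bar>Y - V\<bar> \<le> 0" by (rule field_le_epsilon)
  then have YV: "Y = V" by simp
  have "Y = (LINT z|M. (la - s\<^sup>2) * (y z * (ph (snd z) * trig w b m (fst z))))"
    unfolding Y_def
  proof (rule integral_cong_AE)
    show "AE z in M. y z * (D (ph, f1, f2) (snd z) * trig w b m (fst z)) = (la - s\<^sup>2) * (y z * (ph (snd z) * trig w b m (fst z)))"
      unfolding AE_M using D0 space_Omega by (intro AE_I2) auto
  qed (intro borel_measurable_times borel_measurable_const sqint_measurable[OF y]
       sqint_measurable[OF sqint_tensor] cD cph cf1 cf2)+
  then have Y: "Y = mu u p q m n * (LINT z|M. y z * (ph (snd z) * trig w b m (fst z)))"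
    by (simp add: mu_def la_def s_def)
  have cf: "L2.cf f (b, m, n) = Tm T m * (LINT z|M. f z * (ph (snd z) * trig w b m (fst z)))" for f
    unfolding L2.cf_def basis_eq ph_def integral_mult_right_zero[symmetric] by (simp only: mult_ac)
  show ?thesis unfolding cf using YV Y V_def by simp
qed

end

section \<open>Uniqueness\<close>

text \<open>A strict violation would persist on a ball, which contains a rational. Needed because
  bounds valid almost everywhere for each single argument can be joined only for countably many
  arguments.\<close>

lemma le_on_reals_if_le_on_rationals:
  fixes g h :: "real \<Rightarrow> real"
  assumes g: "continuous_on UNIV g" and h: "continuous_on UNIV h" and le: "\<And>r. r \<in> \<rat> \<Longrightarrow> g r \<le> h r"
  shows "g x \<le> h x"
proof (rule ccontr)
  assume "\<not> g x \<le> h x"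
  define U where "U = {x. h x < g x}"
  have "open U" unfolding U_def by (rule open_Collect_less[OF h g])
  moreover have "x \<in> U" using \<open>\<not> g x \<le> h x\<close> by (simp add: U_def)
  ultimately obtain e where e: "e > 0" "ball x e \<subseteq> U" by (meson open_contains_ball)
  obtain r where r: "r \<in> \<rat>" "x < r" "r < x + e" using Rats_dense_in_real[of x "x + e"] e(1) by auto
  then have "r \<in> ball x e" by (simp add: dist_real_def)
  then have "h r < g r" using e(2) by (auto simp: U_def)
  then show False using le[OF r(1)] by simp
qed

lemma periodic_int_shift:
  fixes f :: "real \<Rightarrow> 'a"
  assumes "\<And>t. f (t + T) = f t"
  shows "f (t + T * of_int k) = f t"
proof (induction k rule: int_induct[of _ 0])
  case base then show ?case by simp
next
  case (step1 i)
  have "f (t + T * of_int (i + 1)) = f ((t + T * of_int i) + T)" by (simp add: algebra_simps)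
  then show ?case using assms step1 by simp
next
  case (step2 i)
  have "f (t + T * of_int i) = f ((t + T * of_int (i - 1)) + T)" by (simp add: algebra_simps)
  then show ?case using assms step2 by simp
qed

lemma C2_on_continuous_derivative:
  assumes "C2_on S u"
  obtains u1 where "\<And>x. x \<in> S \<Longrightarrow> (u has_real_derivative u1 x) (at x within S)" "continuous_on S u1"
proof -
  obtain u1 u2 where d: "\<forall>x\<in>S. (u has_real_derivative u1 x) (at x within S)
            \<and> (u1 has_real_derivative u2 x) (at x within S)"
    using assms unfolding C2_on_def by blast
  have "continuous_on S u1" by (rule DERIV_continuous_on) (rule conjunct2[OF bspec[OF d]])
  then show ?thesis using that[of u1] d by blast
qed

text \<open>Turns the nonlinearity into a pointwise linear factor; where \<open>y\<close> is zero
  any factor works and \<open>a\<close> is taken.\<close>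

lemma slope_exists:
  fixes v y :: real
  assumes "a * y\<^sup>2 \<le> v * y" "v * y \<le> b * y\<^sup>2" "y = 0 \<Longrightarrow> v = 0" "a \<le> b"
  obtains c where "a \<le> c" "c \<le> b" "v = c * y"
proof (cases "y = 0")
  case True then show ?thesis using that[of a] assms by simp
next
  case False
  then have "y\<^sup>2 > 0" by simp
  have e: "v * y = (v / y) * y\<^sup>2" using False by (simp add: power2_eq_square)
  have "a \<le> v / y" "v / y \<le> b"
    using assms(1,2) unfolding e mult_le_cancel_right_pos[OF \<open>y\<^sup>2 > 0\<close>] by simp_all
  then show ?thesis using that[of "v / y"] False by simp
qed

theorem theorem4p2:
  fixes u :: "real \<Rightarrow> real" and p q :: nat and f :: "real \<Rightarrow> real \<Rightarrow> real \<Rightarrow> real"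
    and \<alpha> \<beta> :: "real \<times> real \<Rightarrow> real" and ll lh :: real
  assumes u_C2: "C2_on {0..pi} u" and u_pos: "\<forall>x\<in>{0..pi}. u x > 0"
    and pq: "p > 0" "q > 0" "coprime p q" "even p"
    and f_cont: "continuous_on (Omega (Tper p q) \<times> UNIV) (\<lambda>(z, y). f (fst z) (snd z) y)"
    and f_per: "\<forall>t x y. f (t + Tper p q) x y = f t x y"
    and f_bound: "\<forall>R>0. \<exists>h. L2u u (Tper p q) h \<and>
        (AE z in lebesgue. z \<in> Omega (Tper p q) \<longrightarrow>
           (\<forall>y. \<bar>y\<bar> \<le> R \<longrightarrow> \<bar>f (fst z) (snd z) y / u (snd z)\<bar> \<le> h z))"
    and consec: "ll \<in> Lambda_Lo u p q" "lh \<in> Lambda_Lo u p q" "ll < lh"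
        "\<not> (\<exists>\<nu>\<in>Lambda_Lo u p q. ll < \<nu> \<and> \<nu> < lh)"
    and ab: "Me u (Tper p q) \<alpha>" "Linf (Tper p q) \<alpha>" "Me u (Tper p q) \<beta>" "Linf (Tper p q) \<beta>"
    and ab_bounds: "AE z in lebesgue. z \<in> Omega (Tper p q) \<longrightarrow>
        ll \<le> \<alpha> z \<and> \<alpha> z \<le> \<beta> z \<and> \<beta> z \<le> lh"
    and nonres_low: "\<forall>v\<in>ker_Lo u p q ll. \<not> ae_zero (Tper p q) v \<longrightarrow>
        (LINT z:Omega (Tper p q)|lebesgue. (\<alpha> z - ll) * (v z)\<^sup>2) > 0"
    and nonres_high: "\<forall>w\<in>ker_Lo u p q lh. \<not> ae_zero (Tper p q) w \<longrightarrow>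
        (LINT z:Omega (Tper p q)|lebesgue. (lh - \<beta> z) * (w z)\<^sup>2) > 0"
    and f_shift: "\<forall>t x y. x \<in> {0<..<pi} \<longrightarrow>
        f (t + Tper p q / 2) x y / u x = f t x y / u x"
    and f_odd: "\<forall>t x y. x \<in> {0<..<pi} \<longrightarrow> f t x (- y) / u x = - (f t x y / u x)"
    and f_quot: "\<forall>y z. y \<noteq> z \<longrightarrow> (AE w in lebesgue. w \<in> Omega (Tper p q) \<longrightarrow>
        \<alpha> w \<le> (f (fst w) (snd w) y / u (snd w) - f (fst w) (snd w) z / u (snd w)) / (y - z)
      \<and> (f (fst w) (snd w) y / u (snd w) - f (fst w) (snd w) z / u (snd w)) / (y - z) \<le> \<beta> w)"
  shows "weak_sol u p q f (\<lambda>_. 0) \<and>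
    (\<forall>y. weak_sol u p q f y \<and> Mo u (Tper p q) y \<longrightarrow> ae_zero (Tper p q) y)"
proof -
  have cu: "continuous_on {0..pi} u"
  proof -
    obtain u1 where "\<And>x. x \<in> {0..pi} \<Longrightarrow> (u has_real_derivative u1 x) (at x within {0..pi})"
      using C2_on_continuous_derivative[OF u_C2] by metis
    then show ?thesis by (rule DERIV_continuous_on)
  qed
  interpret wave u p q
    by unfold_locales (use cu u_pos pq in auto)
  have upos: "u (snd z) > 0" if "z \<in> \<Omega>" for z using pos_u conjunct2[OF space_Omega[OF that]] by blast
  have in_pi: "snd z \<in> {0<..<pi}" if "z \<in> \<Omega>" for z using that by (auto simp: Omega_def)
  define fh where "fh = (\<lambda>z r. f (fst z) (snd z) r / u (snd z))"
  have fh_odd: "fh z (- r) = - fh z r" if "snd z \<in> {0<..<pi}" for z r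
    using f_odd that by (simp add: fh_def)
  \<comment> \<open>Oddness forces the value 0 at 0: zero is a solution, and comparison with the
    argument 0 yields slopes of \<open>fh\<close> itself.\<close>
  have fh0: "fh z 0 = 0" if "snd z \<in> {0<..<pi}" for z using fh_odd[OF that, of 0] by simp
  have f0: "f (fst z) (snd z) 0 = 0" if "z \<in> \<Omega>" for z
    using fh0[OF in_pi[OF that]] upos[OF that] by (simp add: fh_def)
  have weak0: "weak_sol u p q f (\<lambda>_. 0)"
  proof -
    have "L2u u T (\<lambda>_. 0)" by (simp add: L2u_def set_borel_measurable_def set_integrable_def)
    moreover have "(\<lambda>z. indicator \<Omega> z *\<^sub>R (f (fst z) (snd z) 0 * psi z)) = (\<lambda>z. 0)" for psi :: "real \<times> real \<Rightarrow> real"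
      using f0 by (auto simp: indicator_def fun_eq_iff)
    ultimately show ?thesis
      by (simp add: weak_sol_def set_integrable_def set_lebesgue_integral_def)
  qed
  have "ae_zero T y" if ws: "weak_sol u p q f y" and My: "Mo u T y" for y
  proof -
    have sy: "sqint M y" using My by (simp add: Mo_def sqint_M_iff)
    define v where "v = (\<lambda>z. fh z (y z))"
    \<comment> \<open>Rational r share one null set, and continuity in r covers the others. The
      bounds are multiplied by r^2 so that both sides are continuous and r = 0 is included.\<close>
    have slope: "AE z in lebesgue. z \<in> \<Omega> \<longrightarrow> (\<forall>r. \<alpha> z * r\<^sup>2 \<le> fh z r * r \<and> fh z r * r \<le> \<beta> z * r\<^sup>2)"
    proof -
      have "AE z in lebesgue. \<forall>r\<in>\<rat>. r \<noteq> 0 \<longrightarrow> z \<in> \<Omega> \<longrightarrow> \<alpha> z \<le> (fh z r - fh z 0) / (r - 0) \<and> (fh z r - fh z 0) / (r - 0) \<le> \<beta> z"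
        unfolding fh_def
        by (subst AE_ball_countable[OF countable_rat], intro ballI)
           (use f_quot in \<open>force intro: AE_I2\<close>)
      then show ?thesis
      proof eventually_elim
        case (elim z)
        show ?case
        proof (intro impI allI)
          fix r :: real assume z: "z \<in> \<Omega>"
          have cf: "continuous_on UNIV (\<lambda>r. fh z r)"
            unfolding fh_def
          proof (intro continuous_on_divide continuous_on_const)
            have "continuous_on UNIV (\<lambda>r. (\<lambda>(z, y). f (fst z) (snd z) y) (z, r))"
              by (rule continuous_on_compose2[OF f_cont]) (use z in \<open>auto intro!: continuous_intros\<close>)
            then show "continuous_on UNIV (\<lambda>r. f (fst z) (snd z) r)" by simp
          qed (use upos[OF z] in auto)
          have q: "\<alpha> z * r\<^sup>2 \<le> fh z r * r \<and> fh z r * r \<le> \<beta> z * r\<^sup>2" if "r \<in> \<rat>" for r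
          proof (cases "r = 0")
            case False
            then have b: "\<alpha> z \<le> fh z r / r" "fh z r / r \<le> \<beta> z"
              using elim that z fh0[OF in_pi[OF z]] by auto
            have e: "fh z r * r = fh z r / r * r\<^sup>2" using False by (simp add: power2_eq_square)
            show ?thesis unfolding e by (intro conjI mult_right_mono b zero_le_power2)
          qed simp
          show "\<alpha> z * r\<^sup>2 \<le> fh z r * r \<and> fh z r * r \<le> \<beta> z * r\<^sup>2"
          proof
            show "\<alpha> z * r\<^sup>2 \<le> fh z r * r"
              by (rule le_on_reals_if_le_on_rationals[of "\<lambda>r. \<alpha> z * r\<^sup>2" "\<lambda>r. fh z r * r"])
                 (use q in \<open>auto intro!: continuous_intros cf\<close>)
            show "fh z r * r \<le> \<beta> z * r\<^sup>2"
              by (rule le_on_reals_if_le_on_rationals[of "\<lambda>r. fh z r * r" "\<lambda>r. \<beta> z * r\<^sup>2"])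
                 (use q in \<open>auto intro!: continuous_intros cf\<close>)
          qed
        qed
      qed
    qed
    have cc: "AE z in lebesgue. z \<in> \<Omega> \<longrightarrow> (\<exists>c. ll \<le> \<alpha> z \<and> \<alpha> z \<le> c \<and> c \<le> \<beta> z \<and> \<beta> z \<le> lh \<and> v z = c * y z)"
      using slope ab_bounds
    proof eventually_elim
      case (elim z)
      show ?case
      proof
        assume z: "z \<in> \<Omega>"
        have "\<alpha> z * (y z)\<^sup>2 \<le> v z * y z" "v z * y z \<le> \<beta> z * (y z)\<^sup>2" using elim(1) z by (auto simp: v_def)
        moreover have "y z = 0 \<Longrightarrow> v z = 0" using fh0[OF in_pi[OF z]] by (simp add: v_def)
        moreover have b: "ll \<le> \<alpha> z" "\<alpha> z \<le> \<beta> z" "\<beta> z \<le> lh" using elim(2) z by auto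
        ultimately obtain c where "\<alpha> z \<le> c" "c \<le> \<beta> z" "v z = c * y z" using slope_exists by metis
        then show "\<exists>c. ll \<le> \<alpha> z \<and> \<alpha> z \<le> c \<and> c \<le> \<beta> z \<and> \<beta> z \<le> lh \<and> v z = c * y z" using b by blast
      qed
    qed
    have mv: "v \<in> borel_measurable M"
    proof -
      \<comment> \<open>Continuity of \<open>f\<close> is given over the rectangle only; its
        extension by zero is Borel on the whole space and can be composed with z \<mapsto> (z, y
        z).\<close>
      define F where "F = (\<lambda>x :: (real \<times> real) \<times> real. indicator (\<Omega> \<times> UNIV) x *\<^sub>R (case x of (z, y) \<Rightarrow> f (fst z) (snd z) y))"
      have "\<Omega> \<times> UNIV \<in> sets (borel :: ((real \<times> real) \<times> real) measure)"
        by (intro borel_open open_Times) (auto simp: Omega_def intro!: open_Times)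
      then have F: "F \<in> borel_measurable borel"
        unfolding F_def by (intro borel_measurable_continuous_on_indicator f_cont)
      have id: "(\<lambda>z. z) \<in> restrict_space lebesgue \<Omega> \<rightarrow>\<^sub>M (borel :: (real \<times> real) measure)"
        by (intro measurable_restrict_space1 measurable_completion) simp
      have "(\<lambda>z. (z, y z)) \<in> borel_measurable (restrict_space lebesgue \<Omega>)"
        using sqint_measurable[OF sy] by (intro borel_measurable_Pair id) (simp add: measurable_M)
      from measurable_compose[OF this F]
      have "(\<lambda>z. F (z, y z) / u (snd z)) \<in> borel_measurable (restrict_space lebesgue \<Omega>)"
        using u_measurable by (intro borel_measurable_divide)
      then show ?thesis unfolding measurable_M
        by (rule measurable_cong[THEN iffD1, rotated]) (simp add: space_restrict_space F_def v_def fh_def)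
    qed
    have sv: "sqint M v"
    proof -
      \<comment> \<open>Slopes between \<open>ll\<close> and \<open>lh\<close> make \<open>v\<close>
        grow at most linearly in \<open>y\<close>, which puts it into the weighted space.\<close>
      define C where "C = (\<bar>ll\<bar> + \<bar>lh\<bar>)\<^sup>2"
      have "integrable M (\<lambda>z. (v z)\<^sup>2)"
      proof (rule Bochner_Integration.integrable_bound)
        show "integrable M (\<lambda>z. C * (y z)\<^sup>2)" using sy by (simp add: sqint_def)
        show "(\<lambda>z. (v z)\<^sup>2) \<in> borel_measurable M" using mv by measurable
        show "AE z in M. norm ((v z)\<^sup>2) \<le> norm (C * (y z)\<^sup>2)"
          unfolding AE_M using cc
        proof eventually_elim
          case (elim z)
          show ?case
          proof
            assume "z \<in> \<Omega>"
            then obtain c where "ll \<le> \<alpha> z" "\<alpha> z \<le> c" "c \<le> \<beta> z" "\<beta> z \<le> lh" and c3: "v z = c * y z"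
            using elim by blast
          then have c: "ll \<le> c" "c \<le> lh" "v z = c * y z" by (linarith, linarith, simp)
            have "\<bar>c\<bar> \<le> \<bar>ll\<bar> + \<bar>lh\<bar>" using c(1,2) by linarith
            then have "c\<^sup>2 \<le> C" unfolding C_def by (metis abs_ge_zero power2_abs power_mono)
            then have "c\<^sup>2 * (y z)\<^sup>2 \<le> C * (y z)\<^sup>2" by (intro mult_right_mono) auto
            then show "norm ((v z)\<^sup>2) \<le> norm (C * (y z)\<^sup>2)" by (simp add: c(3) power_mult_distrib C_def)
          qed
        qed
      qed
      then show ?thesis using mv by (simp add: sqint_def)
    qed
    obtain u1 where u1: "\<And>x. x \<in> {0..pi} \<Longrightarrow> (u has_real_derivative u1 x) (at x within {0..pi})"
      and cu1: "continuous_on {0..pi} u1"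
      using C2_on_continuous_derivative[OF u_C2] by metis
    have weak: "(LINT z:\<Omega>|lebesgue. y z * Aop u psi z) = (LINT z:\<Omega>|lebesgue. u (snd z) * (v z * psi z))"
      if "test_fn T psi" for psi
    proof -
      have "(LINT z:\<Omega>|lebesgue. y z * Aop u psi z) = (LINT z:\<Omega>|lebesgue. f (fst z) (snd z) (y z) * psi z)"
        using ws that by (simp add: weak_sol_def)
      also have "\<dots> = (LINT z:\<Omega>|lebesgue. u (snd z) * (v z * psi z))"
        unfolding set_lebesgue_integral_def
      proof (rule Bochner_Integration.integral_cong[OF refl])
        show "indicator \<Omega> z *\<^sub>R (f (fst z) (snd z) (y z) * psi z) = indicator \<Omega> z *\<^sub>R (u (snd z) * (v z * psi z))" for z
          using upos[of z] by (cases "z \<in> \<Omega>") (simp_all add: v_def fh_def)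
      qed
      finally show ?thesis .
    qed
    have cfv: "L2.cf v (b, m, n) = mu u p q m n * L2.cf y (b, m, n)" for b m n
      by (rule weak_coefficient[OF u1 cu1 sy sv weak])
    define A where "A = (\<lambda>lam z. 1 * v z + (- lam) * y z)"
    have sA: "sqint M (A lam)" for lam unfolding A_def by (rule sqint_linear[OF sv sy])
    have cfA: "L2.cf (A lam) (b, m, n) = (mu u p q m n - lam) * L2.cf y (b, m, n)" if "n \<ge> 1" for lam b m n
      unfolding A_def using that
      by (subst L2.cf_linear[OF sv sy]) (auto simp: BI_def idx_def cfv algebra_simps)
    have tpos: "L2.cf (A ll) i * L2.cf (A lh) i \<ge> 0" if "i \<in> BI" for i
    proof -
      obtain b m n where i: "i = (b, m, n)" "n \<ge> 1" using \<open>i \<in> BI\<close> by (cases i) (auto simp: BI_def idx_def)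
      show ?thesis
      proof (cases "even m")
        case True
        then show ?thesis using Mo_even_coefficient_zero[OF My] by (simp add: i(1) cfA[OF i(2)])
      next
        case False
        then have "mu u p q m n \<in> Lambda_Lo u p q" using i(2) by (auto simp: Lambda_Lo_def)
        then have "mu u p q m n \<le> ll \<or> lh \<le> mu u p q m n" using consec(4) by force
        then have "0 \<le> (mu u p q m n - ll) * (mu u p q m n - lh)"
          using consec(3) by (auto intro: mult_nonpos_nonpos mult_nonneg_nonneg)
        then have "0 \<le> (mu u p q m n - ll) * (mu u p q m n - lh) * (L2.cf y i)\<^sup>2" by simp
        then show ?thesis by (simp add: i(1) cfA[OF i(2)] power2_eq_square mult_ac)
      qed
    qed
    have AB: "AE z in M. 0 \<le> - (A ll z * A lh z)"
      unfolding AE_M using cc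
    proof eventually_elim
      case (elim z)
      show ?case
      proof
        assume "z \<in> \<Omega>"
        then obtain c where "ll \<le> \<alpha> z" "\<alpha> z \<le> c" "c \<le> \<beta> z" "\<beta> z \<le> lh" and c3: "v z = c * y z"
            using elim by blast
          then have c: "ll \<le> c" "c \<le> lh" "v z = c * y z" by (linarith, linarith, simp)
        have "(c - ll) * (c - lh) \<le> 0" using c(1,2) by (intro mult_nonneg_nonpos) auto
        then have "(c - ll) * (c - lh) * (y z)\<^sup>2 \<le> 0" by (rule mult_nonpos_nonneg) simp
        then show "0 \<le> - (A ll z * A lh z)" by (simp add: A_def c(3) power2_eq_square algebra_simps)
      qed
    qed
    note par = L2.parseval[OF sA sA, of ll lh]
    have iAB: "integrable M (\<lambda>z. - (A ll z * A lh z))" using sqint_mult[OF sA sA] by simp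
    have "(LINT z|M. - (A ll z * A lh z)) \<ge> 0" by (rule integral_nonneg_AE[OF AB])
    moreover have "(LINT z|M. A ll z * A lh z) \<ge> 0" by (rule has_sum_nonneg[OF par tpos])
    ultimately have int0: "(LINT z|M. A ll z * A lh z) = 0" by simp
    then have "(LINT z|M. - (A ll z * A lh z)) = 0" by simp
    then have AB0: "AE z in M. - (A ll z * A lh z) = 0"
      using integral_nonneg_eq_0_iff_AE[OF iAB AB] by blast
    \<comment> \<open>A vanishing sum of nonnegative terms: \<open>y\<close> carries only modes with
      \<open>mu\<close> equal to \<open>ll\<close> or \<open>lh\<close>.\<close>
    have res: "(mu u p q m n - ll) * (mu u p q m n - lh) * L2.cf y (b, m, n) = 0" if n: "n \<ge> 1" for b m n
    proof -
      have i: "(b, m, n) \<in> BI" using n by (simp add: BI_def idx_def)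
      have "(\<Sum>i\<in>{(b, m, n)}. L2.cf (A ll) i * L2.cf (A lh) i) \<le> 0"
        using finite_sum_le_has_sum[OF par[unfolded int0], of "{(b, m, n)}"] tpos i by blast
      then have "L2.cf (A ll) (b, m, n) * L2.cf (A lh) (b, m, n) = 0" using tpos[OF i] by simp
      then show ?thesis by (auto simp: cfA[OF n])
    qed
    have Mo_A: "Mo u T (A lam)" for lam
      unfolding Mo_def
    proof
      show "L2u u T (A lam)" using sA by (simp add: sqint_M_iff)
      have "AE z in lebesgue. z \<in> \<Omega> \<longrightarrow> pext T y z = - pext T y (fst z + T / 2, snd z)"
        using My by (simp add: Mo_def)
      then show "AE z in lebesgue. z \<in> \<Omega> \<longrightarrow> pext T (A lam) z = - pext T (A lam) (fst z + T / 2, snd z)"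
      proof eventually_elim
        case (elim z)
        show ?case
        proof
          assume z: "z \<in> \<Omega>"
          \<comment> \<open>\<open>pext\<close> moves the time back by a multiple of
            \<open>T\<close>, which the periodicity of \<open>f\<close> undoes. Half-period
            invariance and oddness of the nonlinearity then pass the antiperiodicity of
            \<open>y\<close> on to \<open>v\<close>.\<close>
          have pv: "pext T v (t, snd z) = f t (snd z) (pext T y (t, snd z)) / u (snd z)" for t
          proof -
            have "f (t + T * of_int (- \<lfloor>t / T\<rfloor>)) (snd z) r = f t (snd z) r" for r
              by (rule periodic_int_shift[of "\<lambda>t. f t (snd z) r"]) (use f_per in blast)
            then show ?thesis by (simp add: pext_def v_def fh_def)
          qed
          define r where "r = pext T y (fst z, snd z)"
          have r: "pext T y (fst z + T / 2, snd z) = - r" using elim z by (simp add: r_def)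
          have "pext T v (fst z + T / 2, snd z) = f (fst z + T / 2) (snd z) (- r) / u (snd z)" by (simp only: pv r)
          also have "\<dots> = f (fst z) (snd z) (- r) / u (snd z)" using f_shift in_pi[OF z] by blast
          also have "\<dots> = - (f (fst z) (snd z) r / u (snd z))" using f_odd in_pi[OF z] by blast
          also have "\<dots> = - pext T v (fst z, snd z)" by (simp only: pv r_def)
          finally have pvz: "pext T v (fst z + T / 2, snd z) = - pext T v (fst z, snd z)" .
          have pA: "pext T (A lam) zz = pext T v zz - lam * pext T y zz" for zz by (simp add: pext_def A_def)
          have "pext T (A lam) (fst z + T / 2, snd z) = - (pext T v (fst z, snd z) - lam * r)"
            unfolding pA pvz r by simp
          then show "pext T (A lam) z = - pext T (A lam) (fst z + T / 2, snd z)"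
            using pA[of z] by (simp add: r_def)
        qed
      qed
    qed
    have kerA: "A ll \<in> ker_Lo u p q lh"
    proof (rule ker_LoI[OF Mo_A])
      fix b m and n :: nat assume n: "n \<ge> 1"
      show "mu u p q m n * L2.cf (A ll) (b, m, n) = lh * L2.cf (A ll) (b, m, n)"
        using res[OF n, of m b] by (auto simp: cfA[OF n])
    qed
    have kerB: "A lh \<in> ker_Lo u p q ll"
    proof (rule ker_LoI[OF Mo_A])
      fix b m and n :: nat assume n: "n \<ge> 1"
      show "mu u p q m n * L2.cf (A lh) (b, m, n) = ll * L2.cf (A lh) (b, m, n)"
        using res[OF n, of m b] by (auto simp: cfA[OF n])
    qed
    \<comment> \<open>Where \<open>y\<close> is nonzero, the slope c is \<open>ll\<close> or
      \<open>lh\<close>. If c = ll, then \<open>A ll\<close> vanishes and \<alpha>, squeezed between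
      \<open>ll\<close> and c, equals \<open>ll\<close>; if c = lh, then \<open>A lh\<close>
      vanishes and \<beta> equals \<open>lh\<close>.\<close>
    have dich: "AE z in lebesgue. z \<in> \<Omega> \<longrightarrow> (lh - \<beta> z) * (A ll z)\<^sup>2 = 0 \<and> (\<alpha> z - ll) * (A lh z)\<^sup>2 = 0"
      using AB0[unfolded AE_M] cc
    proof eventually_elim
      case (elim z)
      show ?case
      proof
        assume z: "z \<in> \<Omega>"
        then obtain c where c: "ll \<le> \<alpha> z" "\<alpha> z \<le> c" "c \<le> \<beta> z" "\<beta> z \<le> lh" "v z = c * y z" using elim(2) by blast
        have "A ll z * A lh z = 0" using elim(1) z by simp
        moreover have AA: "A ll z = (c - ll) * y z" "A lh z = (c - lh) * y z" by (simp_all add: A_def c(5) algebra_simps)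
        ultimately consider "y z = 0" | "c = ll" | "c = lh" by auto
        then show "(lh - \<beta> z) * (A ll z)\<^sup>2 = 0 \<and> (\<alpha> z - ll) * (A lh z)\<^sup>2 = 0"
          unfolding AA using c(1-4) by cases auto
      qed
    qed
    have zero_int: "(LINT z:\<Omega>|lebesgue. g z) = 0" if "AE z in lebesgue. z \<in> \<Omega> \<longrightarrow> g z = 0" for g :: "real \<times> real \<Rightarrow> real"
      unfolding set_lebesgue_integral_def
      by (rule integral_eq_zero_AE) (use that in eventually_elim, auto)
    have "(LINT z:\<Omega>|lebesgue. (lh - \<beta> z) * (A ll z)\<^sup>2) = 0"
      by (rule zero_int) (use dich in eventually_elim, simp)
    then have a1: "ae_zero T (A ll)" using nonres_high kerA by force
    have "(LINT z:\<Omega>|lebesgue. (\<alpha> z - ll) * (A lh z)\<^sup>2) = 0"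
      by (rule zero_int) (use dich in eventually_elim, simp)
    then have a2: "ae_zero T (A lh)" using nonres_low kerB by force
    show "ae_zero T y"
      using a1 a2 unfolding ae_zero_def
    proof eventually_elim
      case (elim z)
      show ?case
      proof
        assume "z \<in> \<Omega>"
        then have "A ll z - A lh z = 0" using elim by simp
        then have "(lh - ll) * y z = 0" by (simp add: A_def algebra_simps)
        then show "y z = 0" using consec(3) by simp
      qed
    qed
  qed
  then show ?thesis using weak0 by blast
qed

end
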